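(* Let $\alpha\in(1,2]$ and let $N$ be a linear fractional $\alpha$-stable motion of index $H\in(0,1)$, driven by the $\alpha$-stable Lévy process $Z$. Then there exists a unique-in-law QOU process $X$ driven by $N$ with parameter $\lambda>0$, and $X$ is a moving average of the form $$X_t=\int_{-\infty}^t\psi_{\alpha,H}(t-s)\,dZ_s,\qquad t\in\mathbb{R},$$ where $\psi_{\alpha,H}:\mathbb{R}_+\to\mathbb{R}$ is given by $$\psi_{\alpha,H}(t)=c_H\Big(t^{H-1/\alpha}-\lambda e^{-\lambda t}\int_0^te^{\lambda u}u^{H-1/\alpha}\,du\Big),\qquad t\ge0.$$ For $t\to\infty$, we have $\psi_{\alpha,H}(t)\sim\big(c_H(H-1/\alpha)/\lambda\big)t^{H-1/\alpha-1}$, and for $t\to0$, $\psi_{\alpha,H}(t)\sim c_Ht^{H-1/\alpha}$.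
   Context: Let $c_H=\dfrac{\sqrt{2H\sin(\pi H)\Gamma(2H)}}{\Gamma(H+1/2)}$. A linear fractional $\alpha$-stable motion of index $H\in(0,1)$ is the process $$N_t=\int_{\mathbb{R}}\big(f(t-s)-f(-s)\big)\,dZ_s,\quad t\in\mathbb{R},\qquad f(t)=c_Ht_+^{H-1/\alpha},$$ where $t_+^{H-1/\alpha}$ equals $t^{H-1/\alpha}$ for $t>0$ and $0$ for $t<0$, and $Z=(Z_t)_{t\in\mathbb{R}}$ is an integrable and centered $\alpha$-stable Lévy process indexed by $\mathbb{R}$; integrals of deterministic functions in $L^\alpha(\mathbb{R},\text{Lebesgue})$ with respect to $Z$ are the usual stable stochastic integrals. A measurable modification of $N$ is chosen. A QOU (quasi Ornstein--Uhlenbeck) process driven by $N$ with parameter $\lambda>0$ is a stationary process $X=(X_t)_{t\in\mathbb{R}}$ satisfying $X_t=X_0-\lambda\int_0^tX_s\,ds+N_t$ for all $t\in\mathbb{R}$, where the integral is a pathwise Lebesgue integral (with $\int_0^t=-\int_t^0$ for $t<0$). Unique in law means that any two such processes have the same law (finite-dimensional distributions). $f(t)\sim g(t)$ means $f(t)/g(t)\to1$.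
   Formalization: For t→∞ the equivalence is claimed only when H≠1/α; at H=1/α its right side is identically 0 while ψ(t)=c_H e^{-λt}, so the ratio is undefined, and instead ψ(t)/t^{H-1/α-1}→0 is proved. All other claims include H=1/α. *)

theory Defs
  imports "HOL-Probability.Probability" "HOL-Library.Landau_Symbols"
begin

section \<open>Finite-dimensional distributions\<close>

definition fdd :: "'w measure \<Rightarrow> (real \<Rightarrow> 'w \<Rightarrow> real) \<Rightarrow> real set \<Rightarrow> (real \<Rightarrow> real) measure" where
  "fdd M X J = distr M (PiM J (\<lambda>_. borel)) (\<lambda>\<omega>. \<lambda>t\<in>J. X t \<omega>)"

definition same_law :: "'w measure \<Rightarrow> (real \<Rightarrow> 'w \<Rightarrow> real) \<Rightarrow> (real \<Rightarrow> 'w \<Rightarrow> real) \<Rightarrow> bool" where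
  "same_law M X Y \<longleftrightarrow> (\<forall>J. finite J \<longrightarrow> fdd M X J = fdd M Y J)"

definition stationary :: "'w measure \<Rightarrow> (real \<Rightarrow> 'w \<Rightarrow> real) \<Rightarrow> bool" where
  "stationary M X \<longleftrightarrow> (\<forall>h. same_law M (\<lambda>t. X (t + h)) X)"

definition converges_in_prob :: "'w measure \<Rightarrow> ('a \<Rightarrow> 'w \<Rightarrow> real) \<Rightarrow> ('w \<Rightarrow> real) \<Rightarrow> 'a filter \<Rightarrow> bool" where
  "converges_in_prob M Y Y' F \<longleftrightarrow>
     (\<forall>\<epsilon>>0. ((\<lambda>i. measure M {\<omega> \<in> space M. \<bar>Y i \<omega> - Y' \<omega>\<bar> > \<epsilon>}) \<longlongrightarrow> 0) F)"


section \<open>Stable L\'evy processes indexed by the real line\<close>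

definition levy_process :: "'w measure \<Rightarrow> (real \<Rightarrow> 'w \<Rightarrow> real) \<Rightarrow> bool" where
  "levy_process M Z \<longleftrightarrow>
     (\<forall>t. Z t \<in> borel_measurable M) \<and>
     (AE \<omega> in M. Z 0 \<omega> = 0) \<and>
     (\<forall>t n. strict_mono t \<longrightarrow>
        prob_space.indep_vars M (\<lambda>_. borel)
          (\<lambda>i \<omega>. Z (t (Suc i)) \<omega> - Z (t i) \<omega>) {..<n::nat}) \<and>
     (\<forall>s t h. distr M borel (\<lambda>\<omega>. Z (t + h) \<omega> - Z (s + h) \<omega>)
            = distr M borel (\<lambda>\<omega>. Z t \<omega> - Z s \<omega>)) \<and>
     (\<forall>t. converges_in_prob M Z (Z t) (at t)) \<and>
     (AE \<omega> in M. \<forall>t. ((\<lambda>s. Z s \<omega>) \<longlongrightarrow> Z t \<omega>) (at_right t) \<and>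
                     (\<exists>l. ((\<lambda>s. Z s \<omega>) \<longlongrightarrow> l) (at_left t)))"

text \<open>
  For independent \<open>U\<close>, \<open>V\<close> with law \<open>\<mu>\<close> and all \<open>a, b > 0\<close>, the variable \<open>a U + b V\<close> has the law
  of \<open>c U + d\<close>, where \<open>c\<^sup>\<alpha> = a\<^sup>\<alpha> + b\<^sup>\<alpha>\<close>. Skewed laws are covered, as are the Gaussian ones
  (\<open>\<alpha> = 2\<close>). Point masses satisfy the condition for every \<open>\<alpha>\<close> and are not excluded.
\<close>
definition stable_law :: "real \<Rightarrow> real measure \<Rightarrow> bool" where
  "stable_law \<alpha> \<mu> \<longleftrightarrow>
     (\<forall>a>0. \<forall>b>0. \<exists>d.
        convolution (distr \<mu> borel (\<lambda>x. a * x)) (distr \<mu> borel (\<lambda>x. b * x))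
        = distr \<mu> borel (\<lambda>x. (a powr \<alpha> + b powr \<alpha>) powr (1 / \<alpha>) * x + d))"

definition stable_levy_process :: "'w measure \<Rightarrow> real \<Rightarrow> (real \<Rightarrow> 'w \<Rightarrow> real) \<Rightarrow> bool" where
  "stable_levy_process M \<alpha> Z \<longleftrightarrow> levy_process M Z \<and> stable_law \<alpha> (distr M borel (Z 1))"

definition centered :: "'w measure \<Rightarrow> (real \<Rightarrow> 'w \<Rightarrow> real) \<Rightarrow> bool" where
  "centered M Z \<longleftrightarrow> (\<forall>t. integrable M (Z t) \<and> integral\<^sup>L M (Z t) = 0)"


section \<open>Stable stochastic integrals\<close>

text \<open>
  A list of triples \<open>(c, a, b)\<close> with \<open>a \<le> b\<close> stands for the step function
  \<open>\<Sum> c 1\<^bsub>(a,b]\<^esub>\<close>, whose integral with respect to \<open>Z\<close> is \<open>\<Sum> c (Z\<^sub>b - Z\<^sub>a)\<close>.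
\<close>
definition step_fun :: "(real \<times> real \<times> real) list \<Rightarrow> real \<Rightarrow> real" where
  "step_fun xs s = (\<Sum>(c, a, b)\<leftarrow>xs. c * indicator {a<..b} s)"

definition step_integral ::
    "(real \<Rightarrow> 'w \<Rightarrow> real) \<Rightarrow> (real \<times> real \<times> real) list \<Rightarrow> 'w \<Rightarrow> real" where
  "step_integral Z xs \<omega> = (\<Sum>(c, a, b)\<leftarrow>xs. c * (Z b \<omega> - Z a \<omega>))"

text \<open>
  \<open>Y\<close> is a version of \<open>\<integral> f dZ\<close>: \<open>f \<in> L\<^sup>\<alpha>\<close>, and \<open>Y\<close> is the limit in probability of the integrals of
  step functions converging to \<open>f\<close> in \<open>L\<^sup>\<alpha>\<close>. This is a relation because the integral is
  determined only up to almost sure equality.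
\<close>
definition has_stable_integral ::
    "'w measure \<Rightarrow> real \<Rightarrow> (real \<Rightarrow> 'w \<Rightarrow> real) \<Rightarrow> (real \<Rightarrow> real) \<Rightarrow> ('w \<Rightarrow> real) \<Rightarrow> bool" where
  "has_stable_integral M \<alpha> Z f Y \<longleftrightarrow>
     f \<in> borel_measurable lborel \<and>
     integrable lborel (\<lambda>s. \<bar>f s\<bar> powr \<alpha>) \<and>
     Y \<in> borel_measurable M \<and>
     (\<exists>S :: nat \<Rightarrow> (real \<times> real \<times> real) list.
        (\<forall>n. \<forall>(c, a, b) \<in> set (S n). a \<le> b) \<and>
        (\<lambda>n. \<integral>s. \<bar>step_fun (S n) s - f s\<bar> powr \<alpha> \<partial>lborel) \<longlonglongrightarrow> 0 \<and>
        converges_in_prob M (\<lambda>n. step_integral Z (S n)) Y sequentially)"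


section \<open>Linear fractional stable motions\<close>

definition c_H :: "real \<Rightarrow> real" where
  "c_H H = sqrt (2 * H * sin (pi * H) * Gamma (2 * H)) / Gamma (H + 1 / 2)"

definition lfsm_fun :: "real \<Rightarrow> real \<Rightarrow> real \<Rightarrow> real" where
  "lfsm_fun \<alpha> H t = (if t > 0 then c_H H * t powr (H - 1 / \<alpha>) else 0)"

text \<open>The first conjunct says that \<open>N\<close> is a measurable version of the process.\<close>
definition linear_fractional_stable_motion ::
    "'w measure \<Rightarrow> real \<Rightarrow> real \<Rightarrow> (real \<Rightarrow> 'w \<Rightarrow> real) \<Rightarrow> (real \<Rightarrow> 'w \<Rightarrow> real) \<Rightarrow> bool" where
  "linear_fractional_stable_motion M \<alpha> H Z N \<longleftrightarrow>
     (\<lambda>(t, \<omega>). N t \<omega>) \<in> borel_measurable (borel \<Otimes>\<^sub>M M) \<and>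
     (\<forall>t. has_stable_integral M \<alpha> Z (\<lambda>s. lfsm_fun \<alpha> H (t - s) - lfsm_fun \<alpha> H (- s)) (N t))"


section \<open>Quasi Ornstein--Uhlenbeck processes\<close>

text \<open>
  Integrability on \<open>[0, t]\<close> is required because non-integrable functions have integral \<open>0\<close> in HOL.
  For \<open>t < 0\<close>, the interval integral is \<open>\<integral>\<^sub>0\<^sup>t = - \<integral>\<^sub>t\<^sup>0\<close>.
\<close>
definition QOU_process ::
    "'w measure \<Rightarrow> (real \<Rightarrow> 'w \<Rightarrow> real) \<Rightarrow> real \<Rightarrow> (real \<Rightarrow> 'w \<Rightarrow> real) \<Rightarrow> bool" where
  "QOU_process M N l X \<longleftrightarrow>
     (\<forall>t. X t \<in> borel_measurable M) \<and>
     stationary M X \<and>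
     (AE \<omega> in M. \<forall>t.
        interval_lebesgue_integrable lborel (ereal 0) (ereal t) (\<lambda>s. X s \<omega>) \<and>
        X t \<omega> = X 0 \<omega> - l * (LBINT s=ereal 0..ereal t. X s \<omega>) + N t \<omega>)"

text \<open>
  Meaningful for \<open>t \<ge> 0\<close>. The value at \<open>0\<close>, where \<open>0 powr x = 0\<close>, does not matter: it affects
  neither the stochastic integral of the function nor its asymptotics.
\<close>
definition psi :: "real \<Rightarrow> real \<Rightarrow> real \<Rightarrow> real \<Rightarrow> real" where
  "psi \<alpha> H l t =
     c_H H * (t powr (H - 1 / \<alpha>)
       - l * exp (- l * t) * (LBINT u=ereal 0..ereal t. exp (l * u) * u powr (H - 1 / \<alpha>)))"

end

theory Submission
  imports Defs
begin

text \<open>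
  Strict stability (the shift vanishes because \<open>Z\<close> is centered) and uniqueness of characteristic
  functions show that \<open>\<integral> f dZ\<close> has the law of \<open>\<parallel>f\<parallel>\<^sub>\<alpha> Z\<^sub>1\<close> for step functions \<open>f \<ge> 0\<close>. Hence
  \<open>E\<bar>\<integral> f dZ\<bar> \<le> C \<parallel>f\<parallel>\<^sub>\<alpha>\<close>, and all limits can be taken in \<open>L\<^sup>1\<close>. By scaling,
  \<open>E\<bar>N\<^sub>t - N\<^sub>u\<bar> \<le> C \<bar>t - u\<bar>\<^sup>H\<close>, so with an independent exponential time \<open>v\<close> of rate \<open>l\<close> the process
  \<open>Y\<^sub>t = N\<^sub>t - E\<^sub>v N\<^bsub>t-v\<^esub> = N\<^sub>t - l \<integral>\<^sub>0\<^sup>\<infinity> exp (- l v) N\<^bsub>t-v\<^esub> dv\<close> exists. Discretising \<open>v\<close> and applying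
  Jensen's inequality to the kernels identifies \<open>Y\<^sub>t\<close> as the stable integral of
  \<open>E\<^sub>v (f (t - s) - f (t - v - s)) = psi (t - s)\<close>; its law is translation invariant because the
  increments of \<open>Z\<close> are stationary and independent. Fubini's theorem shows that the paths of \<open>Y\<close>
  solve the integral equation. Two solutions differ by \<open>D exp (- l t)\<close>, and \<open>t \<rightarrow> -\<infinity>\<close> together with
  stationarity gives \<open>D = 0\<close>. The asymptotics at infinity follow from l'Hopital's rule.
\<close>

text \<open>Stability is assumed for the law of \<open>Z 1\<close> alone. The law of an increment
  over a time t is recovered from independence and stationarity: its characteristic function is
  identified first for t = 1/n, as an n-th root, then for rational t, then for all t > 0 by
  continuity in probability. Skewness rules out an isometry: a sign change in the integrand may
  alter the law of the integral, so the exact identity is kept for nonnegative weights, and signed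
  ones get only an inequality. That is enough, since all later uses are limits: the integral is a
  relation defined by convergence in probability, and the moment bound makes it closed under joint
  limits in \<open>L^\<alpha>\<close> and \<open>L^1\<close>. The main obstacle is the interchange
  of the exponential average with the stable integral. Linearity covers finite averages; the bounds
  of order |v - v'|^(\<alpha> H) for kernels and |v - v'|^H for the noise control the passage from a
  finite grid to the exponential law. \<open>Y\<close> comes from X' = -l X + N' by variation of
  constants from time minus infinity and integration by parts, which leaves only ordinary integrals
  of paths of \<open>N\<close>.\<close>

definition steps_ok :: "(real \<times> real \<times> real) list \<Rightarrow> bool" where
  "steps_ok xs \<longleftrightarrow> (\<forall>(c, a, b) \<in> set xs. a \<le> b)"

lemma steps_ok_simps [simp]:
  "steps_ok []"
  "steps_ok ((c, a, b) # xs) \<longleftrightarrow> a \<le> b \<and> steps_ok xs"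
  "steps_ok (xs @ ys) \<longleftrightarrow> steps_ok xs \<and> steps_ok ys"
  unfolding steps_ok_def by (simp_all add: ball_Un)

lemma step_integral_simps [simp]:
  "step_integral Z [] \<omega> = 0"
  "step_integral Z ((c, a, b) # xs) \<omega> = c * (Z b \<omega> - Z a \<omega>) + step_integral Z xs \<omega>"
  "step_integral Z (xs @ ys) \<omega> = step_integral Z xs \<omega> + step_integral Z ys \<omega>"
  by (auto simp: step_integral_def)

lemma step_fun_simps [simp]:
  "step_fun [] s = 0"
  "step_fun ((c, a, b) # xs) s = c * indicator {a<..b} s + step_fun xs s"
  "step_fun (xs @ ys) s = step_fun xs s + step_fun ys s"
  by (auto simp: step_fun_def)

lemma borel_measurable_step_fun [measurable]: "step_fun xs \<in> borel_measurable borel"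
proof (induction xs)
  case (Cons x xs)
  obtain c a b where x: "x = (c, a, b)" by (cases x)
  have "step_fun (x # xs) = (\<lambda>s. c * indicator {a<..b} s + step_fun xs s)"
    by (simp add: x fun_eq_iff)
  with Cons show ?case by simp
qed (simp add: step_fun_def)

text \<open>Step functions are step integrals of a deterministic integrator, so that one partition lemma
  serves both.\<close>
lemma step_fun_eq_step_integral:
  assumes "steps_ok xs"
  shows "step_fun xs s = step_integral (\<lambda>x _. of_bool (s \<le> x)) xs \<omega>"
  using assms by (induction xs) (auto simp: indicator_def)

section \<open>Refining step functions along a common partition\<close>

lemma increment_eq_partition_sum:
  fixes t :: "nat \<Rightarrow> real" and z :: "real \<Rightarrow> real"
  assumes t: "strict_mono t" and "p \<le> q" "q \<le> n"
  shows "z (t q) - z (t p) =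
    (\<Sum>i<n. indicator {t p<..t q} (t (Suc i)) * (z (t (Suc i)) - z (t i)))"
proof -
  have "(\<Sum>i<n. indicator {t p<..t q} (t (Suc i)) * (z (t (Suc i)) - z (t i))) =
      (\<Sum>i\<in>{p..<q}. z (t (Suc i)) - z (t i))"
    using assms
    by (intro sum.mono_neutral_cong_right)
       (auto simp: indicator_def strict_mono_less strict_mono_less_eq)
  also have "\<dots> = z (t q) - z (t p)"
    using sum_Suc_diff'[of p q "\<lambda>i. z (t i)"] assms by simp
  finally show ?thesis by simp
qed

text \<open>A half-open cell lies in an interval with endpoints among the \<open>t i\<close> exactly
  when its right endpoint does, so a step function is constant on each cell with the value taken at
  \<open>t (Suc i)\<close>. This replaces possibly overlapping intervals by disjoint cells, whose
  increments are independent.\<close>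

lemma step_integral_partition:
  fixes t :: "nat \<Rightarrow> real"
  assumes t: "strict_mono t" and "steps_ok xs"
    and "\<And>c a b. (c, a, b) \<in> set xs \<Longrightarrow> a \<in> t ` {..n} \<and> b \<in> t ` {..n}"
  shows "step_integral Z xs \<omega> =
    (\<Sum>i<n. step_fun xs (t (Suc i)) * (Z (t (Suc i)) \<omega> - Z (t i) \<omega>))"
  using assms(2,3)
proof (induction xs)
  case (Cons x xs)
  obtain c a b where x: "x = (c, a, b)" by (cases x)
  have ab: "a \<le> b" using Cons.prems(1) by (simp add: x)
  obtain p q where pq: "a = t p" "b = t q" "p \<le> n" "q \<le> n"
    using Cons.prems(2)[of c a b] by (auto simp: x)
  have "p \<le> q" using ab t by (simp add: pq strict_mono_less_eq)
  have "Z b \<omega> - Z a \<omega> = (\<Sum>i<n. indicator {a<..b} (t (Suc i)) * (Z (t (Suc i)) \<omega> - Z (t i) \<omega>))"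
    using increment_eq_partition_sum[OF t \<open>p \<le> q\<close> \<open>q \<le> n\<close>, of "\<lambda>x. Z x \<omega>"] by (simp add: pq)
  moreover have "step_integral Z xs \<omega> =
      (\<Sum>i<n. step_fun xs (t (Suc i)) * (Z (t (Suc i)) \<omega> - Z (t i) \<omega>))"
    using Cons.prems by (intro Cons.IH) (auto simp: x)
  ultimately show ?case
    by (simp only: x step_integral_simps step_fun_simps distrib_right sum.distrib sum_distrib_left mult.assoc)
qed simp

lemma step_fun_partition:
  fixes t :: "nat \<Rightarrow> real"
  assumes t: "strict_mono t" and "steps_ok xs"
    and "\<And>c a b. (c, a, b) \<in> set xs \<Longrightarrow> a \<in> t ` {..n} \<and> b \<in> t ` {..n}"
  shows "step_fun xs s = (\<Sum>i<n. step_fun xs (t (Suc i)) * indicator {t i<..t (Suc i)} s)"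
proof -
  have "step_fun xs s = step_integral (\<lambda>x _. of_bool (s \<le> x)) xs ()"
    by (rule step_fun_eq_step_integral) fact
  also have "\<dots> = (\<Sum>i<n. step_fun xs (t (Suc i)) * (of_bool (s \<le> t (Suc i)) - of_bool (s \<le> t i)))"
    by (rule step_integral_partition) fact+
  also have "\<dots> = (\<Sum>i<n. step_fun xs (t (Suc i)) * indicator {t i<..t (Suc i)} s)"
  proof (intro sum.cong refl)
    fix i show "step_fun xs (t (Suc i)) * (of_bool (s \<le> t (Suc i)) - of_bool (s \<le> t i))
      = step_fun xs (t (Suc i)) * indicator {t i<..t (Suc i)} s"
      using strict_monoD[OF t, of i "Suc i"] by (auto simp: indicator_def)
  qed
  finally show ?thesis .
qed

text \<open>Independence of increments is formulated along strictly increasing sequences indexed by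
  all naturals, so a finite set of endpoints is sorted and then continued to infinity.\<close>

lemma ex_strict_mono_enumeration:
  fixes P :: "real set"
  assumes "finite P"
  shows "\<exists>t n. strict_mono (t :: nat \<Rightarrow> real) \<and> P \<subseteq> t ` {..n}"
proof -
  \<comment> \<open>Inserting 0 keeps the list nonempty, so that \<open>last xs\<close> is
    meaningful; beyond the list the points continue in unit steps.\<close>
  define xs where "xs = sorted_list_of_set (insert 0 P)"
  have set: "set xs = insert 0 P" and sd: "sorted_wrt (<) xs"
    using assms unfolding xs_def
    by (auto simp del: sorted_list_of_set_insert_remove)
  define t where "t i = (if i < length xs then xs ! i else last xs + real (Suc i - length xs))" for i
  have ne: "xs \<noteq> []" using set by auto
  have "t i < t (Suc i)" for i
  proof (cases "Suc i < length xs")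
    case True
    then show ?thesis using sd by (auto simp: t_def sorted_wrt_iff_nth_less)
  next
    case False
    moreover have "i = length xs - 1" if "Suc i = length xs" using that by simp
    ultimately show ?thesis using ne by (cases "Suc i = length xs") (auto simp: t_def last_conv_nth)
  qed
  then have "strict_mono t" by (simp add: strict_mono_Suc_iff)
  moreover have "P \<subseteq> t ` {..length xs}"
  proof
    fix x assume "x \<in> P"
    then obtain i where "i < length xs" "xs ! i = x"
      using set by (metis in_set_conv_nth insert_iff)
    then show "x \<in> t ` {..length xs}" by (intro image_eqI[of _ _ i]) (auto simp: t_def)
  qed
  ultimately show ?thesis by blast
qed

lemma ex_common_partition:
  fixes xss :: "(real \<times> real \<times> real) list set"
  assumes "finite xss"
  obtains t :: "nat \<Rightarrow> real" and n where "strict_mono t"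
    "\<And>xs c a b. xs \<in> xss \<Longrightarrow> (c, a, b) \<in> set xs \<Longrightarrow> a \<in> t ` {..n} \<and> b \<in> t ` {..n}"
proof -
  define P where "P = (\<Union>xs\<in>xss. \<Union>(c, a, b)\<in>set xs. {a, b})"
  have "finite P" unfolding P_def using assms by auto
  then obtain t n where tn: "strict_mono (t :: nat \<Rightarrow> real)" "P \<subseteq> t ` {..n}"
    using ex_strict_mono_enumeration by blast
  have "{a, b} \<subseteq> t ` {..n}" if "xs \<in> xss" "(c, a, b) \<in> set xs" for xs c a b
  proof -
    have "{a, b} \<subseteq> P" unfolding P_def using that by fastforce
    with tn show ?thesis by blast
  qed
  then show thesis using that[of t n] tn(1) by simp
qed

text \<open>The cells are disjoint, so at each point at most one term is nonzero and the power can
  be taken term by term.\<close>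

lemma
  fixes t c :: "nat \<Rightarrow> real"
  assumes t: "strict_mono t" and p: "p \<noteq> 0"
  shows integrable_partition_powr:
      "integrable lborel (\<lambda>s. \<bar>\<Sum>i<n. c i * indicator {t i<..t (Suc i)} s\<bar> powr p)" (is ?A)
    and integral_partition_powr:
      "(\<integral>s. \<bar>\<Sum>i<n. c i * indicator {t i<..t (Suc i)} s\<bar> powr p \<partial>lborel) =
        (\<Sum>i<n. \<bar>c i\<bar> powr p * (t (Suc i) - t i))" (is ?B)
proof -
  have eq: "\<bar>\<Sum>i<n. c i * indicator {t i<..t (Suc i)} s\<bar> powr p =
      (\<Sum>i<n. \<bar>c i\<bar> powr p * indicator {t i<..t (Suc i)} s)" for s
  proof (cases "\<exists>j<n. s \<in> {t j<..t (Suc j)}")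
    case True
    then obtain j where j: "j < n" "t j < s" "s \<le> t (Suc j)" by auto
    have ind: "indicator {t i<..t (Suc i)} s = (of_bool (i = j) :: real)" for i
    proof (cases i j rule: linorder_cases)
      case less
      then have "t (Suc i) \<le> t j" using t by (simp add: strict_mono_less_eq)
      then show ?thesis using less j by (auto simp: indicator_def)
    next
      case greater
      then have "t (Suc j) \<le> t i" using t by (simp add: strict_mono_less_eq)
      then show ?thesis using greater j by (auto simp: indicator_def)
    qed (use j in auto)
    show ?thesis using j by (simp add: ind)
  next
    case False
    then have ind: "indicator {t i<..t (Suc i)} s = (0::real)" if "i < n" for i
      using that by (auto simp: indicator_def)
    show ?thesis by (simp add: ind p)
  qed
  have le: "t i \<le> t (Suc i)" for i using t by (simp add: strict_mono_less_eq)
  show ?A unfolding eq by (intro Bochner_Integration.integrable_sum integrable_mult_right)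
      (auto simp: le emeasure_lborel_Ioc)
  show ?B unfolding eq
    by (subst Bochner_Integration.integral_sum) (auto simp: le emeasure_lborel_Ioc)
qed

section \<open>Increments of a centered stable process\<close>

locale centered_stable_levy = prob_space M for M :: "'w measure" +
  fixes \<alpha> :: real and Z :: "real \<Rightarrow> 'w \<Rightarrow> real"
  assumes alpha_gt_1: "1 < \<alpha>"
    and stable: "stable_levy_process M \<alpha> Z"
    and centered: "centered M Z"
begin

lemma Z_measurable [measurable]: "Z t \<in> borel_measurable M"
  using stable by (auto simp: stable_levy_process_def levy_process_def)

lemma Z_integrable [simp]: "integrable M (Z t)"
  using centered by (auto simp: centered_def)

lemma Z_0: "AE \<omega> in M. Z 0 \<omega> = 0"
  using stable by (auto simp: stable_levy_process_def levy_process_def)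

lemma indep_increments:
  "strict_mono t \<Longrightarrow> indep_vars (\<lambda>_. borel) (\<lambda>i \<omega>. Z (t (Suc i)) \<omega> - Z (t i) \<omega>) {..<n::nat}"
  using stable by (auto simp: stable_levy_process_def levy_process_def)

lemma stationary_increments:
  "distr M borel (\<lambda>\<omega>. Z (t + h) \<omega> - Z (s + h) \<omega>) = distr M borel (\<lambda>\<omega>. Z t \<omega> - Z s \<omega>)"
  using stable by (auto simp: stable_levy_process_def levy_process_def)

lemma Z_continuous_in_prob: "converges_in_prob M Z (Z t) (at t)"
  using stable by (auto simp: stable_levy_process_def levy_process_def)

lemma step_integral_measurable [measurable]: "step_integral Z xs \<in> borel_measurable M"
  unfolding step_integral_def by (induction xs) auto

lemma integrable_step_integral [simp]: "integrable M (step_integral Z xs)"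
  unfolding step_integral_def by (induction xs) auto

section \<open>Strict stability of the law of \<open>Z 1\<close>\<close>

definition \<phi> :: "real \<Rightarrow> complex" where "\<phi> = char (distr M borel (Z 1))"

lemma char_distr_scale:
  assumes [measurable]: "X \<in> borel_measurable M"
  shows "char (distr M borel (\<lambda>\<omega>. c * X \<omega>)) u = char (distr M borel X) (c * u)"
  by (simp add: char_def integral_distr mult_ac)

lemma \<phi>_0: "\<phi> 0 = 1"
  unfolding \<phi>_def by (intro real_distribution.char_zero) simp

lemma isCont_\<phi>: "isCont \<phi> u"
  unfolding \<phi>_def by (intro real_distribution.isCont_char) simp

text \<open>Being centered forces the shift in the definition of stability to vanish.\<close>
lemma \<phi>_mult_pos:
  assumes "a > 0" "b > 0"
  shows "\<phi> (a * u) * \<phi> (b * u) = \<phi> ((a powr \<alpha> + b powr \<alpha>) powr (1 / \<alpha>) * u)"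
proof -
  define \<mu> where "\<mu> = distr M borel (Z 1)"
  define c where "c = (a powr \<alpha> + b powr \<alpha>) powr (1 / \<alpha>)"
  interpret \<mu>: real_distribution \<mu> unfolding \<mu>_def by simp
  interpret P: pair_prob_space \<mu> \<mu> ..
  from stable assms obtain d where d:
    "convolution (distr \<mu> borel (\<lambda>x. a * x)) (distr \<mu> borel (\<lambda>x. b * x)) = distr \<mu> borel (\<lambda>x. c * x + d)"
    unfolding stable_levy_process_def stable_law_def \<mu>_def c_def by blast
  have conv: "convolution (distr \<mu> borel (\<lambda>x. a * x)) (distr \<mu> borel (\<lambda>x. b * x)) =
      distr (\<mu> \<Otimes>\<^sub>M \<mu>) borel (\<lambda>p. a * fst p + b * snd p)"
  proof -
    have "distr \<mu> borel (\<lambda>x. a * x) \<Otimes>\<^sub>M distr \<mu> borel (\<lambda>x. b * x) =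
        distr (\<mu> \<Otimes>\<^sub>M \<mu>) (borel \<Otimes>\<^sub>M borel) (\<lambda>(x, y). (a * x, b * y))"
      by (rule pair_measure_distr)
         (auto intro!: finite_measure.sigma_finite_measure prob_space.finite_measure \<mu>.prob_space_distr)
    then show ?thesis
      unfolding convolution_def by (simp add: distr_distr comp_def case_prod_beta)
  qed
  have int: "integrable \<mu> (\<lambda>x. x)" "(\<integral>x. x \<partial>\<mu>) = 0"
    using centered by (auto simp: \<mu>_def integrable_distr_eq integral_distr centered_def)
  have id_meas: "(\<lambda>x. x) \<in> borel_measurable \<mu>"
    by measurable
  have fw: "distr (\<mu> \<Otimes>\<^sub>M \<mu>) \<mu> fst = \<mu>"
    by (rule \<mu>.distr_pair_fst)
  have int_fst: "integrable (\<mu> \<Otimes>\<^sub>M \<mu>) fst" "(\<integral>p. fst p \<partial>(\<mu> \<Otimes>\<^sub>M \<mu>)) = 0"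
    using integrable_distr_eq[OF measurable_fst id_meas, of \<mu>, unfolded fw, THEN iffD1, OF int(1)]
      integral_distr[OF measurable_fst id_meas, of \<mu>, unfolded fw int(2), symmetric]
    by (simp_all only:)

  have int_snd: "integrable (\<mu> \<Otimes>\<^sub>M \<mu>) snd" "(\<integral>p. snd p \<partial>(\<mu> \<Otimes>\<^sub>M \<mu>)) = 0"
    using P.integrable_product_swap[OF int_fst(1)] P.integral_product_swap[of fst] int_fst
    by (simp_all add: snd_def[abs_def])
  have "(\<integral>x. x \<partial>distr \<mu> borel (\<lambda>x. c * x + d)) = (\<integral>x. x \<partial>distr (\<mu> \<Otimes>\<^sub>M \<mu>) borel (\<lambda>p. a * fst p + b * snd p))"
    unfolding d[symmetric] conv ..
  moreover have "(\<integral>x. x \<partial>distr \<mu> borel (\<lambda>x. c * x + d)) = (\<integral>x. c * x + d \<partial>\<mu>)"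
    by (rule integral_distr) measurable
  moreover have "(\<integral>x. c * x + d \<partial>\<mu>) = d"
    using \<mu>.prob_space by (subst Bochner_Integration.integral_add) (simp_all add: int)
  moreover have "(\<integral>x. x \<partial>distr (\<mu> \<Otimes>\<^sub>M \<mu>) borel (\<lambda>p. a * fst p + b * snd p)) =
      (\<integral>p. a * fst p + b * snd p \<partial>(\<mu> \<Otimes>\<^sub>M \<mu>))"
    by (rule integral_distr) measurable
  moreover have "(\<integral>p. a * fst p + b * snd p \<partial>(\<mu> \<Otimes>\<^sub>M \<mu>)) = 0"
    by (subst Bochner_Integration.integral_add) (simp_all add: int_fst int_snd)
  ultimately have "d = 0" by simp
  have 1: "char (distr \<mu> borel (\<lambda>x. c * x + d)) u = \<phi> (c * u)"
    by (simp add: \<open>d = 0\<close> char_def \<phi>_def \<mu>_def integral_distr mult_ac)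
  have "char (distr (\<mu> \<Otimes>\<^sub>M \<mu>) borel (\<lambda>p. a * fst p + b * snd p)) u =
      (\<integral>p. iexp (a * u * fst p) * iexp (b * u * snd p) \<partial>(\<mu> \<Otimes>\<^sub>M \<mu>))"
    by (simp add: char_def integral_distr algebra_simps exp_add)
  also have "\<dots> = (\<integral>x. \<integral>y. iexp (a * u * x) * iexp (b * u * y) \<partial>\<mu> \<partial>\<mu>)"
    by (subst P.integral_fst'[symmetric])
       (auto intro!: P.P.integrable_const_bound[where B=1] simp: norm_mult norm_exp_i_times simp flip: of_real_mult)
  also have "\<dots> = char \<mu> (a * u) * char \<mu> (b * u)"
    by (simp add: char_def)
  finally have 2: "char (distr (\<mu> \<Otimes>\<^sub>M \<mu>) borel (\<lambda>p. a * fst p + b * snd p)) u = \<phi> (a * u) * \<phi> (b * u)"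
    by (simp add: \<phi>_def \<mu>_def)
  show ?thesis using 1 2 d conv by (simp add: c_def)
qed

lemma \<phi>_mult:
  assumes "a \<ge> 0" "b \<ge> 0"
  shows "\<phi> (a * u) * \<phi> (b * u) = \<phi> ((a powr \<alpha> + b powr \<alpha>) powr (1 / \<alpha>) * u)"
proof -
  consider "a = 0" | "b = 0" | "a > 0" "b > 0" using assms by fastforce
  then show ?thesis
    using \<phi>_mult_pos[of a b u] assms alpha_gt_1 by cases (auto simp: \<phi>_0 powr_powr)
qed

lemma \<phi>_prod:
  assumes "finite I" "\<And>i. i \<in> I \<Longrightarrow> a i \<ge> 0"
  shows "(\<Prod>i\<in>I. \<phi> (a i * u)) = \<phi> ((\<Sum>i\<in>I. a i powr \<alpha>) powr (1 / \<alpha>) * u)"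
  using assms
proof (induction I)
  case (insert j I)
  have "(\<Prod>i\<in>insert j I. \<phi> (a i * u)) = \<phi> (a j * u) * \<phi> ((\<Sum>i\<in>I. a i powr \<alpha>) powr (1 / \<alpha>) * u)"
    using insert by simp
  also have "\<dots> = \<phi> ((a j powr \<alpha> + ((\<Sum>i\<in>I. a i powr \<alpha>) powr (1 / \<alpha>)) powr \<alpha>) powr (1 / \<alpha>) * u)"
    using insert by (intro \<phi>_mult) auto
  also have "((\<Sum>i\<in>I. a i powr \<alpha>) powr (1 / \<alpha>)) powr \<alpha> = (\<Sum>i\<in>I. a i powr \<alpha>)"
    using alpha_gt_1 by (simp add: powr_powr sum_nonneg)
  finally show ?case using insert by simp
qed (simp add: \<phi>_0)

lemma \<phi>_power: "\<phi> u ^ n = \<phi> (real n powr (1 / \<alpha>) * u)"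
  using \<phi>_prod[of "{..<n}" "\<lambda>_. 1" u] by simp

text \<open>A zero \<open>u\<close> would produce zeros \<open>a ^ k * u\<close> converging to 0,
  where \<open>\<phi>\<close> is continuous with value 1. This permits the division by
  \<open>\<phi>\<close> in the comparison of n-th roots.\<close>

lemma \<phi>_nonzero: "\<phi> u \<noteq> 0"
proof
  assume u: "\<phi> u = 0"
  \<comment> \<open>With this \<open>a\<close>, two independent copies of weight \<open>a\<close>
    recombine to weight 1, so \<open>\<phi>\<close> at a point is the square of
    \<open>\<phi>\<close> at \<open>a\<close> times that point.\<close>
  define a where "a = (1 / 2) powr (1 / \<alpha>)"
  have a: "0 < a" "a < 1" using alpha_gt_1 powr_less_mono2[of "1 / \<alpha>" "1 / 2" 1] by (auto simp: a_def)
  have aa: "(a powr \<alpha> + a powr \<alpha>) powr (1 / \<alpha>) = 1"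
    using alpha_gt_1 by (simp add: a_def powr_powr)
  have zero: "\<phi> (a ^ k * u) = 0" for k
  proof (induction k)
    case (Suc k)
    have "\<phi> (a * (a ^ k * u)) * \<phi> (a * (a ^ k * u)) = \<phi> (a ^ k * u)"
      using \<phi>_mult_pos[OF a(1) a(1), of "a ^ k * u"] unfolding aa by simp
    with Suc show ?case by (simp add: mult_ac)
  qed (use u in simp)
  have "(\<lambda>k. a ^ k * u) \<longlonglongrightarrow> 0"
    using a by (auto intro!: tendsto_mult_left_zero LIMSEQ_power_zero)
  then have "(\<lambda>k. \<phi> (a ^ k * u)) \<longlonglongrightarrow> \<phi> 0"
    by (intro isCont_tendsto_compose[OF isCont_\<phi>])
  then show False by (simp add: zero \<phi>_0 LIMSEQ_const_iff)
qed

section \<open>Characteristic functions of increments over arbitrary times\<close>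

definition \<kappa> :: "real \<Rightarrow> real \<Rightarrow> complex" where
  "\<kappa> t = char (distr M borel (\<lambda>\<omega>. Z t \<omega> - Z 0 \<omega>))"

text \<open>\<open>Z 0\<close> vanishes only almost surely. Since \<open>\<kappa>\<close> subtracts
  it, \<open>\<kappa> t\<close> is the transform of a genuine increment, and stationarity applies
  directly.\<close>

lemma char_increment: "char (distr M borel (\<lambda>\<omega>. Z t \<omega> - Z s \<omega>)) = \<kappa> (t - s)"
  using stationary_increments[of "t - s" s 0] by (simp add: \<kappa>_def)

lemma \<kappa>_1: "\<kappa> 1 = \<phi>"
proof -
  have "distr M borel (\<lambda>\<omega>. Z 1 \<omega> - Z 0 \<omega>) = distr M borel (Z 1)"
    using Z_0 by (intro distr_cong_AE) auto
  then show ?thesis by (simp add: \<kappa>_def \<phi>_def)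
qed

lemma isCont_\<kappa>: "isCont (\<kappa> t) u"
  unfolding \<kappa>_def by (intro real_distribution.isCont_char) simp

lemma char_weighted_increments:
  assumes "strict_mono t"
  shows "char (distr M borel (\<lambda>\<omega>. \<Sum>i<n. c i * (Z (t (Suc i)) \<omega> - Z (t i) \<omega>))) u =
    (\<Prod>i<n. \<kappa> (t (Suc i) - t i) (c i * u))"
proof -
  have "indep_vars (\<lambda>_. borel) (\<lambda>i \<omega>. c i * (Z (t (Suc i)) \<omega> - Z (t i) \<omega>)) {..<n}"
    using indep_vars_compose2[OF indep_increments[OF assms, of n], of "\<lambda>i x. c i * x" "\<lambda>_. borel"]
    by simp
  then have "char (distr M borel (\<lambda>\<omega>. \<Sum>i<n. c i * (Z (t (Suc i)) \<omega> - Z (t i) \<omega>))) u =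
      (\<Prod>i<n. char (distr M borel (\<lambda>\<omega>. c i * (Z (t (Suc i)) \<omega> - Z (t i) \<omega>))) u)"
    by (rule char_distr_sum)
  also have "\<dots> = (\<Prod>i<n. \<kappa> (t (Suc i) - t i) (c i * u))"
    by (intro prod.cong refl) (subst char_distr_scale, simp_all add: char_increment)
  finally show ?thesis .
qed

lemma \<kappa>_power:
  assumes "h > 0"
  shows "\<kappa> (real n * h) u = \<kappa> h u ^ n"
proof -
  have "strict_mono (\<lambda>i. real i * h)" using assms by (auto simp: strict_mono_def)
  from char_weighted_increments[OF this, of "\<lambda>_. 1" n u]
  have "char (distr M borel (\<lambda>\<omega>. \<Sum>i<n. Z (real (Suc i) * h) \<omega> - Z (real i * h) \<omega>)) u = \<kappa> h u ^ n"
    by (simp add: algebra_simps)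
  also have "(\<lambda>\<omega>. \<Sum>i<n. Z (real (Suc i) * h) \<omega> - Z (real i * h) \<omega>) = (\<lambda>\<omega>. Z (real n * h) \<omega> - Z 0 \<omega>)"
    by (simp add: sum_lessThan_telescope[of "\<lambda>i. Z (real i * h) _"] del: of_nat_Suc)
  finally show ?thesis by (simp add: \<kappa>_def)
qed

text \<open>Two continuous non-vanishing \<open>n\<close>-th roots of the same function that agree at \<open>0\<close> are equal,
  as their quotient takes values in the finite set of \<open>n\<close>-th roots of unity.\<close>
lemma \<kappa>_inverse_nat:
  assumes "n > 0"
  shows "\<kappa> (1 / real n) u = \<phi> ((1 / real n) powr (1 / \<alpha>) * u)"
proof -
  define r where "r u = \<kappa> (1 / real n) u / \<phi> ((1 / real n) powr (1 / \<alpha>) * u)" for u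
  have "r u ^ n = 1" for u
  proof -
    have "\<kappa> (1 / real n) u ^ n = \<phi> u"
      using \<kappa>_power[of "1 / real n" n u] assms by (simp add: \<kappa>_1)
    moreover have "\<phi> ((1 / real n) powr (1 / \<alpha>) * u) ^ n = \<phi> u"
      using assms by (simp add: \<phi>_power powr_divide)
    ultimately show ?thesis by (simp add: r_def power_divide \<phi>_nonzero)
  qed
  then have "range r \<subseteq> {z. z ^ n = 1}" by auto
  moreover have "finite {z :: complex. z ^ n = 1}"
    by (rule finite_roots_unity) (use assms in simp)
  ultimately have "finite (range r)" by (rule finite_subset)
  moreover have "continuous_on UNIV r"
    unfolding r_def
    by (intro continuous_at_imp_continuous_on ballI continuous_divide isCont_\<kappa> \<phi>_nonzero
          isCont_o2[OF _ isCont_\<phi>] continuous_intros)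
  ultimately have "r constant_on UNIV" by (intro continuous_finite_range_constant) auto
  then have "r u = r 0" by (auto simp: constant_on_def)
  also have "r 0 = 1"
    using real_distribution.char_zero[of "distr M borel (\<lambda>\<omega>. Z (1 / real n) \<omega> - Z 0 \<omega>)"]
    by (simp add: r_def \<phi>_0 \<kappa>_def)
  finally show ?thesis by (simp add: r_def \<phi>_nonzero)
qed

lemma \<kappa>_rat:
  assumes "p > 0" "q > 0"
  shows "\<kappa> (real p / real q) u = \<phi> ((real p / real q) powr (1 / \<alpha>) * u)"
proof -
  have "\<kappa> (real p / real q) u = \<kappa> (1 / real q) u ^ p"
    using \<kappa>_power[of "1 / real q" p u] assms by simp
  also have "\<dots> = \<phi> ((real p / real q) powr (1 / \<alpha>) * u)"
    using assms by (simp add: \<kappa>_inverse_nat \<phi>_power powr_divide)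
  finally show ?thesis .
qed

text \<open>The distance of \<open>\<kappa> s u\<close> and \<open>\<kappa> t u\<close> is at most
  the mean of |exp (i u (Z s - Z t)) - 1|, which is bounded by |u| \<epsilon> where the increment is
  at most \<epsilon> and by 2 elsewhere. Here continuity in probability enters; it carries the
  formula for \<open>\<kappa>\<close> from rational to real times.\<close>

lemma isCont_\<kappa>_time: "isCont (\<lambda>t. \<kappa> t u) t"
  unfolding isCont_def tendsto_iff
proof (intro allI impI)
  fix e :: real assume "e > 0"
  \<comment> \<open>The first summand becomes at most e/2; adding 1 to |u| avoids division by zero.
    The exceptional probability is made smaller than e/4 because it is counted twice.\<close>
  define \<epsilon> where "\<epsilon> = e / (2 * (\<bar>u\<bar> + 1))"
  have \<epsilon>: "\<epsilon> > 0" "\<bar>u\<bar> * \<epsilon> \<le> e / 2"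
    using \<open>e > 0\<close> by (auto simp: \<epsilon>_def field_simps)
  have "((\<lambda>s. prob {\<omega> \<in> space M. \<bar>Z s \<omega> - Z t \<omega>\<bar> > \<epsilon>}) \<longlongrightarrow> 0) (at t)"
    using Z_continuous_in_prob[of t] \<epsilon>(1) by (auto simp: converges_in_prob_def)
  then have "\<forall>\<^sub>F s in at t. prob {\<omega> \<in> space M. \<bar>Z s \<omega> - Z t \<omega>\<bar> > \<epsilon>} < e / 4"
    by (rule order_tendstoD) (use \<open>e > 0\<close> in simp)
  then show "\<forall>\<^sub>F s in at t. dist (\<kappa> s u) (\<kappa> t u) < e"
  proof eventually_elim
    case (elim s)
    let ?A = "{\<omega> \<in> space M. \<bar>Z s \<omega> - Z t \<omega>\<bar> > \<epsilon>}"
    have "?A \<in> events" by measurable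
    then have A: "integrable M (\<lambda>\<omega>. 2 * indicator ?A \<omega> :: real)"
      by (intro integrable_mult_right integrable_real_indicator) (auto simp: less_top[symmetric])
    let ?d = "\<lambda>\<omega>. iexp (u * (Z s \<omega> - Z 0 \<omega>)) - iexp (u * (Z t \<omega> - Z 0 \<omega>))"
    have int: "integrable M (\<lambda>\<omega>. iexp (u * (Z r \<omega> - Z 0 \<omega>)))" for r
      by (intro integrable_iexp) auto
    have "\<kappa> s u - \<kappa> t u = (\<integral>\<omega>. ?d \<omega> \<partial>M)"
      using int by (subst Bochner_Integration.integral_diff) (simp_all add: \<kappa>_def char_def integral_distr)
    also have "norm \<dots> \<le> (\<integral>\<omega>. norm (?d \<omega>) \<partial>M)"
      by (rule integral_norm_bound)
    also have "\<dots> \<le> (\<integral>\<omega>. e / 2 + 2 * indicator ?A \<omega> \<partial>M)"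
    proof (rule integral_mono)
      show "integrable M (\<lambda>\<omega>. norm (?d \<omega>))"
        by (intro integrable_norm Bochner_Integration.integrable_diff int)
      fix \<omega> assume \<omega>: "\<omega> \<in> space M"
      have "?d \<omega> = iexp (u * (Z t \<omega> - Z 0 \<omega>)) * (iexp (u * (Z s \<omega> - Z t \<omega>)) - 1)"
        by (simp add: algebra_simps flip: exp_add)
      then have nd: "norm (?d \<omega>) = norm (iexp (u * (Z s \<omega> - Z t \<omega>)) - 1)"
        by (simp add: norm_mult norm_exp_i_times del: of_real_mult of_real_diff)
      show "norm (?d \<omega>) \<le> e / 2 + 2 * indicator ?A \<omega>"
      proof (cases "\<omega> \<in> ?A")
        case True
        have "norm (?d \<omega>) \<le> 1 + 1"
          unfolding nd by (rule order_trans[OF norm_triangle_ineq4]) (simp add: norm_exp_i_times del: of_real_mult of_real_diff)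
        then show ?thesis using True \<open>e > 0\<close> by simp
      next
        case False
        then have "\<bar>Z s \<omega> - Z t \<omega>\<bar> \<le> \<epsilon>" using \<omega> by auto
        then have "\<bar>u * (Z s \<omega> - Z t \<omega>)\<bar> \<le> \<bar>u\<bar> * \<epsilon>" by (simp add: abs_mult mult_left_mono)
        moreover have "norm (?d \<omega>) \<le> \<bar>u * (Z s \<omega> - Z t \<omega>)\<bar>"
          unfolding nd using iexp_approx1[of "u * (Z s \<omega> - Z t \<omega>)" 0] by simp
        ultimately show ?thesis using False \<epsilon> by simp
      qed
    qed (intro Bochner_Integration.integrable_add A integrable_const)
    also have "\<dots> = e / 2 + 2 * prob ?A"
      using A \<open>?A \<in> events\<close> by (subst Bochner_Integration.integral_add) (simp_all add: prob_space)
    finally show ?case using elim by (simp add: dist_norm)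
  qed
qed

lemma \<kappa>_eq:
  assumes "t > 0"
  shows "\<kappa> t u = \<phi> (t powr (1 / \<alpha>) * u)"
proof (rule LIMSEQ_unique)
  \<comment> \<open>Rounding up keeps the numerators positive, as \<open>\<kappa>_rat\<close>
    requires, and approaches \<open>t\<close> from above.\<close>
  define p where "p n = nat \<lceil>t * real (Suc n)\<rceil>" for n
  define r where "r n = real (p n) / real (Suc n)" for n
  have p: "p n > 0" for n using assms by (simp add: p_def)
  have r: "t \<le> r n" "r n \<le> t + 1 / real (Suc n)" for n
  proof -
    have "real (p n) = of_int \<lceil>t * real (Suc n)\<rceil>"
      using assms by (simp add: p_def)
    then have "t * real (Suc n) \<le> real (p n)" "real (p n) \<le> t * real (Suc n) + 1"
      by linarith+
    moreover have "t + 1 / real (Suc n) = (t * real (Suc n) + 1) / real (Suc n)"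
      by (simp add: add_divide_distrib del: of_nat_Suc)
    ultimately show "t \<le> r n" "r n \<le> t + 1 / real (Suc n)"
      by (simp_all add: r_def pos_le_divide_eq divide_right_mono del: of_nat_Suc)
  qed
  have "r \<longlonglongrightarrow> t"
  proof (rule tendsto_sandwich[where f = "\<lambda>_. t" and h = "\<lambda>n. t + 1 / real (Suc n)"])
    show "(\<lambda>n. t + 1 / real (Suc n)) \<longlonglongrightarrow> t"
      using tendsto_add[OF tendsto_const LIMSEQ_inverse_real_of_nat, of t] by (simp add: inverse_eq_divide)
  qed (use r in auto)
  then show "(\<lambda>n. \<kappa> (r n) u) \<longlonglongrightarrow> \<kappa> t u"
    by (rule isCont_tendsto_compose[OF isCont_\<kappa>_time])
  have "(\<lambda>n. \<phi> (r n powr (1 / \<alpha>) * u)) \<longlonglongrightarrow> \<phi> (t powr (1 / \<alpha>) * u)"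
    using assms \<open>r \<longlonglongrightarrow> t\<close> by (intro isCont_tendsto_compose[OF isCont_\<phi>] tendsto_intros) auto
  moreover have "\<kappa> (r n) u = \<phi> (r n powr (1 / \<alpha>) * u)" for n
    unfolding r_def using p by (intro \<kappa>_rat) auto
  ultimately show "(\<lambda>n. \<kappa> (r n) u) \<longlonglongrightarrow> \<phi> (t powr (1 / \<alpha>) * u)" by simp
qed

text \<open>Independence multiplies the factors
  \<open>\<phi> (c i * (t (Suc i) - t i) powr (1 / \<alpha>) * u)\<close>, and strict stability adds
  the \<alpha>-th powers of the weights. Signs matter: for a skewed law \<open>- Z 1\<close> is not
  distributed like a positive multiple of \<open>Z 1\<close>.\<close>

lemma distr_weighted_increments:
  assumes t: "strict_mono t" and c: "\<And>i. c i \<ge> 0"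
  shows "distr M borel (\<lambda>\<omega>. \<Sum>i<n. c i * (Z (t (Suc i)) \<omega> - Z (t i) \<omega>)) =
    distr M borel (\<lambda>\<omega>. (\<Sum>i<n. c i powr \<alpha> * (t (Suc i) - t i)) powr (1 / \<alpha>) * Z 1 \<omega>)"
proof (rule Levy_uniqueness)
  show "char (distr M borel (\<lambda>\<omega>. \<Sum>i<n. c i * (Z (t (Suc i)) \<omega> - Z (t i) \<omega>))) =
    char (distr M borel (\<lambda>\<omega>. (\<Sum>i<n. c i powr \<alpha> * (t (Suc i) - t i)) powr (1 / \<alpha>) * Z 1 \<omega>))"
  proof
    fix u
    have pos: "t (Suc i) - t i > 0" for i using t by (simp add: strict_mono_less)
    have "(\<Prod>i<n. \<kappa> (t (Suc i) - t i) (c i * u)) =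
        (\<Prod>i<n. \<phi> ((c i * (t (Suc i) - t i) powr (1 / \<alpha>)) * u))"
      using pos by (simp add: \<kappa>_eq mult_ac)
    also have "\<dots> = \<phi> ((\<Sum>i<n. (c i * (t (Suc i) - t i) powr (1 / \<alpha>)) powr \<alpha>) powr (1 / \<alpha>) * u)"
      using c by (intro \<phi>_prod) auto
    also have "(\<Sum>i<n. (c i * (t (Suc i) - t i) powr (1 / \<alpha>)) powr \<alpha>) =
        (\<Sum>i<n. c i powr \<alpha> * (t (Suc i) - t i))"
      using c pos[THEN less_imp_le] alpha_gt_1 by (intro sum.cong refl) (simp add: powr_mult powr_powr)
    finally show "char (distr M borel (\<lambda>\<omega>. \<Sum>i<n. c i * (Z (t (Suc i)) \<omega> - Z (t i) \<omega>))) u =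
      char (distr M borel (\<lambda>\<omega>. (\<Sum>i<n. c i powr \<alpha> * (t (Suc i) - t i)) powr (1 / \<alpha>) * Z 1 \<omega>)) u"
      by (simp add: char_weighted_increments[OF t] char_distr_scale \<phi>_def)
  qed
qed auto

lemma expectation_abs_weighted_increments:
  assumes t: "strict_mono t" and c: "\<And>i. c i \<ge> 0"
  shows "expectation (\<lambda>\<omega>. \<bar>\<Sum>i<n. c i * (Z (t (Suc i)) \<omega> - Z (t i) \<omega>)\<bar>) =
    (\<Sum>i<n. c i powr \<alpha> * (t (Suc i) - t i)) powr (1 / \<alpha>) * expectation (\<lambda>\<omega>. \<bar>Z 1 \<omega>\<bar>)"
proof -
  let ?C = "(\<Sum>i<n. c i powr \<alpha> * (t (Suc i) - t i)) powr (1 / \<alpha>)"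
  have "expectation (\<lambda>\<omega>. \<bar>\<Sum>i<n. c i * (Z (t (Suc i)) \<omega> - Z (t i) \<omega>)\<bar>) =
      (\<integral>x. \<bar>x\<bar> \<partial>distr M borel (\<lambda>\<omega>. \<Sum>i<n. c i * (Z (t (Suc i)) \<omega> - Z (t i) \<omega>)))"
    by (simp add: integral_distr)
  also have "\<dots> = (\<integral>x. \<bar>x\<bar> \<partial>distr M borel (\<lambda>\<omega>. ?C * Z 1 \<omega>))"
    by (simp only: distr_weighted_increments[OF t c])
  also have "\<dots> = expectation (\<lambda>\<omega>. \<bar>?C * Z 1 \<omega>\<bar>)"
    by (subst integral_distr) auto
  finally show ?thesis by (simp add: abs_mult)
qed

text \<open>The positive and the negative part of the step function each give a scaled copy of \<open>Z 1\<close>, hence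
  the factor \<open>2\<close>; no tail estimates for stable laws are needed.\<close>
lemma
  assumes "steps_ok xs"
  shows integrable_step_fun_powr: "integrable lborel (\<lambda>s. \<bar>step_fun xs s\<bar> powr \<alpha>)"
    and expectation_abs_step_integral:
      "expectation (\<lambda>\<omega>. \<bar>step_integral Z xs \<omega>\<bar>) \<le>
        2 * expectation (\<lambda>\<omega>. \<bar>Z 1 \<omega>\<bar>) * (\<integral>s. \<bar>step_fun xs s\<bar> powr \<alpha> \<partial>lborel) powr (1 / \<alpha>)"
proof -
  obtain t :: "nat \<Rightarrow> real" and n where t: "strict_mono t"
    and "\<And>xs' c a b. xs' \<in> {xs} \<Longrightarrow> (c, a, b) \<in> set xs' \<Longrightarrow> a \<in> t ` {..n} \<and> b \<in> t ` {..n}"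
    by (rule ex_common_partition[of "{xs}"], simp, rule that)
  then have part: "\<And>c a b. (c, a, b) \<in> set xs \<Longrightarrow> a \<in> t ` {..n} \<and> b \<in> t ` {..n}"
    by simp
  define c where "c i = step_fun xs (t (Suc i))" for i
  define pos where "pos i = max (c i) 0" for i
  define neg where "neg i = max (- c i) 0" for i
  let ?S = "\<lambda>d \<omega>. \<Sum>i<n. d i * (Z (t (Suc i)) \<omega> - Z (t i) \<omega>)"
  have le: "t (Suc i) - t i \<ge> 0" for i using t by (simp add: strict_mono_less_eq)
  have "\<alpha> \<noteq> 0" using alpha_gt_1 by simp
  have F: "step_fun xs = (\<lambda>s. \<Sum>i<n. c i * indicator {t i<..t (Suc i)} s)"
    unfolding c_def by (rule ext) (rule step_fun_partition[OF t assms part])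
  show "integrable lborel (\<lambda>s. \<bar>step_fun xs s\<bar> powr \<alpha>)"
    unfolding F by (rule integrable_partition_powr[OF t \<open>\<alpha> \<noteq> 0\<close>])
  have I: "(\<integral>s. \<bar>step_fun xs s\<bar> powr \<alpha> \<partial>lborel) = (\<Sum>i<n. \<bar>c i\<bar> powr \<alpha> * (t (Suc i) - t i))"
    unfolding F by (rule integral_partition_powr[OF t \<open>\<alpha> \<noteq> 0\<close>])
  have S: "step_integral Z xs \<omega> = ?S pos \<omega> - ?S neg \<omega>" for \<omega>
  proof -
    have "step_integral Z xs \<omega> = ?S c \<omega>"
      unfolding c_def by (rule step_integral_partition[OF t assms part])
    also have "\<dots> = ?S pos \<omega> - ?S neg \<omega>"
      unfolding sum_subtractf[symmetric] pos_def neg_def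
      by (intro sum.cong refl) (auto simp: max_def algebra_simps)
    finally show ?thesis .
  qed
  have mono: "(\<Sum>i<n. d i powr \<alpha> * (t (Suc i) - t i)) powr (1 / \<alpha>) \<le>
      (\<integral>s. \<bar>step_fun xs s\<bar> powr \<alpha> \<partial>lborel) powr (1 / \<alpha>)"
    if "\<And>i. 0 \<le> d i" "\<And>i. d i \<le> \<bar>c i\<bar>" for d
    unfolding I using that alpha_gt_1 le
    by (intro powr_mono2 sum_mono mult_right_mono sum_nonneg mult_nonneg_nonneg) auto
  have bound: "expectation (\<lambda>\<omega>. \<bar>?S d \<omega>\<bar>) \<le>
      expectation (\<lambda>\<omega>. \<bar>Z 1 \<omega>\<bar>) * (\<integral>s. \<bar>step_fun xs s\<bar> powr \<alpha> \<partial>lborel) powr (1 / \<alpha>)"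
    if "\<And>i. 0 \<le> d i" "\<And>i. d i \<le> \<bar>c i\<bar>" for d
  proof -
    have "expectation (\<lambda>\<omega>. \<bar>Z 1 \<omega>\<bar>) \<ge> 0" by simp
    then show ?thesis
      using expectation_abs_weighted_increments[where c = d and n = n, OF t that(1)]
        mult_left_mono[OF mono[OF that]] by (simp add: mult.commute)
  qed
  have "expectation (\<lambda>\<omega>. \<bar>step_integral Z xs \<omega>\<bar>) \<le> expectation (\<lambda>\<omega>. \<bar>?S pos \<omega>\<bar> + \<bar>?S neg \<omega>\<bar>)"
    unfolding S by (intro integral_mono) auto
  also have "\<dots> = expectation (\<lambda>\<omega>. \<bar>?S pos \<omega>\<bar>) + expectation (\<lambda>\<omega>. \<bar>?S neg \<omega>\<bar>)"
    by (intro Bochner_Integration.integral_add) auto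
  also have "\<dots> \<le> 2 * (expectation (\<lambda>\<omega>. \<bar>Z 1 \<omega>\<bar>) * (\<integral>s. \<bar>step_fun xs s\<bar> powr \<alpha> \<partial>lborel) powr (1 / \<alpha>))"
  proof -
    have *: "0 \<le> pos i" "pos i \<le> \<bar>c i\<bar>" "0 \<le> neg i" "neg i \<le> \<bar>c i\<bar>" for i
      by (auto simp: pos_def neg_def)
    show ?thesis using bound[OF *(1,2)] bound[OF *(3,4)] by linarith
  qed
  finally show "expectation (\<lambda>\<omega>. \<bar>step_integral Z xs \<omega>\<bar>) \<le>
      2 * expectation (\<lambda>\<omega>. \<bar>Z 1 \<omega>\<bar>) * (\<integral>s. \<bar>step_fun xs s\<bar> powr \<alpha> \<partial>lborel) powr (1 / \<alpha>)"
    by (simp add: mult.assoc)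
qed

end

section \<open>Moment inequalities and limits in probability\<close>

text \<open>A crude replacement for Minkowski's inequality, from |a + b| <= 2 max(|a|, |b|). The
  factor only enlarges constants in bounds that are sent to 0 or used up to a constant.\<close>

lemma abs_add_powr_le:
  fixes a b p :: real
  assumes "p > 0"
  shows "\<bar>a + b\<bar> powr p \<le> 2 powr p * (\<bar>a\<bar> powr p + \<bar>b\<bar> powr p)"
proof -
  have "\<bar>a + b\<bar> powr p \<le> (2 * max \<bar>a\<bar> \<bar>b\<bar>) powr p"
    using assms by (intro powr_mono2) auto
  also have "\<dots> = 2 powr p * max \<bar>a\<bar> \<bar>b\<bar> powr p" by (simp add: powr_mult)
  also have "\<dots> \<le> 2 powr p * (\<bar>a\<bar> powr p + \<bar>b\<bar> powr p)"
    by (intro mult_left_mono) (auto simp: max_def)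
  finally show ?thesis .
qed

lemma abs_le_1_plus_powr:
  fixes x p :: real
  assumes "p \<ge> 1"
  shows "\<bar>x\<bar> \<le> 1 + \<bar>x\<bar> powr p"
proof (cases "\<bar>x\<bar> \<le> 1")
  case False
  then have "\<bar>x\<bar> powr 1 \<le> \<bar>x\<bar> powr p" using assms by (intro powr_mono) auto
  then show ?thesis using False by simp
next
  case True
  then show ?thesis using powr_ge_zero[of "\<bar>x\<bar>" p] by linarith
qed

lemma powr_above_tangent:
  fixes x m p :: real
  assumes "p \<ge> 1" "m > 0" "x \<ge> 0"
  shows "m powr p + p * m powr (p - 1) * (x - m) \<le> x powr p"
\<comment> \<open>Convexity of the power is taken on the open half-line, so 0 is checked by hand:
  there the tangent has the value (1 - p) m^p <= 0.\<close>
proof (cases "x = 0")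
  case True
  have "m powr (p - 1) * m = m powr p"
    using assms powr_add[of m "p - 1" 1] by simp
  then have eq: "p * m powr (p - 1) * (x - m) = - (p * m powr p)"
    unfolding True mult.assoc by (simp only: diff_0 mult_minus_right)
  moreover have "1 * m powr p \<le> p * m powr p" using assms by (intro mult_right_mono) auto
  ultimately show ?thesis unfolding eq using True by simp
next
  case False
  have "p * m powr (p - 1) * (x - m) \<le> x powr p - m powr p"
  proof (rule convex_on_imp_above_tangent[OF powr_convex[OF assms(1)]])
    show "((\<lambda>x. x powr p) has_real_derivative p * m powr (p - 1)) (at m within {0<..})"
      using assms by (auto intro!: derivative_eq_intros)
  qed (use assms False in \<open>auto simp: interior_open\<close>)
  then show ?thesis by simp
qed

text \<open>Jensen's inequality, by integrating the tangent bound at the mean \<open>m\<close> of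
  |f|: the linear term has expectation 0.\<close>

lemma (in prob_space)
  fixes f :: "'a \<Rightarrow> real"
  assumes f [measurable]: "f \<in> borel_measurable M" and p: "p \<ge> 1"
    and int: "integrable M (\<lambda>x. \<bar>f x\<bar> powr p)"
  shows integrable_of_powr: "integrable M f"
    and abs_expectation_powr_le: "\<bar>expectation f\<bar> powr p \<le> expectation (\<lambda>x. \<bar>f x\<bar> powr p)"
proof -
  show f_int: "integrable M f"
  proof (rule Bochner_Integration.integrable_bound)
    show "integrable M (\<lambda>x. 1 + \<bar>f x\<bar> powr p)" using int by simp
    show "AE x in M. norm (f x) \<le> norm (1 + \<bar>f x\<bar> powr p)"
      using abs_le_1_plus_powr[OF p] by (intro AE_I2) (simp add: add_nonneg_nonneg)
  qed simp
  define m where "m = expectation (\<lambda>x. \<bar>f x\<bar>)"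
  have le: "\<bar>expectation f\<bar> \<le> m" unfolding m_def by (rule integral_abs_bound)
  show "\<bar>expectation f\<bar> powr p \<le> expectation (\<lambda>x. \<bar>f x\<bar> powr p)"
  proof (cases "m > 0")
    case True
    have "m powr p = expectation (\<lambda>x. m powr p + p * m powr (p - 1) * (\<bar>f x\<bar> - m))"
      using f_int by (simp add: m_def prob_space right_diff_distrib)
    also have "\<dots> \<le> expectation (\<lambda>x. \<bar>f x\<bar> powr p)"
      using f_int int True p by (intro integral_mono powr_above_tangent) auto
    finally have "m powr p \<le> expectation (\<lambda>x. \<bar>f x\<bar> powr p)" .
    moreover have "\<bar>expectation f\<bar> powr p \<le> m powr p" using le p by (intro powr_mono2) auto
    ultimately show ?thesis by linarith
  next
    case False
    then have "expectation f = 0" using le by linarith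
    then show ?thesis using p by simp
  qed
qed

text \<open>A subsequence converges almost surely, and Fatou's lemma carries the moment bounds to
  the limit. This is how the definition of the integral, which speaks of probability only, yields
  statements in \<open>L^1\<close>.\<close>

lemma (in prob_space)
  fixes X :: "nat \<Rightarrow> 'a \<Rightarrow> real"
  assumes conv: "converges_in_prob M X Y sequentially"
    and X: "\<And>n. integrable M (X n)" and Y [measurable]: "Y \<in> borel_measurable M"
    and B: "\<And>n. expectation (\<lambda>\<omega>. \<bar>X n \<omega>\<bar>) \<le> B n" "B \<longlonglongrightarrow> b"
  shows integrable_limit_in_prob: "integrable M Y"
    and expectation_limit_in_prob_le: "expectation (\<lambda>\<omega>. \<bar>Y \<omega>\<bar>) \<le> b"
proof -
  note [measurable] = borel_measurable_integrable[OF X]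
  \<comment> \<open>Truncating at 1 turns convergence in probability into convergence in
    \<open>L^1\<close>, from which an almost surely convergent subsequence can be extracted.\<close>
  define u where "u n \<omega> = min 1 \<bar>X n \<omega> - Y \<omega>\<bar>" for n \<omega>
  have u_meas [measurable]: "u n \<in> borel_measurable M" for n unfolding u_def by measurable
  have u_int: "integrable M (u n)" for n
    by (rule integrable_const_bound[where B = 1]) (auto simp: u_def)
  have "(\<lambda>n. \<integral>\<omega>. norm (u n \<omega>) \<partial>M) \<longlonglongrightarrow> 0"
    unfolding tendsto_iff
  proof (intro allI impI)
    fix e :: real assume "e > 0"
    let ?A = "\<lambda>n. {\<omega> \<in> space M. \<bar>X n \<omega> - Y \<omega>\<bar> > e / 2}"
    have "(\<lambda>n. prob (?A n)) \<longlonglongrightarrow> 0"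
      using conv[unfolded converges_in_prob_def, rule_format, of "e / 2"] \<open>e > 0\<close> by simp
    then have "\<forall>\<^sub>F n in sequentially. prob (?A n) < e / 2"
      by (rule order_tendstoD) (use \<open>e > 0\<close> in simp)
    then show "\<forall>\<^sub>F n in sequentially. dist (\<integral>\<omega>. norm (u n \<omega>) \<partial>M) 0 < e"
    proof eventually_elim
      case (elim n)
      have A [measurable]: "?A n \<in> events" by measurable
      have iA: "integrable M (\<lambda>\<omega>. indicator (?A n) \<omega> :: real)"
        by (intro integrable_real_indicator) (auto simp: less_top[symmetric])
      have "(\<integral>\<omega>. norm (u n \<omega>) \<partial>M) \<le> (\<integral>\<omega>. e / 2 + indicator (?A n) \<omega> \<partial>M)"
      proof (intro integral_mono integrable_norm u_int Bochner_Integration.integrable_add iA integrable_const)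
        show "norm (u n \<omega>) \<le> e / 2 + indicator (?A n) \<omega>" if "\<omega> \<in> space M" for \<omega>
          using that \<open>e > 0\<close> by (cases "\<omega> \<in> ?A n") (simp_all add: u_def min_def)
      qed
      also have "\<dots> = e / 2 + prob (?A n)"
        using iA by (subst Bochner_Integration.integral_add) (simp_all add: prob_space)
      finally show ?case using elim by simp
    qed
  qed
  from tendsto_L1_AE_subseq[OF u_int this] obtain r :: "nat \<Rightarrow> nat" where r: "strict_mono r"
    and lim: "AE \<omega> in M. (\<lambda>n. u (r n) \<omega>) \<longlonglongrightarrow> 0" by auto
  have "AE \<omega> in M. (\<lambda>n. X (r n) \<omega>) \<longlonglongrightarrow> Y \<omega>"
    using lim
  proof eventually_elim
    case (elim \<omega>)
    show ?case unfolding tendsto_iff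
    proof (intro allI impI)
      fix e :: real assume "e > 0"
      then have "\<forall>\<^sub>F n in sequentially. u (r n) \<omega> < min 1 e"
        by (intro order_tendstoD[OF elim]) auto
      then show "\<forall>\<^sub>F n in sequentially. dist (X (r n) \<omega>) (Y \<omega>) < e"
        by eventually_elim (auto simp: u_def dist_real_def min_def split: if_splits)
    qed
  qed
  then have eq: "AE \<omega> in M. ennreal \<bar>Y \<omega>\<bar> = liminf (\<lambda>n. ennreal \<bar>X (r n) \<omega>\<bar>)"
  proof eventually_elim
    case (elim \<omega>)
    then have "(\<lambda>n. ennreal \<bar>X (r n) \<omega>\<bar>) \<longlonglongrightarrow> ennreal \<bar>Y \<omega>\<bar>"
      by (intro tendsto_ennrealI tendsto_rabs)
    then show ?case by (rule lim_imp_Liminf[OF sequentially_bot, symmetric])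
  qed
  have "(\<integral>\<^sup>+\<omega>. ennreal \<bar>Y \<omega>\<bar> \<partial>M) = (\<integral>\<^sup>+\<omega>. liminf (\<lambda>n. ennreal \<bar>X (r n) \<omega>\<bar>) \<partial>M)"
    by (intro nn_integral_cong_AE eq)
  also have "\<dots> \<le> liminf (\<lambda>n. \<integral>\<^sup>+\<omega>. ennreal \<bar>X (r n) \<omega>\<bar> \<partial>M)"
    by (intro nn_integral_liminf) measurable
  also have "\<dots> \<le> liminf (\<lambda>n. ennreal (B (r n)))"
    using X B by (intro Liminf_mono always_eventually allI) (simp add: nn_integral_eq_integral ennreal_leI)
  also have "\<dots> = ennreal b"
    using LIMSEQ_subseq_LIMSEQ[OF B(2) r]
    by (intro lim_imp_Liminf tendsto_ennrealI) (auto simp: comp_def)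
  finally have le: "(\<integral>\<^sup>+\<omega>. ennreal \<bar>Y \<omega>\<bar> \<partial>M) \<le> ennreal b" .
  then show Y_int: "integrable M Y"
    by (intro integrableI_bounded) (auto intro: le_less_trans[OF _ ennreal_less_top])
  have "b \<ge> 0"
  proof (rule LIMSEQ_le_const[OF B(2)])
    have "0 \<le> expectation (\<lambda>\<omega>. \<bar>X n \<omega>\<bar>)" for n by simp
    then show "\<exists>N. \<forall>n\<ge>N. 0 \<le> B n" using B(1) order_trans by blast
  qed
  then show "expectation (\<lambda>\<omega>. \<bar>Y \<omega>\<bar>) \<le> b"
    using le Y_int by (simp add: nn_integral_eq_integral)
qed

lemma (in prob_space) converges_in_prob_of_L1:
  fixes X :: "nat \<Rightarrow> 'a \<Rightarrow> real"
  assumes X: "\<And>n. integrable M (X n)" and Y: "integrable M Y"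
    and lim: "(\<lambda>n. expectation (\<lambda>\<omega>. \<bar>X n \<omega> - Y \<omega>\<bar>)) \<longlonglongrightarrow> 0"
  shows "converges_in_prob M X Y sequentially"
  unfolding converges_in_prob_def
proof (intro allI impI)
  fix e :: real assume "e > 0"
  note [measurable] = borel_measurable_integrable[OF X] borel_measurable_integrable[OF Y]
  show "(\<lambda>n. prob {\<omega> \<in> space M. \<bar>X n \<omega> - Y \<omega>\<bar> > e}) \<longlonglongrightarrow> 0"
  proof (rule tendsto_sandwich[where f = "\<lambda>_. 0" and h = "\<lambda>n. expectation (\<lambda>\<omega>. \<bar>X n \<omega> - Y \<omega>\<bar>) / e"])
    show "\<forall>\<^sub>F n in sequentially. prob {\<omega> \<in> space M. \<bar>X n \<omega> - Y \<omega>\<bar> > e} \<le> expectation (\<lambda>\<omega>. \<bar>X n \<omega> - Y \<omega>\<bar>) / e"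
    proof (intro always_eventually allI)
      fix n
      have "prob {\<omega> \<in> space M. \<bar>X n \<omega> - Y \<omega>\<bar> > e} \<le> prob {\<omega> \<in> space M. \<bar>X n \<omega> - Y \<omega>\<bar> \<ge> e}"
        by (intro finite_measure_mono) auto
      also have "\<dots> \<le> expectation (\<lambda>\<omega>. \<bar>X n \<omega> - Y \<omega>\<bar>) / e"
        using X Y \<open>e > 0\<close> by (intro integral_Markov_inequality_measure[where A = "{}"]) auto
      finally show "prob {\<omega> \<in> space M. \<bar>X n \<omega> - Y \<omega>\<bar> > e} \<le> expectation (\<lambda>\<omega>. \<bar>X n \<omega> - Y \<omega>\<bar>) / e" .
    qed
    show "(\<lambda>n. expectation (\<lambda>\<omega>. \<bar>X n \<omega> - Y \<omega>\<bar>) / e) \<longlonglongrightarrow> 0"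
      using tendsto_divide[OF lim tendsto_const[of e]] \<open>e > 0\<close> by simp
  qed auto
qed

section \<open>Stable integrals\<close>

definition in_Lp :: "real \<Rightarrow> (real \<Rightarrow> real) \<Rightarrow> bool" where
  "in_Lp p f \<longleftrightarrow> f \<in> borel_measurable borel \<and> integrable lborel (\<lambda>s. \<bar>f s\<bar> powr p)"

text \<open>The p-th power of the usual distance in \<open>L^p\<close>. It obeys the triangle
  inequality up to the factor 2^p; the root is taken only in moment bounds.\<close>

definition Lp_dist :: "real \<Rightarrow> (real \<Rightarrow> real) \<Rightarrow> (real \<Rightarrow> real) \<Rightarrow> real" where
  "Lp_dist p f g = (\<integral>s. \<bar>f s - g s\<bar> powr p \<partial>lborel)"

lemma in_Lp_add:
  assumes "p > 0" "in_Lp p f" "in_Lp p g"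
  shows "in_Lp p (\<lambda>s. f s + g s)"
proof -
  have [measurable]: "f \<in> borel_measurable borel" "g \<in> borel_measurable borel"
    using assms by (auto simp: in_Lp_def)
  have "integrable lborel (\<lambda>s. \<bar>f s + g s\<bar> powr p)"
  proof (rule Bochner_Integration.integrable_bound)
    show "integrable lborel (\<lambda>s. 2 powr p * (\<bar>f s\<bar> powr p + \<bar>g s\<bar> powr p))"
      using assms by (auto simp: in_Lp_def)
    show "AE s in lborel. norm (\<bar>f s + g s\<bar> powr p) \<le> norm (2 powr p * (\<bar>f s\<bar> powr p + \<bar>g s\<bar> powr p))"
      using abs_add_powr_le[OF assms(1)] by (intro AE_I2) (simp add: abs_mult)
  qed measurable
  then show ?thesis by (simp add: in_Lp_def)
qed

lemma in_Lp_cmult: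
  assumes "in_Lp p f"
  shows "in_Lp p (\<lambda>s. c * f s)"
  using assms by (auto simp: in_Lp_def abs_mult powr_mult)

lemma in_Lp_diff:
  assumes "p > 0" "in_Lp p f" "in_Lp p g"
  shows "in_Lp p (\<lambda>s. f s - g s)"
  using in_Lp_add[OF assms(1,2) in_Lp_cmult[OF assms(3), of "-1"]] by simp

lemma Lp_dist_nonneg [simp]: "Lp_dist p f g \<ge> 0"
  by (simp add: Lp_dist_def)

lemma Lp_dist_commute: "Lp_dist p f g = Lp_dist p g f"
  by (simp add: Lp_dist_def abs_minus_commute)

lemma Lp_dist_triangle:
  assumes "p > 0" "in_Lp p f" "in_Lp p g" "in_Lp p h"
  shows "Lp_dist p f h \<le> 2 powr p * (Lp_dist p f g + Lp_dist p g h)"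
proof -
  have int: "integrable lborel (\<lambda>s. \<bar>f s - g s\<bar> powr p)" "integrable lborel (\<lambda>s. \<bar>g s - h s\<bar> powr p)"
    "integrable lborel (\<lambda>s. \<bar>f s - h s\<bar> powr p)"
    using in_Lp_diff[OF assms(1)] assms by (auto simp: in_Lp_def)
  have "Lp_dist p f h \<le> (\<integral>s. 2 powr p * (\<bar>f s - g s\<bar> powr p + \<bar>g s - h s\<bar> powr p) \<partial>lborel)"
    unfolding Lp_dist_def
  proof (rule integral_mono)
    show "\<bar>f s - h s\<bar> powr p \<le> 2 powr p * (\<bar>f s - g s\<bar> powr p + \<bar>g s - h s\<bar> powr p)" for s
      using abs_add_powr_le[OF assms(1), of "f s - g s" "g s - h s"] by simp
  qed (use int in auto)
  also have "\<dots> = 2 powr p * (Lp_dist p f g + Lp_dist p g h)"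
    using int by (simp add: Lp_dist_def)
  finally show ?thesis .
qed

section \<open>Scaling and translating step functions\<close>

definition scale_steps :: "real \<Rightarrow> (real \<times> real \<times> real) list \<Rightarrow> (real \<times> real \<times> real) list" where
  "scale_steps k = map (\<lambda>(c, a, b). (k * c, a, b))"

definition shift_steps :: "real \<Rightarrow> (real \<times> real \<times> real) list \<Rightarrow> (real \<times> real \<times> real) list" where
  "shift_steps h = map (\<lambda>(c, a, b). (c, a + h, b + h))"

lemma step_fun_scale: "step_fun (scale_steps k xs) s = k * step_fun xs s"
  by (induction xs) (auto simp: scale_steps_def algebra_simps)

lemma step_integral_scale: "step_integral Z (scale_steps k xs) \<omega> = k * step_integral Z xs \<omega>"
  by (induction xs) (auto simp: scale_steps_def algebra_simps)

lemma steps_ok_scale [simp]: "steps_ok (scale_steps k xs) \<longleftrightarrow> steps_ok xs"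
  by (induction xs) (auto simp: scale_steps_def)

lemma step_fun_shift: "step_fun (shift_steps h xs) s = step_fun xs (s - h)"
  by (induction xs) (auto simp: shift_steps_def indicator_def)

lemma step_integral_shift: "step_integral Z (shift_steps h xs) \<omega> = step_integral (\<lambda>t. Z (t + h)) xs \<omega>"
  by (induction xs) (auto simp: shift_steps_def)

lemma steps_ok_shift [simp]: "steps_ok (shift_steps h xs) \<longleftrightarrow> steps_ok xs"
  by (induction xs) (auto simp: shift_steps_def)

section \<open>The integral as a closed linear relation between integrands and random
  variables\<close>

context centered_stable_levy
begin

lemma alpha_pos: "\<alpha> > 0" using alpha_gt_1 by simp

lemma in_Lp_step_fun: "steps_ok xs \<Longrightarrow> in_Lp \<alpha> (step_fun xs)"
  by (simp add: in_Lp_def integrable_step_fun_powr)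

lemma expectation_step_integral_diff:
  assumes "steps_ok xs" "steps_ok ys"
  shows "expectation (\<lambda>\<omega>. \<bar>step_integral Z xs \<omega> - step_integral Z ys \<omega>\<bar>) \<le>
    2 * expectation (\<lambda>\<omega>. \<bar>Z 1 \<omega>\<bar>) * Lp_dist \<alpha> (step_fun xs) (step_fun ys) powr (1 / \<alpha>)"
  using expectation_abs_step_integral[of "xs @ scale_steps (-1) ys"] assms
  by (simp add: step_fun_scale step_integral_scale Lp_dist_def)

lemma has_stable_integral_in_Lp:
  "has_stable_integral M \<alpha> Z f Y \<Longrightarrow> in_Lp \<alpha> f"
  by (auto simp: has_stable_integral_def in_Lp_def)

text \<open>Step integrals form a Cauchy sequence in \<open>L^1\<close> by the moment bound, so
  their limit in probability is also a limit in \<open>L^1\<close>. With its converse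
  \<open>has_stable_integralI\<close> this gives an epsilon form of the definition, and sequences
  can be avoided from there on.\<close>

lemma has_stable_integral_approx:
  assumes "has_stable_integral M \<alpha> Z f Y"
  shows "integrable M Y"
    and "e > 0 \<Longrightarrow> \<exists>xs. steps_ok xs \<and> Lp_dist \<alpha> (step_fun xs) f < e \<and>
      expectation (\<lambda>\<omega>. \<bar>step_integral Z xs \<omega> - Y \<omega>\<bar>) < e"
proof -
  have f: "in_Lp \<alpha> f" and [measurable]: "Y \<in> borel_measurable M"
    using assms by (auto simp: has_stable_integral_def in_Lp_def)
  from assms obtain S where S: "\<And>n. steps_ok (S n)"
    and lim: "(\<lambda>n. Lp_dist \<alpha> (step_fun (S n)) f) \<longlonglongrightarrow> 0"
    and conv: "converges_in_prob M (\<lambda>n. step_integral Z (S n)) Y sequentially"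
    unfolding has_stable_integral_def Lp_dist_def steps_ok_def by blast
  define d where "d n = Lp_dist \<alpha> (step_fun (S n)) f" for n
  define K where "K = 2 * expectation (\<lambda>\<omega>. \<bar>Z 1 \<omega>\<bar>)"
  have "K \<ge> 0" by (simp add: K_def)
  \<comment> \<open>The bound compares two approximants by way of \<open>f\<close>. Letting
    \<open>m\<close> tend to infinity with \<open>n\<close> fixed removes \<open>d m\<close> and
    replaces the approximant of index \<open>m\<close> by \<open>Y\<close>.\<close>
  define B where "B n m = K * (2 powr \<alpha> * (d n + d m)) powr (1 / \<alpha>)" for n m
  have bound: "expectation (\<lambda>\<omega>. \<bar>step_integral Z (S m) \<omega> - step_integral Z (S n) \<omega>\<bar>) \<le> B n m" for n m
  proof -
    have "Lp_dist \<alpha> (step_fun (S m)) (step_fun (S n)) \<le> 2 powr \<alpha> * (d n + d m)"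
      using Lp_dist_triangle[OF alpha_pos in_Lp_step_fun[OF S] f in_Lp_step_fun[OF S]]
      by (simp add: d_def Lp_dist_commute[of \<alpha> f] add.commute)
    then have "K * Lp_dist \<alpha> (step_fun (S m)) (step_fun (S n)) powr (1 / \<alpha>) \<le> B n m"
      unfolding B_def using \<open>K \<ge> 0\<close> alpha_pos by (intro mult_left_mono powr_mono2) auto
    then show ?thesis
      using expectation_step_integral_diff[OF S S, of m n] by (simp add: K_def)
  qed
  have B_lim: "B n \<longlonglongrightarrow> K * (2 powr \<alpha> * (d n + 0)) powr (1 / \<alpha>)" for n
    unfolding B_def using lim alpha_pos
    by (intro tendsto_intros tendsto_powr2 always_eventually) (auto simp: d_def)
  have conv': "converges_in_prob M (\<lambda>m \<omega>. step_integral Z (S m) \<omega> - step_integral Z (S n) \<omega>)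
      (\<lambda>\<omega>. Y \<omega> - step_integral Z (S n) \<omega>) sequentially" for n
    using conv by (simp add: converges_in_prob_def)
  have int_diff: "integrable M (\<lambda>\<omega>. Y \<omega> - step_integral Z (S n) \<omega>)" for n
    using bound by (intro integrable_limit_in_prob[OF conv' _ _ _ B_lim]) auto
  then have "integrable M (\<lambda>\<omega>. (Y \<omega> - step_integral Z (S 0) \<omega>) + step_integral Z (S 0) \<omega>)"
    by (intro Bochner_Integration.integrable_add) auto
  then show Y_int: "integrable M Y" by simp
  have le: "expectation (\<lambda>\<omega>. \<bar>step_integral Z (S n) \<omega> - Y \<omega>\<bar>) \<le> K * (2 powr \<alpha> * (d n + 0)) powr (1 / \<alpha>)" for n
    using bound by (subst abs_minus_commute, intro expectation_limit_in_prob_le[OF conv' _ _ _ B_lim]) auto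
  have "(\<lambda>n. K * (2 powr \<alpha> * (d n + 0)) powr (1 / \<alpha>)) \<longlonglongrightarrow> K * (2 powr \<alpha> * (0 + 0)) powr (1 / \<alpha>)"
    using lim alpha_pos by (intro tendsto_intros tendsto_powr2 always_eventually) (auto simp: d_def)
  then have lim2: "(\<lambda>n. K * (2 powr \<alpha> * (d n + 0)) powr (1 / \<alpha>)) \<longlonglongrightarrow> 0" by simp
  show "\<exists>xs. steps_ok xs \<and> Lp_dist \<alpha> (step_fun xs) f < e \<and>
      expectation (\<lambda>\<omega>. \<bar>step_integral Z xs \<omega> - Y \<omega>\<bar>) < e" if "e > 0"
  proof -
    have "\<forall>\<^sub>F n in sequentially. Lp_dist \<alpha> (step_fun (S n)) f < e \<and>
        K * (2 powr \<alpha> * (d n + 0)) powr (1 / \<alpha>) < e"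
      using order_tendstoD(2)[OF lim that] order_tendstoD(2)[OF lim2 that] by eventually_elim auto
    then obtain n where "Lp_dist \<alpha> (step_fun (S n)) f < e" "K * (2 powr \<alpha> * (d n + 0)) powr (1 / \<alpha>) < e"
      by (auto simp: eventually_sequentially)
    with le[of n] S show ?thesis by (intro exI[of _ "S n"] conjI) auto
  qed
qed

lemma has_stable_integralI:
  assumes f: "in_Lp \<alpha> f" and Y: "integrable M Y"
    and approx: "\<And>e. e > 0 \<Longrightarrow> \<exists>xs. steps_ok xs \<and> Lp_dist \<alpha> (step_fun xs) f < e \<and>
      expectation (\<lambda>\<omega>. \<bar>step_integral Z xs \<omega> - Y \<omega>\<bar>) < e"
  shows "has_stable_integral M \<alpha> Z f Y"
proof -
  have "\<exists>xs. steps_ok xs \<and> Lp_dist \<alpha> (step_fun xs) f < inverse (real (Suc n)) \<and>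
      expectation (\<lambda>\<omega>. \<bar>step_integral Z xs \<omega> - Y \<omega>\<bar>) < inverse (real (Suc n))" for n
    by (rule approx) simp
  then obtain S where S: "\<And>n. steps_ok (S n)"
    "\<And>n. Lp_dist \<alpha> (step_fun (S n)) f < inverse (real (Suc n))"
    "\<And>n. expectation (\<lambda>\<omega>. \<bar>step_integral Z (S n) \<omega> - Y \<omega>\<bar>) < inverse (real (Suc n))"
    by metis
  have "(\<lambda>n. Lp_dist \<alpha> (step_fun (S n)) f) \<longlonglongrightarrow> 0"
    by (rule tendsto_sandwich[OF _ _ tendsto_const LIMSEQ_inverse_real_of_nat])
       (use S(2) in \<open>auto intro!: always_eventually less_imp_le simp del: of_nat_Suc\<close>)
  moreover have "(\<lambda>n. expectation (\<lambda>\<omega>. \<bar>step_integral Z (S n) \<omega> - Y \<omega>\<bar>)) \<longlonglongrightarrow> 0"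
    by (rule tendsto_sandwich[OF _ _ tendsto_const LIMSEQ_inverse_real_of_nat])
       (use S(3) in \<open>auto intro!: always_eventually less_imp_le simp del: of_nat_Suc\<close>)
  then have "converges_in_prob M (\<lambda>n. step_integral Z (S n)) Y sequentially"
    using Y by (intro converges_in_prob_of_L1) auto
  ultimately show ?thesis
    using f Y S(1) unfolding has_stable_integral_def in_Lp_def Lp_dist_def steps_ok_def
    by (intro conjI exI[of _ S]) auto
qed

lemma has_stable_integral_step:
  "steps_ok xs \<Longrightarrow> has_stable_integral M \<alpha> Z (step_fun xs) (step_integral Z xs)"
  by (intro has_stable_integralI in_Lp_step_fun exI[of _ xs] conjI)
     (auto simp: Lp_dist_def)

lemma has_stable_integral_cmult:
  assumes "has_stable_integral M \<alpha> Z f Y"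
  shows "has_stable_integral M \<alpha> Z (\<lambda>s. k * f s) (\<lambda>\<omega>. k * Y \<omega>)"
proof (rule has_stable_integralI)
  note Y = has_stable_integral_approx(1)[OF assms]
  show "in_Lp \<alpha> (\<lambda>s. k * f s)" using has_stable_integral_in_Lp[OF assms] by (rule in_Lp_cmult)
  show "integrable M (\<lambda>\<omega>. k * Y \<omega>)" using Y by simp
  fix e :: real assume "e > 0"
  \<comment> \<open>A single tolerance that survives both multiplication by |k|^\<alpha>, for the
    integrand, and by |k|, for the integral; the summand 1 covers k = 0.\<close>
  define e' where "e' = e / (\<bar>k\<bar> powr \<alpha> + \<bar>k\<bar> + 1)"
  have den: "\<bar>k\<bar> powr \<alpha> + \<bar>k\<bar> + 1 > 0" using powr_ge_zero[of "\<bar>k\<bar>" \<alpha>] by linarith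
  then have "e' > 0" using \<open>e > 0\<close> by (simp add: e'_def)
  have mult: "\<bar>k\<bar> powr \<alpha> * x < e" "\<bar>k\<bar> * x < e" if "0 \<le> x" "x < e'" for x
  proof -
    have "(\<bar>k\<bar> powr \<alpha> + \<bar>k\<bar> + 1) * x < e"
      using that den by (simp add: e'_def pos_less_divide_eq mult.commute)
    moreover have "\<bar>k\<bar> powr \<alpha> * x \<ge> 0" "\<bar>k\<bar> * x \<ge> 0" using that by auto
    ultimately show "\<bar>k\<bar> powr \<alpha> * x < e" "\<bar>k\<bar> * x < e"
      using that(1) unfolding distrib_right by linarith+
  qed
  from has_stable_integral_approx(2)[OF assms \<open>e' > 0\<close>] obtain xs where xs: "steps_ok xs"
    "Lp_dist \<alpha> (step_fun xs) f < e'" "expectation (\<lambda>\<omega>. \<bar>step_integral Z xs \<omega> - Y \<omega>\<bar>) < e'" by blast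
  have "Lp_dist \<alpha> (step_fun (scale_steps k xs)) (\<lambda>s. k * f s) = \<bar>k\<bar> powr \<alpha> * Lp_dist \<alpha> (step_fun xs) f"
    by (simp add: Lp_dist_def step_fun_scale abs_mult powr_mult flip: right_diff_distrib)
  moreover have "expectation (\<lambda>\<omega>. \<bar>step_integral Z (scale_steps k xs) \<omega> - k * Y \<omega>\<bar>) =
      \<bar>k\<bar> * expectation (\<lambda>\<omega>. \<bar>step_integral Z xs \<omega> - Y \<omega>\<bar>)"
    by (simp add: step_integral_scale abs_mult flip: right_diff_distrib)
  ultimately show "\<exists>xs. steps_ok xs \<and> Lp_dist \<alpha> (step_fun xs) (\<lambda>s. k * f s) < e \<and>
      expectation (\<lambda>\<omega>. \<bar>step_integral Z xs \<omega> - k * Y \<omega>\<bar>) < e"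
    using xs by (intro exI[of _ "scale_steps k xs"]) (simp add: mult)
qed

lemma has_stable_integral_add:
  assumes "has_stable_integral M \<alpha> Z f X" "has_stable_integral M \<alpha> Z g Y"
  shows "has_stable_integral M \<alpha> Z (\<lambda>s. f s + g s) (\<lambda>\<omega>. X \<omega> + Y \<omega>)"
proof (rule has_stable_integralI)
  note X = has_stable_integral_approx(1)[OF assms(1)] and Y = has_stable_integral_approx(1)[OF assms(2)]
  note f = has_stable_integral_in_Lp[OF assms(1)] and g = has_stable_integral_in_Lp[OF assms(2)]
  show "in_Lp \<alpha> (\<lambda>s. f s + g s)" by (intro in_Lp_add alpha_pos f g)
  show "integrable M (\<lambda>\<omega>. X \<omega> + Y \<omega>)" using X Y by simp
  fix e :: real assume "e > 0"
  \<comment> \<open>The integrals need e/2 each; the integrands need the further factor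
    2^(-\<alpha>) to absorb the constant of the weakened triangle inequality.\<close>
  define e' where "e' = min (e / 2) (e / (2 * 2 powr \<alpha>))"
  have "e' > 0" using \<open>e > 0\<close> by (simp add: e'_def)
  from has_stable_integral_approx(2)[OF assms(1) this] obtain xs where xs: "steps_ok xs"
    "Lp_dist \<alpha> (step_fun xs) f < e'" "expectation (\<lambda>\<omega>. \<bar>step_integral Z xs \<omega> - X \<omega>\<bar>) < e'" by blast
  from has_stable_integral_approx(2)[OF assms(2) \<open>e' > 0\<close>] obtain ys where ys: "steps_ok ys"
    "Lp_dist \<alpha> (step_fun ys) g < e'" "expectation (\<lambda>\<omega>. \<bar>step_integral Z ys \<omega> - Y \<omega>\<bar>) < e'" by blast
  have int: "integrable lborel (\<lambda>s. \<bar>step_fun xs s - f s\<bar> powr \<alpha>)"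
    "integrable lborel (\<lambda>s. \<bar>step_fun ys s - g s\<bar> powr \<alpha>)"
    "integrable lborel (\<lambda>s. \<bar>step_fun (xs @ ys) s - (f s + g s)\<bar> powr \<alpha>)"
    using in_Lp_diff[OF alpha_pos in_Lp_step_fun[OF xs(1)] f] in_Lp_diff[OF alpha_pos in_Lp_step_fun[OF ys(1)] g]
      in_Lp_diff[OF alpha_pos in_Lp_step_fun[of "xs @ ys"] in_Lp_add[OF alpha_pos f g]] xs(1) ys(1)
    by (simp_all add: in_Lp_def)
  have "Lp_dist \<alpha> (step_fun (xs @ ys)) (\<lambda>s. f s + g s) \<le>
      (\<integral>s. 2 powr \<alpha> * (\<bar>step_fun xs s - f s\<bar> powr \<alpha> + \<bar>step_fun ys s - g s\<bar> powr \<alpha>) \<partial>lborel)"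
    unfolding Lp_dist_def
  proof (rule integral_mono)
    show "\<bar>step_fun (xs @ ys) s - (f s + g s)\<bar> powr \<alpha> \<le>
        2 powr \<alpha> * (\<bar>step_fun xs s - f s\<bar> powr \<alpha> + \<bar>step_fun ys s - g s\<bar> powr \<alpha>)" for s
      using abs_add_powr_le[OF alpha_pos, of "step_fun xs s - f s" "step_fun ys s - g s"]
      by (simp add: algebra_simps)
  qed (use int in auto)
  also have "\<dots> = 2 powr \<alpha> * (Lp_dist \<alpha> (step_fun xs) f + Lp_dist \<alpha> (step_fun ys) g)"
    using int by (simp add: Lp_dist_def)
  also have "\<dots> < 2 powr \<alpha> * (e / (2 * 2 powr \<alpha>) + e / (2 * 2 powr \<alpha>))"
    using xs ys by (intro mult_strict_left_mono add_strict_mono) (auto simp: e'_def)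
  also have "\<dots> = e" by simp
  finally have 1: "Lp_dist \<alpha> (step_fun (xs @ ys)) (\<lambda>s. f s + g s) < e" .
  have "expectation (\<lambda>\<omega>. \<bar>step_integral Z (xs @ ys) \<omega> - (X \<omega> + Y \<omega>)\<bar>) \<le>
      expectation (\<lambda>\<omega>. \<bar>step_integral Z xs \<omega> - X \<omega>\<bar> + \<bar>step_integral Z ys \<omega> - Y \<omega>\<bar>)"
    using X Y by (intro integral_mono) auto
  also have "\<dots> < e"
    using X Y xs ys by (simp add: e'_def)
  finally show "\<exists>xs. steps_ok xs \<and> Lp_dist \<alpha> (step_fun xs) (\<lambda>s. f s + g s) < e \<and>
      expectation (\<lambda>\<omega>. \<bar>step_integral Z xs \<omega> - (X \<omega> + Y \<omega>)\<bar>) < e"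
    using 1 xs(1) ys(1) by (intro exI[of _ "xs @ ys"]) simp
qed

lemma has_stable_integral_diff:
  assumes "has_stable_integral M \<alpha> Z f X" "has_stable_integral M \<alpha> Z g Y"
  shows "has_stable_integral M \<alpha> Z (\<lambda>s. f s - g s) (\<lambda>\<omega>. X \<omega> - Y \<omega>)"
  using has_stable_integral_add[OF assms(1) has_stable_integral_cmult[OF assms(2), of "-1"]] by simp

lemma has_stable_integral_zero: "has_stable_integral M \<alpha> Z (\<lambda>s. 0) (\<lambda>\<omega>. 0)"
  using has_stable_integral_step[of "[]"] by (simp add: step_fun_def[abs_def] step_integral_def[abs_def])

lemma has_stable_integral_sum:
  assumes "finite I" "\<And>i. i \<in> I \<Longrightarrow> has_stable_integral M \<alpha> Z (f i) (X i)"
  shows "has_stable_integral M \<alpha> Z (\<lambda>s. \<Sum>i\<in>I. f i s) (\<lambda>\<omega>. \<Sum>i\<in>I. X i \<omega>)"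
  using assms
  by (induction I) (auto simp: has_stable_integral_zero intro!: has_stable_integral_add)

text \<open>The factor 4 is 2 * 2: one 2 for the positive and negative parts of a step function, the
  other the \<alpha>-th root of the constant 2^\<alpha> in \<open>Lp_dist_triangle\<close>.\<close>

definition C1 :: real where "C1 = 4 * expectation (\<lambda>\<omega>. \<bar>Z 1 \<omega>\<bar>)"

lemma C1_nonneg: "C1 \<ge> 0" by (simp add: C1_def)

lemma expectation_abs_stable_integral:
  assumes "has_stable_integral M \<alpha> Z f Y"
  shows "expectation (\<lambda>\<omega>. \<bar>Y \<omega>\<bar>) \<le> C1 * (\<integral>s. \<bar>f s\<bar> powr \<alpha> \<partial>lborel) powr (1 / \<alpha>)"
proof (rule LIMSEQ_le_const)
  note Y = has_stable_integral_approx(1)[OF assms] and f = has_stable_integral_in_Lp[OF assms]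
  define I where "I = (\<integral>s. \<bar>f s\<bar> powr \<alpha> \<partial>lborel)"
  have "I \<ge> 0" by (simp add: I_def)
  have eq: "C1 * I powr (1 / \<alpha>) = 2 * expectation (\<lambda>\<omega>. \<bar>Z 1 \<omega>\<bar>) * (2 powr \<alpha> * (0 + I)) powr (1 / \<alpha>) + 0"
    using \<open>I \<ge> 0\<close> alpha_pos by (simp add: powr_mult powr_powr C1_def)
  let ?b = "\<lambda>n. 2 * expectation (\<lambda>\<omega>. \<bar>Z 1 \<omega>\<bar>) * (2 powr \<alpha> * (inverse (real (Suc n)) + I)) powr (1 / \<alpha>) + inverse (real (Suc n))"
  show "?b \<longlonglongrightarrow> C1 * (\<integral>s. \<bar>f s\<bar> powr \<alpha> \<partial>lborel) powr (1 / \<alpha>)"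
    unfolding eq I_def[symmetric]
    using alpha_pos \<open>I \<ge> 0\<close>
    by (intro tendsto_intros tendsto_powr2 LIMSEQ_inverse_real_of_nat always_eventually) auto
  show "\<exists>N. \<forall>n\<ge>N. expectation (\<lambda>\<omega>. \<bar>Y \<omega>\<bar>) \<le> ?b n"
  proof (intro exI allI impI)
    fix n :: nat
    have "inverse (real (Suc n)) > 0" by simp
    from has_stable_integral_approx(2)[OF assms this] obtain xs where xs: "steps_ok xs"
      "Lp_dist \<alpha> (step_fun xs) f < inverse (real (Suc n))"
      "expectation (\<lambda>\<omega>. \<bar>step_integral Z xs \<omega> - Y \<omega>\<bar>) < inverse (real (Suc n))" by blast
    have "in_Lp \<alpha> (\<lambda>_. 0)" by (simp add: in_Lp_def)
    from Lp_dist_triangle[OF alpha_pos in_Lp_step_fun[OF xs(1)] f this]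
    have "(\<integral>s. \<bar>step_fun xs s\<bar> powr \<alpha> \<partial>lborel) \<le> 2 powr \<alpha> * (Lp_dist \<alpha> (step_fun xs) f + I)"
      by (simp add: Lp_dist_def I_def)
    also have "\<dots> \<le> 2 powr \<alpha> * (inverse (real (Suc n)) + I)"
      using xs by (intro mult_left_mono add_right_mono) auto
    finally have le: "(\<integral>s. \<bar>step_fun xs s\<bar> powr \<alpha> \<partial>lborel) powr (1 / \<alpha>) \<le>
        (2 powr \<alpha> * (inverse (real (Suc n)) + I)) powr (1 / \<alpha>)"
      using alpha_pos by (intro powr_mono2) auto
    have "expectation (\<lambda>\<omega>. \<bar>Y \<omega>\<bar>) \<le> expectation (\<lambda>\<omega>. \<bar>step_integral Z xs \<omega>\<bar> + \<bar>step_integral Z xs \<omega> - Y \<omega>\<bar>)"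
      using Y by (intro integral_mono) auto
    also have "\<dots> = expectation (\<lambda>\<omega>. \<bar>step_integral Z xs \<omega>\<bar>) + expectation (\<lambda>\<omega>. \<bar>step_integral Z xs \<omega> - Y \<omega>\<bar>)"
      using Y by (intro Bochner_Integration.integral_add) auto
    also have "\<dots> \<le> ?b n"
    proof (intro add_mono)
      show "expectation (\<lambda>\<omega>. \<bar>step_integral Z xs \<omega>\<bar>) \<le>
          2 * expectation (\<lambda>\<omega>. \<bar>Z 1 \<omega>\<bar>) * (2 powr \<alpha> * (inverse (real (Suc n)) + I)) powr (1 / \<alpha>)"
        by (rule order_trans[OF expectation_abs_step_integral[OF xs(1)]], intro mult_left_mono le) simp
    qed (use xs in simp)
    finally show "expectation (\<lambda>\<omega>. \<bar>Y \<omega>\<bar>) \<le> ?b n" .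
  qed
qed

text \<open>A step function close to \<open>g\<close> is close to \<open>f\<close>, and its integral
  is close to \<open>Y\<close>. Applied to finite averages this yields the averaged kernel; with
  \<open>g = f\<close> it allows changing \<open>Y\<close> on a null set.\<close>

lemma has_stable_integral_closed:
  assumes f: "in_Lp \<alpha> f" and Y: "integrable M Y"
    and approx: "\<And>e. e > 0 \<Longrightarrow> \<exists>g X. has_stable_integral M \<alpha> Z g X \<and> Lp_dist \<alpha> g f < e \<and>
      expectation (\<lambda>\<omega>. \<bar>X \<omega> - Y \<omega>\<bar>) < e"
  shows "has_stable_integral M \<alpha> Z f Y"
proof (rule has_stable_integralI[OF f Y])
  fix e :: real assume "e > 0"
  define e' where "e' = min (e / 2) (e / (2 * 2 powr \<alpha>))"
  have "e' > 0" using \<open>e > 0\<close> by (simp add: e'_def)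
  from approx[OF this] obtain g X where g: "has_stable_integral M \<alpha> Z g X" "Lp_dist \<alpha> g f < e'"
    "expectation (\<lambda>\<omega>. \<bar>X \<omega> - Y \<omega>\<bar>) < e'" by blast
  note X = has_stable_integral_approx(1)[OF g(1)]
  from has_stable_integral_approx(2)[OF g(1) \<open>e' > 0\<close>] obtain xs where xs: "steps_ok xs"
    "Lp_dist \<alpha> (step_fun xs) g < e'" "expectation (\<lambda>\<omega>. \<bar>step_integral Z xs \<omega> - X \<omega>\<bar>) < e'" by blast
  have "Lp_dist \<alpha> (step_fun xs) f \<le> 2 powr \<alpha> * (Lp_dist \<alpha> (step_fun xs) g + Lp_dist \<alpha> g f)"
    by (rule Lp_dist_triangle[OF alpha_pos in_Lp_step_fun[OF xs(1)] has_stable_integral_in_Lp[OF g(1)] f])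
  also have "\<dots> < 2 powr \<alpha> * (e / (2 * 2 powr \<alpha>) + e / (2 * 2 powr \<alpha>))"
    using xs g by (intro mult_strict_left_mono add_strict_mono) (auto simp: e'_def)
  also have "\<dots> = e" by simp
  finally have 1: "Lp_dist \<alpha> (step_fun xs) f < e" .
  have "expectation (\<lambda>\<omega>. \<bar>step_integral Z xs \<omega> - Y \<omega>\<bar>) \<le>
      expectation (\<lambda>\<omega>. \<bar>step_integral Z xs \<omega> - X \<omega>\<bar> + \<bar>X \<omega> - Y \<omega>\<bar>)"
    using X Y by (intro integral_mono) auto
  also have "\<dots> < e" using X Y xs g by (simp add: e'_def)
  finally show "\<exists>xs. steps_ok xs \<and> Lp_dist \<alpha> (step_fun xs) f < e \<and>
      expectation (\<lambda>\<omega>. \<bar>step_integral Z xs \<omega> - Y \<omega>\<bar>) < e"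
    using 1 xs(1) by blast
qed

lemma has_stable_integral_cong_AE:
  assumes "has_stable_integral M \<alpha> Z f X" "AE \<omega> in M. X \<omega> = Y \<omega>" "Y \<in> borel_measurable M"
  shows "has_stable_integral M \<alpha> Z f Y"
proof -
  note X = has_stable_integral_approx(1)[OF assms(1)]
  have Y: "integrable M Y"
    using X assms(2,3) by (subst integrable_cong_AE[of _ _ X]) auto
  have "expectation (\<lambda>\<omega>. \<bar>X \<omega> - Y \<omega>\<bar>) = expectation (\<lambda>_. 0)"
    using assms X Y by (intro integral_cong_AE) auto
  then show ?thesis
    using assms(1) by (intro has_stable_integral_closed[OF has_stable_integral_in_Lp[OF assms(1)] Y] exI[of _ f] exI[of _ X])
      (auto simp: Lp_dist_def)
qed

text \<open>The difference is an integral of the zero function, so its first absolute moment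
  vanishes.\<close>

lemma has_stable_integral_unique:
  assumes "has_stable_integral M \<alpha> Z f X" "has_stable_integral M \<alpha> Z f Y"
  shows "AE \<omega> in M. X \<omega> = Y \<omega>"
proof -
  have int: "integrable M (\<lambda>\<omega>. \<bar>X \<omega> - Y \<omega>\<bar>)"
    using assms[THEN has_stable_integral_approx(1)] by simp
  have "expectation (\<lambda>\<omega>. \<bar>X \<omega> - Y \<omega>\<bar>) \<le> 0"
    using expectation_abs_stable_integral[OF has_stable_integral_diff[OF assms]] alpha_pos by simp
  moreover have "expectation (\<lambda>\<omega>. \<bar>X \<omega> - Y \<omega>\<bar>) \<ge> 0" by simp
  ultimately have "expectation (\<lambda>\<omega>. \<bar>X \<omega> - Y \<omega>\<bar>) = 0" by linarith
  then show ?thesis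
    using integral_nonneg_eq_0_iff_AE[OF int] by auto
qed

end

section \<open>Equality of finite-dimensional distributions\<close>

text \<open>Orthants are stable under intersection, generate the product sigma-algebra and exhaust
  the space, so joint distribution functions determine the law.\<close>

lemma (in prob_space) distr_PiM_eqI_atMost:
  fixes X Y :: "'i \<Rightarrow> 'a \<Rightarrow> real"
  assumes J: "finite J"
    and [measurable]: "\<And>t. t \<in> J \<Longrightarrow> X t \<in> borel_measurable M" "\<And>t. t \<in> J \<Longrightarrow> Y t \<in> borel_measurable M"
    and eq: "\<And>a. prob {\<omega> \<in> space M. \<forall>t\<in>J. X t \<omega> \<le> a t} = prob {\<omega> \<in> space M. \<forall>t\<in>J. Y t \<omega> \<le> a t}"
  shows "distr M (PiM J (\<lambda>_. borel)) (\<lambda>\<omega>. \<lambda>t\<in>J. X t \<omega>) =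
    distr M (PiM J (\<lambda>_. borel)) (\<lambda>\<omega>. \<lambda>t\<in>J. Y t \<omega>)"
proof -
  define E where "E = {Pi\<^sub>E J (\<lambda>t. {..a t}) | a :: 'i \<Rightarrow> real. True}"
  \<comment> \<open>\<open>Q\<close> is the family of orthants in the shape in which
    \<open>sets_PiM_sigma\<close> expects a generator of a product.\<close>
  define Q where "Q = {{f \<in> (\<Pi>\<^sub>E i\<in>J. (UNIV::real set)). \<forall>i\<in>j. f i \<in> A i} | A j.
    j \<in> {J} \<and> A \<in> Pi j (\<lambda>_. range atMost)}"
  have Q: "Q = E"
  proof (intro set_eqI iffI)
    fix B assume "B \<in> Q"
    then obtain A where A: "B = {f \<in> (\<Pi>\<^sub>E i\<in>J. UNIV). \<forall>i\<in>J. f i \<in> A i}" "\<forall>i\<in>J. A i \<in> range atMost"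
      by (auto simp: Q_def)
    then have "\<forall>i\<in>J. \<exists>b. A i = {..b}" by blast
    then obtain a where "\<forall>i\<in>J. A i = {..a i}" by metis
    then have "B = Pi\<^sub>E J (\<lambda>t. {..a t})" by (auto simp: A(1) PiE_def)
    then show "B \<in> E" by (auto simp: E_def)
  next
    fix B assume "B \<in> E"
    then obtain a where "B = Pi\<^sub>E J (\<lambda>t. {..a t})" by (auto simp: E_def)
    then have "B = {f \<in> (\<Pi>\<^sub>E i\<in>J. UNIV). \<forall>i\<in>J. f i \<in> {..a i}}" by (auto simp: PiE_def)
    then show "B \<in> Q" unfolding Q_def mem_Collect_eq
      by (intro exI[of _ "\<lambda>i. {..a i}"] exI[of _ J] conjI) auto
  qed
  have "sets (\<Pi>\<^sub>M i\<in>J. sigma UNIV (range (atMost :: real \<Rightarrow> _))) = sets (sigma (\<Pi>\<^sub>E i\<in>J. UNIV) Q)"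
    unfolding Q_def
  proof (rule sets_PiM_sigma)
    show "\<exists>S\<subseteq>range atMost. countable S \<and> (UNIV::real set) = \<Union>S"
    proof (intro exI[of _ "range (\<lambda>n::nat. {..real n})"] conjI)
      show "(UNIV::real set) = (\<Union>n::nat. {..real n})" using real_arch_simple by auto
    qed auto
  qed (use J in auto)
  moreover have "borel = sigma UNIV (range (atMost :: real \<Rightarrow> _))"
    by (simp add: borel_eq_atMost)
  moreover have "E \<subseteq> Pow (\<Pi>\<^sub>E i\<in>J. UNIV)" by (auto simp: E_def)
  ultimately have sets: "sets (PiM J (\<lambda>_. borel :: real measure)) = sigma_sets (\<Pi>\<^sub>E i\<in>J. UNIV) E"
    by (simp only: Q sets_measure_of)
  show ?thesis
  proof (rule measure_eqI_generator_eq)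
    show "Int_stable E"
    proof (rule Int_stableI)
      fix A B assume "A \<in> E" "B \<in> E"
      then obtain a b where "A = Pi\<^sub>E J (\<lambda>t. {..a t})" "B = Pi\<^sub>E J (\<lambda>t. {..b t})" by (auto simp: E_def)
      then have "A \<inter> B = Pi\<^sub>E J (\<lambda>t. {..min (a t) (b t)})"
        by (auto simp: PiE_def Pi_def)
      then show "A \<inter> B \<in> E" by (auto simp: E_def)
    qed
    show "E \<subseteq> Pow (\<Pi>\<^sub>E i\<in>J. UNIV)" by (auto simp: E_def)
    show "range (\<lambda>n. Pi\<^sub>E J (\<lambda>t. {..real n})) \<subseteq> E" by (auto simp: E_def)
    show "(\<Union>n. Pi\<^sub>E J (\<lambda>t. {..real n})) = (\<Pi>\<^sub>E i\<in>J. UNIV)"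
    proof (intro equalityI subsetI)
      fix f assume f: "f \<in> (\<Pi>\<^sub>E i\<in>J. (UNIV::real set))"
      obtain n :: nat where "Max (f ` J) \<le> real n" using real_arch_simple by blast
      then have "f \<in> Pi\<^sub>E J (\<lambda>t. {..real n})"
        using f J by (auto simp: PiE_def Pi_def intro: order_trans[OF Max_ge])
      then show "f \<in> (\<Union>n. Pi\<^sub>E J (\<lambda>t. {..real n}))" by blast
    qed auto
    fix B assume "B \<in> E"
    then obtain a where B: "B = Pi\<^sub>E J (\<lambda>t. {..a t})" by (auto simp: E_def)
    have B_sets: "B \<in> sets (PiM J (\<lambda>_. borel))" unfolding B using J by auto
    have *: "emeasure (distr M (PiM J (\<lambda>_. borel)) (\<lambda>\<omega>. \<lambda>t\<in>J. W t \<omega>)) B =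
        prob {\<omega> \<in> space M. \<forall>t\<in>J. W t \<omega> \<le> a t}"
      if [measurable]: "\<And>t. t \<in> J \<Longrightarrow> W t \<in> borel_measurable M" for W
    proof -
      have "(\<lambda>\<omega>. \<lambda>t\<in>J. W t \<omega>) -` B \<inter> space M = {\<omega> \<in> space M. \<forall>t\<in>J. W t \<omega> \<le> a t}"
        by (auto simp: B PiE_def Pi_def)
      then show ?thesis
        using B_sets by (subst emeasure_distr) (auto simp: emeasure_eq_measure intro!: measurable_restrict)
    qed
    show "emeasure (distr M (PiM J (\<lambda>_. borel)) (\<lambda>\<omega>. \<lambda>t\<in>J. X t \<omega>)) B =
        emeasure (distr M (PiM J (\<lambda>_. borel)) (\<lambda>\<omega>. \<lambda>t\<in>J. Y t \<omega>)) B"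
      by (simp add: * eq)
  next
    fix n :: nat
    interpret D: prob_space "distr M (PiM J (\<lambda>_. borel)) (\<lambda>\<omega>. \<lambda>t\<in>J. X t \<omega>)"
      by (intro prob_space_distr measurable_restrict) simp
    show "emeasure (distr M (PiM J (\<lambda>_. borel)) (\<lambda>\<omega>. \<lambda>t\<in>J. X t \<omega>)) (Pi\<^sub>E J (\<lambda>t. {..real n})) \<noteq> \<infinity>"
      by simp
  qed (simp_all add: sets)
qed

text \<open>For \<open>k > 0\<close> a continuous approximation from above to the indicator of
  \<open>{..a}\<close>: it falls linearly from 1 at \<open>a\<close> to 0 at a + 1/k. Being
  Lipschitz, it tolerates errors that are small in \<open>L^1\<close>, which the indicator does
  not.\<close>

definition ramp :: "nat \<Rightarrow> real \<Rightarrow> real \<Rightarrow> real" where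
  "ramp k a x = max 0 (min 1 (1 - real k * (x - a)))"

lemma ramp_bounds: "0 \<le> ramp k a x" "ramp k a x \<le> 1"
  by (auto simp: ramp_def)

lemma borel_measurable_ramp [measurable]: "ramp k a \<in> borel_measurable borel"
  unfolding ramp_def[abs_def] by measurable

lemma ramp_lipschitz: "\<bar>ramp k a x - ramp k a y\<bar> \<le> real k * \<bar>x - y\<bar>"
proof -
  have "\<bar>ramp k a x - ramp k a y\<bar> \<le> \<bar>real k * (x - a) - real k * (y - a)\<bar>"
    by (auto simp: ramp_def max_def min_def)
  also have "\<dots> = real k * \<bar>x - y\<bar>"
    by (simp add: abs_mult flip: right_diff_distrib)
  finally show ?thesis .
qed

lemma tendsto_ramp: "(\<lambda>k. ramp k a x) \<longlonglongrightarrow> indicator {..a} x"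
proof (cases "x \<le> a")
  case True
  then have "real k * (x - a) \<le> 0" for k by (simp add: mult_nonneg_nonpos)
  then have "ramp k a x = 1" for k unfolding ramp_def by (simp add: min_def)
  then show ?thesis using True by simp
next
  case False
  have "\<forall>\<^sub>F k in sequentially. ramp k a x = 0"
  proof -
    obtain K :: nat where K: "1 / (x - a) \<le> real K" using real_arch_simple by blast
    have "ramp k a x = 0" if "k \<ge> K" for k
    proof -
      have "1 / (x - a) \<le> real k" using K that by (meson of_nat_mono order_trans)
      then have "1 \<le> real k * (x - a)" using False by (simp add: field_simps)
      then show ?thesis by (simp add: ramp_def)
    qed
    then show ?thesis by (auto simp: eventually_sequentially)
  qed
  then show ?thesis using False by (auto intro: tendsto_eventually)
qed

lemma (in prob_space) tendsto_expectation_prod_ramp: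
  assumes J: "finite J" and [measurable]: "\<And>t. t \<in> J \<Longrightarrow> X t \<in> borel_measurable M"
  shows "(\<lambda>k. expectation (\<lambda>\<omega>. \<Prod>t\<in>J. ramp k (a t) (X t \<omega>))) \<longlonglongrightarrow>
    prob {\<omega> \<in> space M. \<forall>t\<in>J. X t \<omega> \<le> a t}"
proof -
  let ?A = "{\<omega> \<in> space M. \<forall>t\<in>J. X t \<omega> \<le> a t}"
  have [measurable]: "?A \<in> events" using J by measurable
  have "(\<lambda>k. expectation (\<lambda>\<omega>. \<Prod>t\<in>J. ramp k (a t) (X t \<omega>))) \<longlonglongrightarrow> expectation (indicator ?A)"
  proof (rule integral_dominated_convergence[where w = "\<lambda>_. 1"])
    show "AE \<omega> in M. (\<lambda>k. \<Prod>t\<in>J. ramp k (a t) (X t \<omega>)) \<longlonglongrightarrow> indicator ?A \<omega>"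
    proof (rule AE_I2)
      fix \<omega> assume "\<omega> \<in> space M"
      have "(\<lambda>k. \<Prod>t\<in>J. ramp k (a t) (X t \<omega>)) \<longlonglongrightarrow> (\<Prod>t\<in>J. indicator {..a t} (X t \<omega>))"
        by (intro tendsto_prod tendsto_ramp)
      also have "(\<Prod>t\<in>J. indicator {..a t} (X t \<omega>)) = (indicator ?A \<omega> :: real)"
      proof (cases "\<forall>t\<in>J. X t \<omega> \<le> a t")
        case True
        then show ?thesis using \<open>\<omega> \<in> space M\<close> by (simp add: indicator_def)
      next
        case False
        then show ?thesis using J by (auto simp: indicator_def prod_zero_iff)
      qed
      finally show "(\<lambda>k. \<Prod>t\<in>J. ramp k (a t) (X t \<omega>)) \<longlonglongrightarrow> indicator ?A \<omega>" .
    qed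
    show "AE \<omega> in M. norm (\<Prod>t\<in>J. ramp k (a t) (X t \<omega>)) \<le> 1" for k
      by (intro AE_I2) (simp add: abs_prod ramp_bounds prod_le_1)
  qed measurable
  then show ?thesis by simp
qed

text \<open>Expectations of products of ramps depend on the variables in a Lipschitz way with
  respect to \<open>L^1\<close>. Equal laws of \<open>U\<close> and \<open>V\<close> therefore force
  equal expectations for \<open>X\<close> and \<open>Y\<close>, and letting \<open>k\<close> tend to
  infinity recovers the joint distribution functions.\<close>

lemma (in prob_space) distr_PiM_eqI_L1_approx:
  fixes X Y :: "'i \<Rightarrow> 'a \<Rightarrow> real"
  assumes J: "finite J"
    and X: "\<And>t. t \<in> J \<Longrightarrow> integrable M (X t)" and Y: "\<And>t. t \<in> J \<Longrightarrow> integrable M (Y t)"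
    and approx: "\<And>e. e > 0 \<Longrightarrow> \<exists>U V.
      (\<forall>t\<in>J. integrable M (U t) \<and> integrable M (V t) \<and>
        expectation (\<lambda>\<omega>. \<bar>U t \<omega> - X t \<omega>\<bar>) < e \<and> expectation (\<lambda>\<omega>. \<bar>V t \<omega> - Y t \<omega>\<bar>) < e) \<and>
      distr M (PiM J (\<lambda>_. borel)) (\<lambda>\<omega>. \<lambda>t\<in>J. U t \<omega>) = distr M (PiM J (\<lambda>_. borel)) (\<lambda>\<omega>. \<lambda>t\<in>J. V t \<omega>)"
  shows "distr M (PiM J (\<lambda>_. borel)) (\<lambda>\<omega>. \<lambda>t\<in>J. X t \<omega>) =
    distr M (PiM J (\<lambda>_. borel)) (\<lambda>\<omega>. \<lambda>t\<in>J. Y t \<omega>)"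
proof -
  note meas = borel_measurable_integrable
  have close: "\<bar>expectation (\<lambda>\<omega>. \<Prod>t\<in>J. ramp k (a t) (U t \<omega>)) - expectation (\<lambda>\<omega>. \<Prod>t\<in>J. ramp k (a t) (V t \<omega>))\<bar> \<le>
      real k * (\<Sum>t\<in>J. expectation (\<lambda>\<omega>. \<bar>U t \<omega> - V t \<omega>\<bar>))"
    if U: "\<And>t. t \<in> J \<Longrightarrow> integrable M (U t)" and V: "\<And>t. t \<in> J \<Longrightarrow> integrable M (V t)" for U V k a
  proof -
    note [measurable] = meas[OF U] meas[OF V]
    have int: "integrable M (\<lambda>\<omega>. \<Prod>t\<in>J. ramp k (a t) (W t \<omega>))"
      if [measurable]: "\<And>t. t \<in> J \<Longrightarrow> W t \<in> borel_measurable M" for W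
      by (rule integrable_const_bound[where B = 1])
         (auto simp: abs_prod ramp_bounds prod_le_1 intro!: AE_I2)
    have "\<bar>expectation (\<lambda>\<omega>. \<Prod>t\<in>J. ramp k (a t) (U t \<omega>)) - expectation (\<lambda>\<omega>. \<Prod>t\<in>J. ramp k (a t) (V t \<omega>))\<bar> =
        \<bar>expectation (\<lambda>\<omega>. (\<Prod>t\<in>J. ramp k (a t) (U t \<omega>)) - (\<Prod>t\<in>J. ramp k (a t) (V t \<omega>)))\<bar>"
      by (subst Bochner_Integration.integral_diff) (auto intro!: int)
    also have "\<dots> \<le> expectation (\<lambda>\<omega>. \<bar>(\<Prod>t\<in>J. ramp k (a t) (U t \<omega>)) - (\<Prod>t\<in>J. ramp k (a t) (V t \<omega>))\<bar>)"
      by (rule integral_abs_bound)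
    also have "\<dots> \<le> expectation (\<lambda>\<omega>. real k * (\<Sum>t\<in>J. \<bar>U t \<omega> - V t \<omega>\<bar>))"
    proof (rule integral_mono)
      show "integrable M (\<lambda>\<omega>. \<bar>(\<Prod>t\<in>J. ramp k (a t) (U t \<omega>)) - (\<Prod>t\<in>J. ramp k (a t) (V t \<omega>))\<bar>)"
        by (intro integrable_abs Bochner_Integration.integrable_diff int) auto
      show "integrable M (\<lambda>\<omega>. real k * (\<Sum>t\<in>J. \<bar>U t \<omega> - V t \<omega>\<bar>))"
        using U V by auto
      fix \<omega>
      have "norm ((\<Prod>t\<in>J. ramp k (a t) (U t \<omega>)) - (\<Prod>t\<in>J. ramp k (a t) (V t \<omega>))) \<le>
          (\<Sum>t\<in>J. norm (ramp k (a t) (U t \<omega>) - ramp k (a t) (V t \<omega>)))"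
        by (rule norm_prod_diff) (auto simp: ramp_bounds)
      also have "\<dots> \<le> (\<Sum>t\<in>J. real k * \<bar>U t \<omega> - V t \<omega>\<bar>)"
        by (intro sum_mono) (simp add: ramp_lipschitz)
      finally show "\<bar>(\<Prod>t\<in>J. ramp k (a t) (U t \<omega>)) - (\<Prod>t\<in>J. ramp k (a t) (V t \<omega>))\<bar> \<le>
          real k * (\<Sum>t\<in>J. \<bar>U t \<omega> - V t \<omega>\<bar>)"
        by (simp add: sum_distrib_left)
    qed
    also have "\<dots> = real k * (\<Sum>t\<in>J. expectation (\<lambda>\<omega>. \<bar>U t \<omega> - V t \<omega>\<bar>))"
      using U V by (subst integral_mult_right_zero, subst Bochner_Integration.integral_sum) auto
    finally show ?thesis .
  qed
  have eq: "expectation (\<lambda>\<omega>. \<Prod>t\<in>J. ramp k (a t) (X t \<omega>)) = expectation (\<lambda>\<omega>. \<Prod>t\<in>J. ramp k (a t) (Y t \<omega>))"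
    (is "?x = ?y") for k a
  proof -
    have "\<bar>?x - ?y\<bar> \<le> 0"
    proof (rule field_le_epsilon)
      fix \<epsilon> :: real assume "\<epsilon> > 0"
      \<comment> \<open>Two replacements cost \<open>k * card J * e\<close> each; the summand 1 in
        the denominator covers \<open>k = 0\<close> and empty \<open>J\<close>.\<close>
      define e where "e = \<epsilon> / (2 * (real k * real (card J) + 1))"
      have den: "real k * real (card J) + 1 > 0" by (simp add: add_nonneg_pos)
      have "e > 0" using \<open>\<epsilon> > 0\<close> den by (simp add: e_def)
      from approx[OF this] obtain U V where UV:
        "\<And>t. t \<in> J \<Longrightarrow> integrable M (U t)" "\<And>t. t \<in> J \<Longrightarrow> integrable M (V t)"
        "\<And>t. t \<in> J \<Longrightarrow> expectation (\<lambda>\<omega>. \<bar>U t \<omega> - X t \<omega>\<bar>) < e"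
        "\<And>t. t \<in> J \<Longrightarrow> expectation (\<lambda>\<omega>. \<bar>V t \<omega> - Y t \<omega>\<bar>) < e"
        and law: "distr M (PiM J (\<lambda>_. borel)) (\<lambda>\<omega>. \<lambda>t\<in>J. U t \<omega>) = distr M (PiM J (\<lambda>_. borel)) (\<lambda>\<omega>. \<lambda>t\<in>J. V t \<omega>)"
        by blast
      have law_E: "expectation (\<lambda>\<omega>. \<Prod>t\<in>J. ramp k (a t) (W t \<omega>)) =
          (\<integral>v. (\<Prod>t\<in>J. ramp k (a t) (v t)) \<partial>distr M (PiM J (\<lambda>_. borel)) (\<lambda>\<omega>. \<lambda>t\<in>J. W t \<omega>))"
        if [measurable]: "\<And>t. t \<in> J \<Longrightarrow> W t \<in> borel_measurable M" for W
        by (subst integral_distr) (auto intro!: measurable_restrict Bochner_Integration.integral_cong prod.cong)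
      have UV_eq: "expectation (\<lambda>\<omega>. \<Prod>t\<in>J. ramp k (a t) (U t \<omega>)) = expectation (\<lambda>\<omega>. \<Prod>t\<in>J. ramp k (a t) (V t \<omega>))"
        using UV(1,2) by (simp add: law_E meas law)
      have "real k * (\<Sum>t\<in>J. expectation (\<lambda>\<omega>. \<bar>U t \<omega> - X t \<omega>\<bar>)) \<le> real k * (\<Sum>t\<in>J. e)"
        "real k * (\<Sum>t\<in>J. expectation (\<lambda>\<omega>. \<bar>V t \<omega> - Y t \<omega>\<bar>)) \<le> real k * (\<Sum>t\<in>J. e)"
        using UV(3,4)[THEN less_imp_le] by (auto intro!: mult_left_mono sum_mono simp del: sum_constant)
      then have "\<bar>?x - ?y\<bar> \<le> 2 * (real k * (\<Sum>t\<in>J. e))"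
        using close[of U X k a, OF UV(1) X] close[of V Y k a, OF UV(2) Y] UV_eq by simp
      also have "\<dots> = \<epsilon> * (real k * real (card J) / (real k * real (card J) + 1))"
        using den by (simp add: e_def field_simps)
      also have "\<dots> \<le> \<epsilon> * 1"
        using \<open>\<epsilon> > 0\<close> den by (intro mult_left_mono) auto
      finally show "\<bar>?x - ?y\<bar> \<le> 0 + \<epsilon>" by simp
    qed
    then show ?thesis by simp
  qed
  show ?thesis
  proof (rule distr_PiM_eqI_atMost[OF J])
    fix a
    have "(\<lambda>k. expectation (\<lambda>\<omega>. \<Prod>t\<in>J. ramp k (a t) (X t \<omega>))) \<longlonglongrightarrow> prob {\<omega> \<in> space M. \<forall>t\<in>J. X t \<omega> \<le> a t}"
      by (intro tendsto_expectation_prod_ramp J meas X)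
    moreover have "(\<lambda>k. expectation (\<lambda>\<omega>. \<Prod>t\<in>J. ramp k (a t) (X t \<omega>))) \<longlonglongrightarrow> prob {\<omega> \<in> space M. \<forall>t\<in>J. Y t \<omega> \<le> a t}"
      unfolding eq by (intro tendsto_expectation_prod_ramp J meas Y)
    ultimately show "prob {\<omega> \<in> space M. \<forall>t\<in>J. X t \<omega> \<le> a t} = prob {\<omega> \<in> space M. \<forall>t\<in>J. Y t \<omega> \<le> a t}"
      by (rule LIMSEQ_unique)
  qed (auto intro: meas X Y)
qed

section \<open>Translation invariance of the joint law of stable integrals\<close>

context centered_stable_levy
begin

text \<open>By independence the joint law is the product of its marginals, and each marginal is
  unchanged by the shift. Writing \<open>Suc n\<close> keeps the index set nonempty, as the
  characterisation of independence by product measures demands.\<close>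

lemma distr_increments_shift:
  assumes "strict_mono t"
  shows "distr M (PiM {..<Suc n} (\<lambda>_. borel)) (\<lambda>\<omega>. \<lambda>i\<in>{..<Suc n}. Z (t (Suc i) + h) \<omega> - Z (t i + h) \<omega>) =
    distr M (PiM {..<Suc n} (\<lambda>_. borel)) (\<lambda>\<omega>. \<lambda>i\<in>{..<Suc n}. Z (t (Suc i)) \<omega> - Z (t i) \<omega>)"
proof -
  have *: "distr M (PiM {..<Suc n} (\<lambda>_. borel)) (\<lambda>\<omega>. \<lambda>i\<in>{..<Suc n}. Z (u (Suc i)) \<omega> - Z (u i) \<omega>) =
      PiM {..<Suc n} (\<lambda>i. distr M borel (\<lambda>\<omega>. Z (u (Suc i)) \<omega> - Z (u i) \<omega>))"
    if "strict_mono u" for u :: "nat \<Rightarrow> real"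
    using indep_increments[OF that, of "Suc n"]
    by (subst (asm) indep_vars_iff_distr_eq_PiM') auto
  have "strict_mono (\<lambda>i. t i + h)" using assms by (simp add: strict_mono_def)
  from *[OF this] *[OF assms] show ?thesis by (simp add: stationary_increments)
qed

lemma distr_step_integrals_shift:
  assumes J: "finite J" and ok: "\<And>t. t \<in> J \<Longrightarrow> steps_ok (xs t)"
  shows "distr M (PiM J (\<lambda>_. borel)) (\<lambda>\<omega>. \<lambda>t\<in>J. step_integral Z (xs t) \<omega>) =
    distr M (PiM J (\<lambda>_. borel)) (\<lambda>\<omega>. \<lambda>t\<in>J. step_integral Z (shift_steps h (xs t)) \<omega>)"
proof -
  obtain u :: "nat \<Rightarrow> real" and n where u: "strict_mono u" and
    part: "\<And>ys c a b. ys \<in> xs ` J \<Longrightarrow> (c, a, b) \<in> set ys \<Longrightarrow> a \<in> u ` {..n} \<and> b \<in> u ` {..n}"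
    by (rule ex_common_partition[of "xs ` J"], simp add: J, rule that)
  have part': "a \<in> u ` {..Suc n} \<and> b \<in> u ` {..Suc n}" if "t \<in> J" "(c, a, b) \<in> set (xs t)" for t c a b
    using part[of "xs t" c a b] that by (auto intro!: image_eqI)
  \<comment> \<open>The weights do not involve the integrator, so the same measurable linear map
    sends the increments of \<open>Z\<close> and those of its translate to the respective step
    integrals.\<close>
  define \<Phi> where "\<Phi> v = (\<lambda>t\<in>J. \<Sum>i<Suc n. step_fun (xs t) (u (Suc i)) * v i)" for v :: "nat \<Rightarrow> real"
  have [measurable]: "\<Phi> \<in> PiM {..<Suc n} (\<lambda>_. borel) \<rightarrow>\<^sub>M PiM J (\<lambda>_. borel)"
    unfolding \<Phi>_def[abs_def] by (intro measurable_restrict borel_measurable_sum borel_measurable_times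
        borel_measurable_const measurable_component_singleton)
  have rep: "(\<lambda>t\<in>J. step_integral Z' (xs t) \<omega>) = \<Phi> (\<lambda>i\<in>{..<Suc n}. Z' (u (Suc i)) \<omega> - Z' (u i) \<omega>)"
    for Z' :: "real \<Rightarrow> 'w \<Rightarrow> real" and \<omega>
    unfolding \<Phi>_def
  proof (intro restrict_ext)
    fix t assume "t \<in> J"
    show "step_integral Z' (xs t) \<omega> =
        (\<Sum>i<Suc n. step_fun (xs t) (u (Suc i)) * (\<lambda>i\<in>{..<Suc n}. Z' (u (Suc i)) \<omega> - Z' (u i) \<omega>) i)"
      by (subst step_integral_partition[OF u ok[OF \<open>t \<in> J\<close>] part'[OF \<open>t \<in> J\<close>]]) auto
  qed
  have push: "distr M (PiM J (\<lambda>_. borel)) (\<lambda>\<omega>. \<lambda>t\<in>J. step_integral Z' (xs t) \<omega>) =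
      distr (distr M (PiM {..<Suc n} (\<lambda>_. borel)) (\<lambda>\<omega>. \<lambda>i\<in>{..<Suc n}. Z' (u (Suc i)) \<omega> - Z' (u i) \<omega>))
        (PiM J (\<lambda>_. borel)) \<Phi>"
    if "\<And>t. Z' t \<in> borel_measurable M" for Z' :: "real \<Rightarrow> 'w \<Rightarrow> real"
    unfolding rep using that
    by (subst distr_distr) (auto simp: comp_def intro!: measurable_restrict borel_measurable_diff)
  show ?thesis
    unfolding step_integral_shift push[OF Z_measurable] push[of "\<lambda>t. Z (t + h)", OF Z_measurable]
    by (simp only: distr_increments_shift[OF u])
qed

text \<open>If a step function is close to \<open>f t\<close>, its translate is equally close to the
  translate of \<open>f t\<close>, because Lebesgue measure is translation invariant. The two
  families of step integrals have the same law.\<close>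

lemma distr_stable_integrals_shift:
  assumes J: "finite J"
    and X: "\<And>t. t \<in> J \<Longrightarrow> has_stable_integral M \<alpha> Z (f t) (X t)"
    and Y: "\<And>t. t \<in> J \<Longrightarrow> has_stable_integral M \<alpha> Z (\<lambda>s. f t (s - h)) (Y t)"
  shows "distr M (PiM J (\<lambda>_. borel)) (\<lambda>\<omega>. \<lambda>t\<in>J. X t \<omega>) = distr M (PiM J (\<lambda>_. borel)) (\<lambda>\<omega>. \<lambda>t\<in>J. Y t \<omega>)"
proof (rule distr_PiM_eqI_L1_approx[OF J])
  fix e :: real assume "e > 0"
  \<comment> \<open>Small enough both as an error in \<open>L^1\<close> and, after the bound with
    constant \<open>C1\<close> and the root 1/\<alpha>, as an error of integrands;
    \<open>C1 + 1\<close> avoids division by zero.\<close>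
  define d where "d = min e ((e / (C1 + 1)) powr \<alpha>)"
  have "d > 0" using \<open>e > 0\<close> C1_nonneg by (simp add: d_def)
  have d_root: "C1 * x powr (1 / \<alpha>) < e" if "0 \<le> x" "x < d" for x
  proof -
    have "x powr (1 / \<alpha>) \<le> ((e / (C1 + 1)) powr \<alpha>) powr (1 / \<alpha>)"
      using that alpha_pos by (intro powr_mono2) (auto simp: d_def)
    also have "\<dots> = e / (C1 + 1)" using alpha_pos \<open>e > 0\<close> C1_nonneg by (simp add: powr_powr)
    finally have "C1 * x powr (1 / \<alpha>) \<le> C1 * (e / (C1 + 1))"
      using C1_nonneg by (intro mult_left_mono)
    also have "\<dots> < e" using C1_nonneg \<open>e > 0\<close> by (simp add: field_simps)
    finally show ?thesis .
  qed
  have "\<forall>t\<in>J. \<exists>xs. steps_ok xs \<and> Lp_dist \<alpha> (step_fun xs) (f t) < d \<and>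
      expectation (\<lambda>\<omega>. \<bar>step_integral Z xs \<omega> - X t \<omega>\<bar>) < d"
    using has_stable_integral_approx(2)[OF X \<open>d > 0\<close>] by blast
  then obtain xs where xs: "\<And>t. t \<in> J \<Longrightarrow> steps_ok (xs t)"
    "\<And>t. t \<in> J \<Longrightarrow> Lp_dist \<alpha> (step_fun (xs t)) (f t) < d"
    "\<And>t. t \<in> J \<Longrightarrow> expectation (\<lambda>\<omega>. \<bar>step_integral Z (xs t) \<omega> - X t \<omega>\<bar>) < d"
    by metis
  have "expectation (\<lambda>\<omega>. \<bar>step_integral Z (shift_steps h (xs t)) \<omega> - Y t \<omega>\<bar>) < e" if t: "t \<in> J" for t
  proof -
    have "has_stable_integral M \<alpha> Z (\<lambda>s. step_fun (shift_steps h (xs t)) s - f t (s - h))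
        (\<lambda>\<omega>. step_integral Z (shift_steps h (xs t)) \<omega> - Y t \<omega>)"
      using xs(1)[OF t] by (intro has_stable_integral_diff has_stable_integral_step Y t) simp
    from expectation_abs_stable_integral[OF this]
    have "expectation (\<lambda>\<omega>. \<bar>step_integral Z (shift_steps h (xs t)) \<omega> - Y t \<omega>\<bar>) \<le>
        C1 * (\<integral>s. \<bar>step_fun (xs t) (s - h) - f t (s - h)\<bar> powr \<alpha> \<partial>lborel) powr (1 / \<alpha>)"
      by (simp add: step_fun_shift)
    also have "(\<integral>s. \<bar>step_fun (xs t) (s - h) - f t (s - h)\<bar> powr \<alpha> \<partial>lborel) = Lp_dist \<alpha> (step_fun (xs t)) (f t)"
      unfolding Lp_dist_def
      by (subst (2) lborel_integral_real_affine[where c = 1 and t = "- h"]) auto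
    also have "C1 * Lp_dist \<alpha> (step_fun (xs t)) (f t) powr (1 / \<alpha>) < e"
      using xs(2)[OF t] by (intro d_root) auto
    finally show ?thesis .
  qed
  moreover have "d \<le> e" by (simp add: d_def)
  ultimately show "\<exists>U V.
      (\<forall>t\<in>J. integrable M (U t) \<and> integrable M (V t) \<and>
        expectation (\<lambda>\<omega>. \<bar>U t \<omega> - X t \<omega>\<bar>) < e \<and> expectation (\<lambda>\<omega>. \<bar>V t \<omega> - Y t \<omega>\<bar>) < e) \<and>
      distr M (PiM J (\<lambda>_. borel)) (\<lambda>\<omega>. \<lambda>t\<in>J. U t \<omega>) = distr M (PiM J (\<lambda>_. borel)) (\<lambda>\<omega>. \<lambda>t\<in>J. V t \<omega>)"
    using xs(3) distr_step_integrals_shift[OF J xs(1), of "\<lambda>t. t" h]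
    by (intro exI[of _ "\<lambda>t. step_integral Z (xs t)"] exI[of _ "\<lambda>t. step_integral Z (shift_steps h (xs t))"] conjI ballI)
       (auto intro: less_le_trans)
qed (use X Y has_stable_integral_approx(1) in blast)+

end

section \<open>Averaging over a probability measure\<close>

text \<open>Jensen's inequality at each \<open>x\<close>, then Fubini's theorem. It is used twice:
  on \<open>M\<close> with exponent 1 for the noise, and on the line with exponent \<alpha> for the
  kernels.\<close>

lemma
  fixes K :: "'v \<Rightarrow> 'x \<Rightarrow> real"
  assumes W: "prob_space W" and S: "sigma_finite_measure S"
    and K [measurable]: "case_prod K \<in> borel_measurable (W \<Otimes>\<^sub>M S)" and p: "p \<ge> 1"
    and int: "\<And>v. v \<in> space W \<Longrightarrow> integrable S (\<lambda>x. \<bar>K v x\<bar> powr p)"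
    and int2: "integrable W (\<lambda>v. \<integral>x. \<bar>K v x\<bar> powr p \<partial>S)"
  shows AE_integrable_average: "AE x in S. integrable W (\<lambda>v. K v x)"
    and integrable_average_powr: "integrable S (\<lambda>x. \<bar>\<integral>v. K v x \<partial>W\<bar> powr p)"
    and integral_average_powr_le:
      "(\<integral>x. \<bar>\<integral>v. K v x \<partial>W\<bar> powr p \<partial>S) \<le> (\<integral>v. \<integral>x. \<bar>K v x\<bar> powr p \<partial>S \<partial>W)"
proof -
  interpret W: prob_space W by fact
  interpret S: sigma_finite_measure S by fact
  interpret P: pair_sigma_finite W S ..
  have "integrable (W \<Otimes>\<^sub>M S) (\<lambda>(v, x). \<bar>K v x\<bar> powr p)"
  proof (rule P.Fubini_integrable)
    show "integrable W (\<lambda>v. \<integral>x. norm (case (v, x) of (v, x) \<Rightarrow> \<bar>K v x\<bar> powr p) \<partial>S)"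
      using int2 by simp
    show "AE v in W. integrable S (\<lambda>x. case (v, x) of (v, x) \<Rightarrow> \<bar>K v x\<bar> powr p)"
      using int by (intro AE_I2) simp
  qed measurable
  note I = this
  have AE: "AE x in S. integrable W (\<lambda>v. \<bar>K v x\<bar> powr p)"
    using P.AE_integrable_snd[OF I] by simp
  have int_x: "integrable S (\<lambda>x. \<integral>v. \<bar>K v x\<bar> powr p \<partial>W)"
    using P.integrable_snd[OF I] by simp
  have meas: "(\<lambda>v. K v x) \<in> borel_measurable W" if "x \<in> space S" for x
    using that by measurable
  have meas2 [measurable]: "(\<lambda>x. \<integral>v. K v x \<partial>W) \<in> borel_measurable S"
    by (intro W.borel_measurable_lebesgue_integral) measurable
  have AE2: "AE x in S. integrable W (\<lambda>v. K v x) \<and> \<bar>\<integral>v. K v x \<partial>W\<bar> powr p \<le> (\<integral>v. \<bar>K v x\<bar> powr p \<partial>W)"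
    using AE AE_space
  proof eventually_elim
    case (elim x)
    then show ?case
      using W.integrable_of_powr[OF meas p] W.abs_expectation_powr_le[OF meas p] by simp
  qed
  then show "AE x in S. integrable W (\<lambda>v. K v x)" by auto
  show int3: "integrable S (\<lambda>x. \<bar>\<integral>v. K v x \<partial>W\<bar> powr p)"
    by (rule Bochner_Integration.integrable_bound[OF int_x]) (use AE2 in \<open>auto elim!: eventually_mono\<close>)
  have "(\<integral>x. \<bar>\<integral>v. K v x \<partial>W\<bar> powr p \<partial>S) \<le> (\<integral>x. \<integral>v. \<bar>K v x\<bar> powr p \<partial>W \<partial>S)"
    using AE2 by (intro integral_mono_AE int3 int_x) auto
  also have "\<dots> = (\<integral>v. \<integral>x. \<bar>K v x\<bar> powr p \<partial>S \<partial>W)"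
    using I by (intro P.Fubini_integral) simp
  finally show "(\<integral>x. \<bar>\<integral>v. K v x \<partial>W\<bar> powr p \<partial>S) \<le> (\<integral>v. \<integral>x. \<bar>K v x\<bar> powr p \<partial>S \<partial>W)" .
qed

text \<open>Averaging over a discretised variable is a finite linear combination, to which linearity
  of the stable integral applies.\<close>

lemma (in prob_space)
  fixes d F :: "_ \<Rightarrow> real"
  assumes [measurable]: "d \<in> borel_measurable M" and fin: "finite (range d)"
  shows integrable_finite_range: "integrable M (\<lambda>v. F (d v))"
    and expectation_finite_range:
      "expectation (\<lambda>v. F (d v)) = (\<Sum>y\<in>range d. prob {v \<in> space M. d v = y} * F y)"
proof -
  have eq: "F (d v) = (\<Sum>y\<in>range d. F y * indicator {v \<in> space M. d v = y} v)" if "v \<in> space M" for v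
  proof -
    have "(\<Sum>y\<in>range d. F y * indicator {v \<in> space M. d v = y} v) = (\<Sum>y\<in>range d. if y = d v then F y else 0)"
      using that by (intro sum.cong refl) (auto simp: indicator_def)
    then show ?thesis using fin by simp
  qed
  have ind: "integrable M (\<lambda>v. indicator {v \<in> space M. d v = y} v :: real)" for y
    by (intro integrable_real_indicator) (auto simp: less_top[symmetric])
  have "integrable M (\<lambda>v. \<Sum>y\<in>range d. F y * indicator {v \<in> space M. d v = y} v)"
    by (intro Bochner_Integration.integrable_sum integrable_mult_right ind)
  then show "integrable M (\<lambda>v. F (d v))"
    by (rule Bochner_Integration.integrable_cong[THEN iffD1, rotated 2]) (simp_all add: eq)
  have "expectation (\<lambda>v. F (d v)) = expectation (\<lambda>v. \<Sum>y\<in>range d. F y * indicator {v \<in> space M. d v = y} v)"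
    by (intro Bochner_Integration.integral_cong refl eq)
  also have "\<dots> = (\<Sum>y\<in>range d. prob {v \<in> space M. d v = y} * F y)"
    using ind by (subst Bochner_Integration.integral_sum) (auto simp: mult.commute)
  finally show "expectation (\<lambda>v. F (d v)) = (\<Sum>y\<in>range d. prob {v \<in> space M. d v = y} * F y)" .
qed

text \<open>Points outside \<open>[0, n)\<close> are sent to \<open>0\<close> to make the range finite.\<close>
definition grid :: "nat \<Rightarrow> real \<Rightarrow> real" where
  "grid n v = (if 0 \<le> v \<and> v < real n then of_int \<lfloor>real n * v\<rfloor> / real n else 0)"

lemma borel_measurable_grid [measurable]: "grid n \<in> borel_measurable borel"
  unfolding grid_def[abs_def] by measurable

lemma finite_range_grid: "finite (range (grid n))"
proof -
  have "grid n v \<in> insert 0 ((\<lambda>k. real_of_int k / real n) ` {0..int n * int n})" for v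
  proof (cases "0 \<le> v \<and> v < real n")
    case True
    then have "0 \<le> real n * v" "real n * v \<le> real n * real n" by (auto intro!: mult_left_mono)
    then have "0 \<le> \<lfloor>real n * v\<rfloor>" "\<lfloor>real n * v\<rfloor> \<le> int n * int n"
      by (auto simp: floor_le_iff)
    then show ?thesis using True by (auto simp: grid_def)
  next
    case False
    then have "grid n v = 0" by (auto simp: grid_def)
    then show ?thesis by simp
  qed
  then have "range (grid n) \<subseteq> insert 0 ((\<lambda>k. real_of_int k / real n) ` {0..int n * int n})" by blast
  then show ?thesis by (rule finite_subset) simp
qed

lemma grid_close:
  assumes "0 \<le> v" "v < real n"
  shows "\<bar>v - grid n v\<bar> \<le> 1 / real n" "0 \<le> grid n v" "grid n v \<le> v"
proof -
  have n: "real n > 0" using assms by linarith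
  have g: "grid n v = of_int \<lfloor>real n * v\<rfloor> / real n" using assms by (simp add: grid_def)
  have "of_int \<lfloor>real n * v\<rfloor> \<le> real n * v" "real n * v \<le> of_int \<lfloor>real n * v\<rfloor> + 1" "0 \<le> \<lfloor>real n * v\<rfloor>"
    using assms by (auto simp: algebra_simps) linarith
  then have "grid n v \<le> v" "v \<le> grid n v + 1 / real n" "0 \<le> grid n v"
    using n by (auto simp: g field_simps)
  then show "\<bar>v - grid n v\<bar> \<le> 1 / real n" "0 \<le> grid n v" "grid n v \<le> v" by auto
qed

text \<open>Supplies the dominating function for the discretisation error; outside
  \<open>[0, n)\<close> the grid value is 0 and equality holds.\<close>

lemma grid_diff_le: "\<bar>v - grid n v\<bar> \<le> \<bar>v\<bar>"
  using grid_close[of v n] by (cases "0 \<le> v \<and> v < real n") (auto simp: grid_def)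

lemma tendsto_grid:
  assumes "v \<ge> 0"
  shows "(\<lambda>n. grid n v) \<longlonglongrightarrow> v"
proof -
  have "(\<lambda>n. v - grid n v) \<longlonglongrightarrow> 0"
  proof (rule Lim_null_comparison)
    obtain K :: nat where K: "v < real K" using reals_Archimedean2 by blast
    then have "norm (v - grid n v) \<le> 1 / real n" if "n \<ge> K" for n
      using grid_close(1)[of v n] assms that by simp
    then show "\<forall>\<^sub>F n in sequentially. norm (v - grid n v) \<le> 1 / real n"
      by (auto simp: eventually_sequentially)
  qed (rule lim_1_over_n)
  then show ?thesis using tendsto_diff[OF tendsto_const[of v]] by fastforce
qed

section \<open>The exponential averaging measure\<close>

definition expW :: "real \<Rightarrow> real measure" where
  "expW l = density lborel (exponential_density l)"

lemma sets_expW [simp, measurable_cong]: "sets (expW l) = sets borel"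
  by (simp add: expW_def)

lemma space_expW [simp]: "space (expW l) = UNIV"
  by (simp add: expW_def)

lemma prob_space_expW: "l > 0 \<Longrightarrow> prob_space (expW l)"
  unfolding expW_def by (rule prob_space_exponential_density)

lemma AE_expW_nonneg: "l > 0 \<Longrightarrow> AE v in expW l. 0 \<le> v"
  unfolding expW_def by (subst AE_density) (auto simp: exponential_density_def)

lemma integrable_expW_iff:
  assumes "l > 0" and [measurable]: "g \<in> borel_measurable borel"
  shows "integrable (expW l) g \<longleftrightarrow> integrable lborel (\<lambda>v. exponential_density l v * g v)"
  unfolding expW_def
  by (subst integrable_density) (auto simp: exponential_density_nonneg assms(1))

lemma integral_expW:
  assumes "l > 0" and [measurable]: "g \<in> borel_measurable borel"
  shows "(\<integral>v. g v \<partial>expW l) = (\<integral>v. exponential_density l v * g v \<partial>lborel)"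
  unfolding expW_def
  by (subst integral_density) (auto simp: exponential_density_nonneg assms(1))

lemma integrable_expW_power: "l > 0 \<Longrightarrow> integrable (expW l) (\<lambda>v. v ^ n)"
proof -
  assume l: "l > 0"
  interpret prob_space "expW l" by (rule prob_space_expW) fact
  have "distributed (expW l) lborel (\<lambda>v. v) (exponential_density l)"
    unfolding distributed_def using l
    by (auto simp: expW_def exponential_density_nonneg intro!: distr_id2)
  from has_bochner_integral_erlang_ith_moment[OF l this, of n]
  show ?thesis by (auto simp: has_bochner_integral_iff)
qed

text \<open>Exponents up to 2 cover the two that occur, H and \<alpha> H, and are dominated by the
  second moment.\<close>

lemma integrable_expW_abs_powr:
  assumes "l > 0" "0 \<le> p" "p \<le> 2"
  shows "integrable (expW l) (\<lambda>v. \<bar>v\<bar> powr p)"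
proof (rule Bochner_Integration.integrable_bound)
  interpret prob_space "expW l" by (rule prob_space_expW) fact
  show "integrable (expW l) (\<lambda>v. 1 + v ^ 2)"
    using integrable_expW_power[OF assms(1), of 2] by simp
  show "AE v in expW l. norm (\<bar>v\<bar> powr p) \<le> norm (1 + v ^ 2)"
  proof (intro AE_I2)
    fix v :: real
    show "norm (\<bar>v\<bar> powr p) \<le> norm (1 + v ^ 2)"
    proof (cases "\<bar>v\<bar> \<le> 1")
      case True
      then have "\<bar>v\<bar> powr p \<le> 1 powr p" using assms by (intro powr_mono2) auto
      then show ?thesis by (simp add: add_increasing2)
    next
      case False
      then have "\<bar>v\<bar> powr p \<le> \<bar>v\<bar> powr 2" using assms by (intro powr_mono) auto
      also have "\<dots> = v ^ 2" using False by (simp add: powr_numeral)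
      finally show ?thesis by simp
    qed
  qed
qed measurable

lemma tendsto_expectation_grid:
  assumes "l > 0" "0 < p" "p \<le> 2"
  shows "(\<lambda>n. \<integral>v. \<bar>v - grid n v\<bar> powr p \<partial>expW l) \<longlonglongrightarrow> 0"
proof -
  have "(\<lambda>n. \<integral>v. \<bar>v - grid n v\<bar> powr p \<partial>expW l) \<longlonglongrightarrow> (\<integral>v. 0 \<partial>expW l)"
  proof (rule integral_dominated_convergence[where w = "\<lambda>v. \<bar>v\<bar> powr p"])
    show "integrable (expW l) (\<lambda>v. \<bar>v\<bar> powr p)"
      using assms by (intro integrable_expW_abs_powr) auto
    show "AE v in expW l. (\<lambda>n. \<bar>v - grid n v\<bar> powr p) \<longlonglongrightarrow> 0"
      using AE_expW_nonneg[OF assms(1)]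
    proof eventually_elim
      case (elim v)
      have "(\<lambda>n. \<bar>v - grid n v\<bar>) \<longlonglongrightarrow> \<bar>v - v\<bar>"
        by (intro tendsto_intros tendsto_grid elim)
      then have "(\<lambda>n. \<bar>v - grid n v\<bar> powr p) \<longlonglongrightarrow> 0 powr p"
        using assms by (intro tendsto_powr2 tendsto_const always_eventually) auto
      then show ?case by simp
    qed
    show "AE v in expW l. norm (\<bar>v - grid n v\<bar> powr p) \<le> \<bar>v\<bar> powr p" for n
      using assms grid_diff_le by (intro AE_I2) (auto intro!: powr_mono2)
  qed measurable
  then show ?thesis by simp
qed

section \<open>The kernel of linear fractional stable motion\<close>

lemma borel_measurable_lfsm_fun [measurable]: "lfsm_fun \<alpha> H \<in> borel_measurable borel"
  unfolding lfsm_fun_def[abs_def] by measurable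

lemma lfsm_fun_scale: "v > 0 \<Longrightarrow> lfsm_fun \<alpha> H (v * x) = v powr (H - 1 / \<alpha>) * lfsm_fun \<alpha> H x"
  by (auto simp: lfsm_fun_def zero_less_mult_iff powr_mult)

text \<open>Self-similarity in terms of the kernel: substitute s = w + v r with v = u - w.
  Homogeneity contributes the exponent \<alpha> (H - 1/\<alpha>) = \<alpha> H - 1, and the Jacobian
  the missing 1.\<close>

lemma lfsm_fun_increment_scaling:
  fixes u w \<alpha> H :: real
  assumes "\<alpha> > 0"
  shows "Lp_dist \<alpha> (\<lambda>s. lfsm_fun \<alpha> H (u - s)) (\<lambda>s. lfsm_fun \<alpha> H (w - s)) =
    \<bar>u - w\<bar> powr (\<alpha> * H) * Lp_dist \<alpha> (\<lambda>s. lfsm_fun \<alpha> H (1 - s)) (\<lambda>s. lfsm_fun \<alpha> H (- s))"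
proof -
  let ?f = "lfsm_fun \<alpha> H"
  have *: "Lp_dist \<alpha> (\<lambda>s. ?f (u - s)) (\<lambda>s. ?f (w - s)) =
      \<bar>u - w\<bar> powr (\<alpha> * H) * Lp_dist \<alpha> (\<lambda>s. ?f (1 - s)) (\<lambda>s. ?f (- s))" if "w < u" for u w
  proof -
    define v where "v = u - w"
    have v: "v > 0" using that by (simp add: v_def)
    have "Lp_dist \<alpha> (\<lambda>s. ?f (u - s)) (\<lambda>s. ?f (w - s)) =
        v * (\<integral>r. \<bar>?f (u - (w + v * r)) - ?f (w - (w + v * r))\<bar> powr \<alpha> \<partial>lborel)"
      unfolding Lp_dist_def using v
      by (subst lborel_integral_real_affine[where c = v and t = w]) auto
    also have "(\<lambda>r. \<bar>?f (u - (w + v * r)) - ?f (w - (w + v * r))\<bar> powr \<alpha>) =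
        (\<lambda>r. v powr (\<alpha> * H - 1) * \<bar>?f (1 - r) - ?f (- r)\<bar> powr \<alpha>)"
    proof
      fix r
      have e1: "u - (w + v * r) = v * (1 - r)" by (simp add: v_def algebra_simps)
      have e2: "w - (w + v * r) = v * (- r)" by simp
      have "\<bar>?f (u - (w + v * r)) - ?f (w - (w + v * r))\<bar> = v powr (H - 1 / \<alpha>) * \<bar>?f (1 - r) - ?f (- r)\<bar>"
        unfolding e1 e2 lfsm_fun_scale[OF v] by (simp add: abs_mult flip: right_diff_distrib)
      then show "\<bar>?f (u - (w + v * r)) - ?f (w - (w + v * r))\<bar> powr \<alpha> =
          v powr (\<alpha> * H - 1) * \<bar>?f (1 - r) - ?f (- r)\<bar> powr \<alpha>"
        using assms by (simp add: powr_mult powr_powr algebra_simps)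
    qed
    also have "v * (\<integral>r. v powr (\<alpha> * H - 1) * \<bar>?f (1 - r) - ?f (- r)\<bar> powr \<alpha> \<partial>lborel) =
        (v powr 1 * v powr (\<alpha> * H - 1)) * Lp_dist \<alpha> (\<lambda>s. ?f (1 - s)) (\<lambda>s. ?f (- s))"
      using v by (simp add: Lp_dist_def)
    also have "v powr 1 * v powr (\<alpha> * H - 1) = \<bar>u - w\<bar> powr (\<alpha> * H)"
      unfolding powr_add[symmetric] using that by (simp add: v_def)
    finally show ?thesis .
  qed
  consider "w < u" | "u < w" | "u = w" by linarith
  then show ?thesis
  proof cases
    case 2
    then show ?thesis using *[of u w] by (simp add: Lp_dist_commute[of _ "\<lambda>s. ?f (u - s)"] abs_minus_commute)
  qed (use * in \<open>auto simp: Lp_dist_def\<close>)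
qed

lemma integrable_powr_indicator:
  fixes b x :: real
  assumes "b > -1" "x \<ge> 0"
  shows "integrable lborel (\<lambda>u. indicator {0<..x} u * u powr b)"
proof -
  have "(\<lambda>u. u powr b) absolutely_integrable_on {0<..x}"
    using integrable_on_powr_from_0'[OF assms] by (subst absolutely_integrable_on_iff_nonneg) auto
  then have "integrable lebesgue (\<lambda>u. indicator {0<..x} u * u powr b)"
    by (simp add: set_integrable_def)
  then show ?thesis by (subst (asm) integrable_completion) auto
qed

lemma psi_eq_average:
  assumes l: "l > 0" and aH: "H - 1 / \<alpha> > - 1"
  shows "(\<integral>v. lfsm_fun \<alpha> H x - lfsm_fun \<alpha> H (x - v) \<partial>expW l) = indicator {0..} x * psi \<alpha> H l x"
proof -
  interpret W: prob_space "expW l" by (rule prob_space_expW) fact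
  let ?f = "lfsm_fun \<alpha> H" and ?b = "H - 1 / \<alpha>"
  show ?thesis
  proof (cases "x > 0")
    case False
    have "(\<integral>v. ?f x - ?f (x - v) \<partial>expW l) = (\<integral>v. 0 \<partial>expW l)"
    proof (rule integral_cong_AE)
      show "AE v in expW l. ?f x - ?f (x - v) = 0"
        using AE_expW_nonneg[OF l] by eventually_elim (use False in \<open>simp add: lfsm_fun_def\<close>)
    qed measurable
    \<comment> \<open>At the origin the convention \<open>0 powr x = 0\<close> matters: the
      indicator includes 0, where the averaged kernel vanishes.\<close>
    moreover have "psi \<alpha> H l 0 = 0" by (simp add: psi_def)
    ultimately show ?thesis using False by (cases "x = 0") auto
  next
    case True
    \<comment> \<open>The integrand after the substitution u = x - v: the density restricts to u <=
      x and contributes the exponentials, while \<open>lfsm_fun\<close> restricts to u > 0.\<close>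
    define g where "g u = c_H H * l * exp (- l * x) * (indicator {0<..x} u * (exp (l * u) * u powr ?b))" for u
    have g_int: "integrable lborel g"
      unfolding g_def
    proof (rule integrable_mult_right)
      show "integrable lborel (\<lambda>u. indicator {0<..x} u * (exp (l * u) * u powr ?b))"
      proof (rule Bochner_Integration.integrable_bound)
        show "integrable lborel (\<lambda>u. exp (l * x) * (indicator {0<..x} u * u powr ?b))"
          using integrable_powr_indicator[OF aH, of x] True by (intro integrable_mult_right) simp
        show "AE u in lborel. norm (indicator {0<..x} u * (exp (l * u) * u powr ?b)) \<le>
            norm (exp (l * x) * (indicator {0<..x} u * u powr ?b))"
          using l by (intro AE_I2) (auto simp: indicator_def intro!: mult_right_mono)
      qed measurable
    qed
    define h where "h v = exponential_density l v * ?f (x - v)" for v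
    have sub: "h (x + (-1) * u) = g u" for u
      unfolding h_def
      by (auto simp: exponential_density_def lfsm_fun_def g_def indicator_def algebra_simps exp_diff exp_minus divide_simps
          simp flip: exp_add)
    have "integrable lborel h"
      using g_int lborel_integrable_real_affine_iff[of "-1" h x] unfolding sub by simp
    then have intW: "integrable (expW l) (\<lambda>v. ?f (x - v))"
      by (subst integrable_expW_iff[OF l]) (auto simp: h_def[abs_def])
    have "(\<integral>v. ?f x - ?f (x - v) \<partial>expW l) = ?f x - (\<integral>v. ?f (x - v) \<partial>expW l)"
      using intW W.prob_space by (subst Bochner_Integration.integral_diff) auto
    also have "(\<integral>v. ?f (x - v) \<partial>expW l) = (\<integral>v. exponential_density l v * ?f (x - v) \<partial>lborel)"
      by (rule integral_expW[OF l]) measurable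
    also have "\<dots> = (\<integral>u. g u \<partial>lborel)"
      using lborel_integral_real_affine[of "-1" h x] unfolding sub by (simp add: h_def[abs_def])
    also have "\<dots> = c_H H * l * exp (- l * x) * (LBINT u=ereal 0..ereal x. exp (l * u) * u powr ?b)"
      using True unfolding g_def
      by (subst interval_integral_Ioc) (auto simp: set_lebesgue_integral_def)
    finally show ?thesis using True by (simp add: lfsm_fun_def psi_def algebra_simps)
  qed
qed

section \<open>The stationary solution as a moving average\<close>

locale lfsm_noise = centered_stable_levy M \<alpha> Z
  for M :: "'w measure" and \<alpha> :: real and Z :: "real \<Rightarrow> 'w \<Rightarrow> real" +
  fixes H l :: real and N :: "real \<Rightarrow> 'w \<Rightarrow> real"
  assumes alpha_le_2: "\<alpha> \<le> 2" and H_pos: "0 < H" and H_less_1: "H < 1" and l_pos: "0 < l"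
    and lfsm: "linear_fractional_stable_motion M \<alpha> H Z N"
begin

abbreviation "f \<equiv> lfsm_fun \<alpha> H"
abbreviation "W \<equiv> expW l"

sublocale W: prob_space W
  using l_pos by (rule prob_space_expW)

lemma exponent_gt: "H - 1 / \<alpha> > -1"
proof -
  have "1 / \<alpha> < 1" using alpha_gt_1 by simp
  then show ?thesis using H_pos by linarith
qed

lemma N_joint: "(\<lambda>(t, \<omega>). N t \<omega>) \<in> borel_measurable (borel \<Otimes>\<^sub>M M)"
  using lfsm by (simp add: linear_fractional_stable_motion_def)

text \<open>Joint measurability is what allows integrating paths of \<open>N\<close> over the
  averaging time and applying Fubini's theorem on the product with \<open>M\<close>.\<close>

lemma N_measurable_comp [measurable (raw)]:
  assumes "g \<in> borel_measurable P" "h \<in> P \<rightarrow>\<^sub>M M"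
  shows "(\<lambda>x. N (g x) (h x)) \<in> borel_measurable P"
  using measurable_compose[OF measurable_Pair[OF assms] N_joint] by simp

lemma N_kernel: "has_stable_integral M \<alpha> Z (\<lambda>s. f (t - s) - f (- s)) (N t)"
  using lfsm by (simp add: linear_fractional_stable_motion_def)

lemma N_increment: "has_stable_integral M \<alpha> Z (\<lambda>s. f (t - s) - f (u - s)) (\<lambda>\<omega>. N t \<omega> - N u \<omega>)"
  using has_stable_integral_diff[OF N_kernel[of t] N_kernel[of u]] by simp

lemma N_0: "AE \<omega> in M. N 0 \<omega> = 0"
  using has_stable_integral_unique[OF N_kernel[of 0]] has_stable_integral_zero by simp

lemma N_integrable: "integrable M (N t)"
  by (rule has_stable_integral_approx(1)[OF N_kernel])

text \<open>The \<alpha>-th power of the norm of the kernel of \<open>N 1\<close>; by scaling it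
  determines the norms of all increments.\<close>

definition D1 :: real where "D1 = Lp_dist \<alpha> (\<lambda>s. f (1 - s)) (\<lambda>s. f (- s))"

definition C2 :: real where "C2 = C1 * D1 powr (1 / \<alpha>)"

lemma integral_kernel_increment:
  "(\<integral>s. \<bar>f (t - s) - f (u - s)\<bar> powr \<alpha> \<partial>lborel) = \<bar>t - u\<bar> powr (\<alpha> * H) * D1"
  using lfsm_fun_increment_scaling[OF alpha_pos, of H t u] by (simp add: D1_def Lp_dist_def)

lemma integrable_kernel_increment:
  "integrable lborel (\<lambda>s. \<bar>f (t - s) - f (u - s)\<bar> powr \<alpha>)"
  using has_stable_integral_in_Lp[OF N_increment] by (simp add: in_Lp_def)

lemma expectation_N_increment:
  "expectation (\<lambda>\<omega>. \<bar>N t \<omega> - N u \<omega>\<bar>) \<le> C2 * \<bar>t - u\<bar> powr H"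
proof -
  have "(\<bar>t - u\<bar> powr (\<alpha> * H) * D1) powr (1 / \<alpha>) = \<bar>t - u\<bar> powr H * D1 powr (1 / \<alpha>)"
    using alpha_pos by (simp add: powr_mult powr_powr D1_def)
  then show ?thesis
    using expectation_abs_stable_integral[OF N_increment[of t u]]
    unfolding integral_kernel_increment by (simp add: C2_def mult_ac)
qed

text \<open>With \<open>d = (\<lambda>_. 0)\<close> this makes the average defining \<open>Y\<close>
  exist; with \<open>d = grid n\<close> it measures the discretisation error of the noise. The next
  lemma does the same for the kernels.\<close>

lemma
  assumes [measurable]: "d \<in> borel_measurable borel" and int: "integrable W (\<lambda>v. \<bar>v - d v\<bar> powr H)"
  shows AE_integrable_average_N: "AE \<omega> in M. integrable W (\<lambda>v. N (t - d v) \<omega> - N (t - v) \<omega>)"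
    and integrable_average_N: "integrable M (\<lambda>\<omega>. \<bar>\<integral>v. N (t - d v) \<omega> - N (t - v) \<omega> \<partial>W\<bar>)"
    and expectation_average_N: "expectation (\<lambda>\<omega>. \<bar>\<integral>v. N (t - d v) \<omega> - N (t - v) \<omega> \<partial>W\<bar>) \<le>
      C2 * (\<integral>v. \<bar>v - d v\<bar> powr H \<partial>W)"
proof -
  let ?K = "\<lambda>v \<omega>. N (t - d v) \<omega> - N (t - v) \<omega>"
  have K: "case_prod ?K \<in> borel_measurable (W \<Otimes>\<^sub>M M)" by measurable
  have K_int: "integrable M (\<lambda>\<omega>. \<bar>?K v \<omega>\<bar> powr 1)" for v
    using N_integrable by simp
  have bound: "(\<integral>\<omega>. \<bar>?K v \<omega>\<bar> powr 1 \<partial>M) \<le> C2 * \<bar>v - d v\<bar> powr H" for v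
    using expectation_N_increment[of "t - d v" "t - v"] by (simp add: abs_minus_commute)
  have K_int2: "integrable W (\<lambda>v. \<integral>\<omega>. \<bar>?K v \<omega>\<bar> powr 1 \<partial>M)"
  proof (rule Bochner_Integration.integrable_bound)
    show "integrable W (\<lambda>v. C2 * \<bar>v - d v\<bar> powr H)" using int by simp
    show "(\<lambda>v. \<integral>\<omega>. \<bar>?K v \<omega>\<bar> powr 1 \<partial>M) \<in> borel_measurable W"
      by (intro borel_measurable_lebesgue_integral) measurable
    show "AE v in W. norm (\<integral>\<omega>. \<bar>?K v \<omega>\<bar> powr 1 \<partial>M) \<le> norm (C2 * \<bar>v - d v\<bar> powr H)"
    proof (rule AE_I2)
      fix v
      have "(\<integral>\<omega>. \<bar>?K v \<omega>\<bar> powr 1 \<partial>M) \<ge> 0" by (intro Bochner_Integration.integral_nonneg) (rule powr_ge_zero)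
      then show "norm (\<integral>\<omega>. \<bar>?K v \<omega>\<bar> powr 1 \<partial>M) \<le> norm (C2 * \<bar>v - d v\<bar> powr H)"
        using bound[of v] by (simp only: real_norm_def)
    qed
  qed
  note avg = W.prob_space_axioms sigma_finite_measure_axioms K order_refl[of 1] K_int K_int2
  show "AE \<omega> in M. integrable W (\<lambda>v. ?K v \<omega>)"
    by (rule AE_integrable_average[OF avg])
  show "integrable M (\<lambda>\<omega>. \<bar>\<integral>v. ?K v \<omega> \<partial>W\<bar>)"
    using integrable_average_powr[OF avg] by simp
  have "expectation (\<lambda>\<omega>. \<bar>\<integral>v. ?K v \<omega> \<partial>W\<bar>) \<le> (\<integral>v. \<integral>\<omega>. \<bar>?K v \<omega>\<bar> powr 1 \<partial>M \<partial>W)"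
    using integral_average_powr_le[OF avg] by simp
  also have "\<dots> \<le> (\<integral>v. C2 * \<bar>v - d v\<bar> powr H \<partial>W)"
    using int bound by (intro integral_mono K_int2) auto
  finally show "expectation (\<lambda>\<omega>. \<bar>\<integral>v. ?K v \<omega> \<partial>W\<bar>) \<le> C2 * (\<integral>v. \<bar>v - d v\<bar> powr H \<partial>W)"
    by simp
qed

lemma
  assumes [measurable]: "d \<in> borel_measurable borel" and int: "integrable W (\<lambda>v. \<bar>v - d v\<bar> powr (\<alpha> * H))"
  shows AE_integrable_average_f: "AE s in lborel. integrable W (\<lambda>v. f (t - d v - s) - f (t - v - s))"
    and integrable_average_f: "integrable lborel (\<lambda>s. \<bar>\<integral>v. f (t - d v - s) - f (t - v - s) \<partial>W\<bar> powr \<alpha>)"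
    and integral_average_f_le: "(\<integral>s. \<bar>\<integral>v. f (t - d v - s) - f (t - v - s) \<partial>W\<bar> powr \<alpha> \<partial>lborel) \<le>
      D1 * (\<integral>v. \<bar>v - d v\<bar> powr (\<alpha> * H) \<partial>W)"
proof -
  let ?K = "\<lambda>v s. f (t - d v - s) - f (t - v - s)"
  have K: "case_prod ?K \<in> borel_measurable (W \<Otimes>\<^sub>M lborel)" by measurable
  have K_int: "integrable lborel (\<lambda>s. \<bar>?K v s\<bar> powr \<alpha>)" for v
    by (rule integrable_kernel_increment)
  have eq: "(\<integral>s. \<bar>?K v s\<bar> powr \<alpha> \<partial>lborel) = D1 * \<bar>v - d v\<bar> powr (\<alpha> * H)" for v
    unfolding integral_kernel_increment by (simp add: abs_minus_commute)
  have K_int2: "integrable W (\<lambda>v. \<integral>s. \<bar>?K v s\<bar> powr \<alpha> \<partial>lborel)"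
    unfolding eq using int by simp
  have "\<alpha> \<ge> 1" using alpha_gt_1 by simp
  note avg = W.prob_space_axioms lborel.sigma_finite_measure_axioms K this K_int K_int2
  show "AE s in lborel. integrable W (\<lambda>v. ?K v s)"
    by (rule AE_integrable_average[OF avg])
  show "integrable lborel (\<lambda>s. \<bar>\<integral>v. ?K v s \<partial>W\<bar> powr \<alpha>)"
    by (rule integrable_average_powr[OF avg])
  show "(\<integral>s. \<bar>\<integral>v. ?K v s \<partial>W\<bar> powr \<alpha> \<partial>lborel) \<le> D1 * (\<integral>v. \<bar>v - d v\<bar> powr (\<alpha> * H) \<partial>W)"
    using integral_average_powr_le[OF avg] unfolding eq by simp
qed

text \<open>Where the path is not integrable against the exponential law, the inner integral is 0 by
  default, so \<open>Y t\<close> is a measurable function on all of \<open>M\<close>; by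
  \<open>AE_integrable_N\<close> this concerns a null set only.\<close>

definition Y :: "real \<Rightarrow> 'w \<Rightarrow> real" where
  "Y t \<omega> = N t \<omega> - (\<integral>v. N (t - v) \<omega> \<partial>W)"

lemma Y_measurable [measurable]: "Y t \<in> borel_measurable M"
  unfolding Y_def[abs_def] by measurable

text \<open>The literal \<open>v - 0\<close> matches the averaging lemmas at
  \<open>d = (\<lambda>_. 0)\<close>. The exponent \<alpha> H is at most 2 because \<alpha> <= 2 and
  H < 1.\<close>

lemma H_moment: "integrable W (\<lambda>v. \<bar>v - 0\<bar> powr H)" "integrable W (\<lambda>v. \<bar>v - grid n v\<bar> powr H)"
  and \<alpha>H_moment: "integrable W (\<lambda>v. \<bar>v - 0\<bar> powr (\<alpha> * H))" "integrable W (\<lambda>v. \<bar>v - grid n v\<bar> powr (\<alpha> * H))"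
proof -
  have aH: "0 \<le> \<alpha> * H" "\<alpha> * H \<le> 2"
    using alpha_pos H_pos mult_mono[OF alpha_le_2, of H 1] H_less_1 by auto
  have *: "integrable W (\<lambda>v. \<bar>v\<bar> powr p)" "integrable W (\<lambda>v. \<bar>v - grid n v\<bar> powr p)" if "0 \<le> p" "p \<le> 2" for p
  proof -
    show 1: "integrable W (\<lambda>v. \<bar>v\<bar> powr p)" using that l_pos by (intro integrable_expW_abs_powr)
    show "integrable W (\<lambda>v. \<bar>v - grid n v\<bar> powr p)"
    proof (rule Bochner_Integration.integrable_bound[OF 1])
      show "AE v in W. norm (\<bar>v - grid n v\<bar> powr p) \<le> norm (\<bar>v\<bar> powr p)"
        using that grid_diff_le by (intro AE_I2) (auto intro!: powr_mono2)
    qed measurable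
  qed
  show "integrable W (\<lambda>v. \<bar>v - 0\<bar> powr H)" "integrable W (\<lambda>v. \<bar>v - grid n v\<bar> powr H)"
    using *[of H] H_pos H_less_1 by auto
  show "integrable W (\<lambda>v. \<bar>v - 0\<bar> powr (\<alpha> * H))" "integrable W (\<lambda>v. \<bar>v - grid n v\<bar> powr (\<alpha> * H))"
    using *[OF aH] by auto
qed

lemma Y_eq_average:
  "AE \<omega> in M. integrable W (\<lambda>v. N t \<omega> - N (t - v) \<omega>) \<and> Y t \<omega> = (\<integral>v. N t \<omega> - N (t - v) \<omega> \<partial>W)"
  using AE_integrable_average_N[OF _ H_moment(1), of t, OF borel_measurable_const]
proof eventually_elim
  case (elim \<omega>)
  then have int: "integrable W (\<lambda>v. N t \<omega> - N (t - v) \<omega>)" by simp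
  have "integrable W (\<lambda>v. N (t - v) \<omega>)"
    using Bochner_Integration.integrable_diff[OF W.integrable_const[of "N t \<omega>"] int] by simp
  then show ?case
    using int W.prob_space by (simp add: Y_def)
qed

lemma Y_integrable: "integrable M (Y t)"
proof (rule Bochner_Integration.integrable_bound)
  show "integrable M (\<lambda>\<omega>. \<bar>\<integral>v. N (t - 0) \<omega> - N (t - v) \<omega> \<partial>W\<bar>)"
    by (rule integrable_average_N[OF _ H_moment(1)]) simp
  show "AE \<omega> in M. norm (Y t \<omega>) \<le> norm \<bar>\<integral>v. N (t - 0) \<omega> - N (t - v) \<omega> \<partial>W\<bar>"
    using Y_eq_average[of t] by eventually_elim simp
qed simp

text \<open>A stochastic Fubini theorem. On the grid it is linearity; the kernel error is at most
  \<open>D1\<close> times the mean of |v - grid n v|^(\<alpha> H), the noise error at most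
  \<open>C2\<close> times the mean of |v - grid n v|^H, and the relation is closed.\<close>

lemma has_stable_integral_Y_average:
  "has_stable_integral M \<alpha> Z (\<lambda>s. \<integral>v. f (t - s) - f (t - v - s) \<partial>W) (Y t)"
proof (rule has_stable_integral_closed[OF _ Y_integrable])
  let ?g = "\<lambda>s. \<integral>v. f (t - s) - f (t - v - s) \<partial>W"
  show "in_Lp \<alpha> ?g"
    using integrable_average_f[of "\<lambda>_. 0" t] \<alpha>H_moment(1) unfolding in_Lp_def by auto
  fix e :: real assume "e > 0"
  have aH: "0 < \<alpha> * H" "\<alpha> * H \<le> 2"
    using alpha_pos H_pos mult_mono[OF alpha_le_2, of H 1] H_less_1 by auto
  have "(\<lambda>n. D1 * (\<integral>v. \<bar>v - grid n v\<bar> powr (\<alpha> * H) \<partial>W)) \<longlonglongrightarrow> D1 * 0"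
    by (intro tendsto_mult tendsto_const tendsto_expectation_grid l_pos aH)
  then have "\<forall>\<^sub>F n in sequentially. D1 * (\<integral>v. \<bar>v - grid n v\<bar> powr (\<alpha> * H) \<partial>W) < e"
    by (rule order_tendstoD) (use \<open>e > 0\<close> in simp)
  moreover have "(\<lambda>n. C2 * (\<integral>v. \<bar>v - grid n v\<bar> powr H \<partial>W)) \<longlonglongrightarrow> C2 * 0"
    using H_pos H_less_1 by (intro tendsto_mult tendsto_const tendsto_expectation_grid l_pos) auto
  then have "\<forall>\<^sub>F n in sequentially. C2 * (\<integral>v. \<bar>v - grid n v\<bar> powr H \<partial>W) < e"
    by (rule order_tendstoD) (use \<open>e > 0\<close> in simp)
  ultimately have "\<forall>\<^sub>F n in sequentially. D1 * (\<integral>v. \<bar>v - grid n v\<bar> powr (\<alpha> * H) \<partial>W) < e \<and>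
      C2 * (\<integral>v. \<bar>v - grid n v\<bar> powr H \<partial>W) < e"
    by (rule eventually_conj)
  then obtain n where n: "D1 * (\<integral>v. \<bar>v - grid n v\<bar> powr (\<alpha> * H) \<partial>W) < e"
      "C2 * (\<integral>v. \<bar>v - grid n v\<bar> powr H \<partial>W) < e"
    by (auto simp: eventually_sequentially)
  have grid_meas: "grid n \<in> borel_measurable W" by measurable
  note fin = W.integrable_finite_range[OF grid_meas finite_range_grid]
    W.expectation_finite_range[OF grid_meas finite_range_grid]
  \<comment> \<open>As \<open>grid n\<close> has finitely many values, \<open>gn\<close> and
    \<open>Xn\<close> are finite combinations of kernels and of increments of \<open>N\<close> with
    the same weights.\<close>
  define gn where "gn s = (\<integral>v. f (t - s) - f (t - grid n v - s) \<partial>W)" for s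
  define Xn where "Xn \<omega> = (\<integral>v. N t \<omega> - N (t - grid n v) \<omega> \<partial>W)" for \<omega>
  have "has_stable_integral M \<alpha> Z
      (\<lambda>s. \<Sum>y\<in>range (grid n). W.prob {v \<in> space W. grid n v = y} * (f (t - s) - f (t - y - s)))
      (\<lambda>\<omega>. \<Sum>y\<in>range (grid n). W.prob {v \<in> space W. grid n v = y} * (N t \<omega> - N (t - y) \<omega>))"
    by (intro has_stable_integral_sum has_stable_integral_cmult N_increment finite_range_grid)
  moreover have "gn = (\<lambda>s. \<Sum>y\<in>range (grid n). W.prob {v \<in> space W. grid n v = y} * (f (t - s) - f (t - y - s)))"
    unfolding gn_def by (intro ext fin(2)[of "\<lambda>y. f (t - _) - f (t - y - _)"])
  moreover have "Xn = (\<lambda>\<omega>. \<Sum>y\<in>range (grid n). W.prob {v \<in> space W. grid n v = y} * (N t \<omega> - N (t - y) \<omega>))"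
    unfolding Xn_def by (intro ext fin(2)[of "\<lambda>y. N t _ - N (t - y) _"])
  ultimately have hsi: "has_stable_integral M \<alpha> Z gn Xn" by simp
  have gn_meas: "gn \<in> borel_measurable borel"
    using has_stable_integral_in_Lp[OF hsi] by (simp add: in_Lp_def)
  have Xn_int: "integrable M Xn" by (rule has_stable_integral_approx(1)[OF hsi])
  \<comment> \<open>The term at time \<open>t\<close> cancels, leaving kernel increments between
    \<open>t - grid n v\<close> and \<open>t - v\<close>, which are short.\<close>
  have "Lp_dist \<alpha> gn ?g = (\<integral>s. \<bar>\<integral>v. f (t - grid n v - s) - f (t - v - s) \<partial>W\<bar> powr \<alpha> \<partial>lborel)"
    unfolding Lp_dist_def
  proof (rule integral_cong_AE)
    have "AE s in lborel. integrable W (\<lambda>v. f (t - grid n v - s) - f (t - v - s))"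
      by (rule AE_integrable_average_f) (auto simp: \<alpha>H_moment)
    then show "AE s in lborel. \<bar>gn s - ?g s\<bar> powr \<alpha> =
        \<bar>\<integral>v. f (t - grid n v - s) - f (t - v - s) \<partial>W\<bar> powr \<alpha>"
    proof eventually_elim
      case (elim s)
      have i1: "integrable W (\<lambda>v. f (t - s) - f (t - grid n v - s))"
        by (rule fin(1)[of "\<lambda>y. f (t - s) - f (t - y - s)"])
      from Bochner_Integration.integrable_add[OF i1 elim]
      have i2: "integrable W (\<lambda>v. f (t - s) - f (t - v - s))" by simp
      have "?g s - gn s = (\<integral>v. f (t - grid n v - s) - f (t - v - s) \<partial>W)"
        unfolding gn_def by (subst Bochner_Integration.integral_diff[OF i2 i1, symmetric]) simp
      then show ?case by (simp only: abs_minus_commute[of "gn s"])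
    qed
  qed (use gn_meas in measurable)
  also have "\<dots> \<le> D1 * (\<integral>v. \<bar>v - grid n v\<bar> powr (\<alpha> * H) \<partial>W)"
    by (rule integral_average_f_le) (auto simp: \<alpha>H_moment)
  also note n(1)
  finally have 1: "Lp_dist \<alpha> gn ?g < e" .
  have "expectation (\<lambda>\<omega>. \<bar>Xn \<omega> - Y t \<omega>\<bar>) = expectation (\<lambda>\<omega>. \<bar>\<integral>v. N (t - grid n v) \<omega> - N (t - v) \<omega> \<partial>W\<bar>)"
  proof (rule integral_cong_AE)
    have "AE \<omega> in M. integrable W (\<lambda>v. N (t - grid n v) \<omega> - N (t - v) \<omega>)"
      by (rule AE_integrable_average_N) (auto simp: H_moment)
    then show "AE \<omega> in M. \<bar>Xn \<omega> - Y t \<omega>\<bar> = \<bar>\<integral>v. N (t - grid n v) \<omega> - N (t - v) \<omega> \<partial>W\<bar>"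
      using Y_eq_average[of t]
    proof eventually_elim
      case (elim \<omega>)
      have i1: "integrable W (\<lambda>v. N t \<omega> - N (t - grid n v) \<omega>)"
        by (rule fin(1)[of "\<lambda>y. N t \<omega> - N (t - y) \<omega>"])
      have i2: "integrable W (\<lambda>v. N t \<omega> - N (t - v) \<omega>)" using elim by simp
      have "Y t \<omega> - Xn \<omega> = (\<integral>v. N (t - grid n v) \<omega> - N (t - v) \<omega> \<partial>W)"
        unfolding Xn_def conjunct2[OF elim(2)]
        by (subst Bochner_Integration.integral_diff[OF i2 i1, symmetric]) simp
      then show ?case by (simp only: abs_minus_commute[of "Xn \<omega>"])
    qed
  qed (use Xn_int in measurable)
  also have "\<dots> \<le> C2 * (\<integral>v. \<bar>v - grid n v\<bar> powr H \<partial>W)"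
    by (rule expectation_average_N) (auto simp: H_moment)
  also note n(2)
  finally have 2: "expectation (\<lambda>\<omega>. \<bar>Xn \<omega> - Y t \<omega>\<bar>) < e" .
  show "\<exists>g X. has_stable_integral M \<alpha> Z g X \<and> Lp_dist \<alpha> g ?g < e \<and> expectation (\<lambda>\<omega>. \<bar>X \<omega> - Y t \<omega>\<bar>) < e"
    using hsi 1 2 by blast
qed

lemma has_stable_integral_Y:
  "has_stable_integral M \<alpha> Z (\<lambda>s. indicator {..t} s * psi \<alpha> H l (t - s)) (Y t)"
proof -
  have "(\<integral>v. f (t - s) - f (t - v - s) \<partial>W) = indicator {..t} s * psi \<alpha> H l (t - s)" for s
  proof -
    have "(\<integral>v. f (t - s) - f (t - v - s) \<partial>W) = (\<integral>v. f (t - s) - f (t - s - v) \<partial>W)"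
      by (simp add: algebra_simps)
    also have "\<dots> = indicator {0..} (t - s) * psi \<alpha> H l (t - s)"
      by (rule psi_eq_average[OF l_pos exponent_gt])
    also have "\<dots> = indicator {..t} s * psi \<alpha> H l (t - s)" by (auto simp: indicator_def)
    finally show ?thesis .
  qed
  then show ?thesis using has_stable_integral_Y_average[of t] by simp
qed

text \<open>The kernel at time \<open>t + h\<close> is the kernel at time \<open>t\<close>
  translated by \<open>h\<close>, for all \<open>t\<close> simultaneously.\<close>

lemma stationary_Y: "stationary M Y"
  unfolding stationary_def same_law_def fdd_def
proof (intro allI impI)
  fix h :: real and J :: "real set" assume J: "finite J"
  have "distr M (PiM J (\<lambda>_. borel)) (\<lambda>\<omega>. \<lambda>t\<in>J. Y t \<omega>) =
      distr M (PiM J (\<lambda>_. borel)) (\<lambda>\<omega>. \<lambda>t\<in>J. Y (t + h) \<omega>)"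
  proof (rule distr_stable_integrals_shift[OF J])
    show "has_stable_integral M \<alpha> Z (\<lambda>s. indicator {..t} s * psi \<alpha> H l (t - s)) (Y t)" for t
      by (rule has_stable_integral_Y)
    show "has_stable_integral M \<alpha> Z (\<lambda>s. indicator {..t} (s - h) * psi \<alpha> H l (t - (s - h))) (Y (t + h))" for t
    proof -
      have "(\<lambda>s. indicator {..t} (s - h) * psi \<alpha> H l (t - (s - h))) =
          (\<lambda>s. indicator {..t + h} s * psi \<alpha> H l (t + h - s))"
        by (auto simp: indicator_def algebra_simps)
      then show ?thesis using has_stable_integral_Y[of "t + h"] by simp
    qed
  qed
  then show "distr M (PiM J (\<lambda>_. borel)) (\<lambda>\<omega>. \<lambda>t\<in>J. Y (t + h) \<omega>) = distr M (PiM J (\<lambda>_. borel)) (\<lambda>\<omega>. \<lambda>t\<in>J. Y t \<omega>)"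
    by simp
qed

end

section \<open>The pathwise equation\<close>

text \<open>Reflecting the variable moves the dependence on \<open>t\<close> from the path into the
  density. Different times can then be compared through their densities, and Fubini's theorem can be
  applied in \<open>t\<close>.\<close>

lemma
  fixes n :: "real \<Rightarrow> real"
  assumes l: "l > 0" and n [measurable]: "n \<in> borel_measurable borel"
  shows integrable_expW_reflect:
      "integrable (expW l) (\<lambda>v. n (t - v)) \<longleftrightarrow> integrable lborel (\<lambda>u. exponential_density l (t - u) * n u)"
    and integral_expW_reflect:
      "(\<integral>v. n (t - v) \<partial>expW l) = (\<integral>u. exponential_density l (t - u) * n u \<partial>lborel)"
proof -
  define h where "h v = exponential_density l v * n (t - v)" for v
  have sub: "h (t + (-1) * u) = exponential_density l (t - u) * n u" for u
    by (simp add: h_def)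
  show "integrable (expW l) (\<lambda>v. n (t - v)) \<longleftrightarrow> integrable lborel (\<lambda>u. exponential_density l (t - u) * n u)"
    using lborel_integrable_real_affine_iff[of "-1" h t] unfolding sub
    by (subst integrable_expW_iff[OF l]) (auto simp: h_def[abs_def])
  have "(\<integral>v. n (t - v) \<partial>expW l) = (\<integral>v. h v \<partial>lborel)"
    unfolding h_def by (rule integral_expW[OF l]) measurable
  also have "\<dots> = (\<integral>u. exponential_density l (t - u) * n u \<partial>lborel)"
    using lborel_integral_real_affine[of "-1" h t] unfolding sub by simp
  finally show "(\<integral>v. n (t - v) \<partial>expW l) = (\<integral>u. exponential_density l (t - u) * n u \<partial>lborel)" .
qed

text \<open>Moving back from \<open>T\<close> to \<open>t\<close> increases the reflected density by
  at most the factor exp (l (T - t)).\<close>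

lemma integrable_expW_earlier:
  fixes n :: "real \<Rightarrow> real"
  assumes l: "l > 0" and n [measurable]: "n \<in> borel_measurable borel"
    and int: "integrable (expW l) (\<lambda>v. n (T - v))" and "t \<le> T"
  shows "integrable (expW l) (\<lambda>v. n (t - v))"
proof -
  have "integrable lborel (\<lambda>u. exponential_density l (t - u) * n u)"
  proof (rule Bochner_Integration.integrable_bound)
    show "integrable lborel (\<lambda>u. exp (l * (T - t)) * (exponential_density l (T - u) * n u))"
      using int by (simp add: integrable_expW_reflect[OF l n])
    show "AE u in lborel. norm (exponential_density l (t - u) * n u) \<le>
        norm (exp (l * (T - t)) * (exponential_density l (T - u) * n u))"
    proof (rule AE_I2)
      fix u
      have "exponential_density l (t - u) \<le> exp (l * (T - t)) * exponential_density l (T - u)"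
        using l \<open>t \<le> T\<close> by (auto simp: exponential_density_def algebra_simps simp flip: exp_add)
      then have "exponential_density l (t - u) * \<bar>n u\<bar> \<le> exp (l * (T - t)) * exponential_density l (T - u) * \<bar>n u\<bar>"
        by (rule mult_right_mono) simp
      then show "norm (exponential_density l (t - u) * n u) \<le>
          norm (exp (l * (T - t)) * (exponential_density l (T - u) * n u))"
        using l by (simp add: abs_mult exponential_density_nonneg mult.assoc)
    qed
  qed measurable
  then show ?thesis by (simp add: integrable_expW_reflect[OF l n])
qed

text \<open>As a function of s, the density equals -1/l times its own derivative away from s = u.
  The difference quotient in the value is the boundary term, and the indicator accounts for the jump
  at s = u when it falls in \<open>{a<..b}\<close>.\<close>

lemma has_bochner_integral_exponential_density:
  fixes u :: real
  assumes l: "l > 0" and "a \<le> b"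
  shows "has_bochner_integral lborel (\<lambda>s. indicator {a..b} s * exponential_density l (s - u))
    (indicator {a<..b} u + (exponential_density l (a - u) - exponential_density l (b - u)) / l)"
proof (cases "u \<le> b")
  case True
  let ?c = "max a u"
  have "has_bochner_integral lborel (\<lambda>s. l * exp (- l * (s - u)) * indicator {?c..b} s)
      (- exp (- l * (b - u)) - (- exp (- l * (?c - u))))"
    using \<open>a \<le> b\<close> True
    by (intro has_bochner_integral_FTC_Icc_real) (auto intro!: derivative_eq_intros continuous_intros)
  moreover have "(\<lambda>s. l * exp (- l * (s - u)) * indicator {?c..b} s) =
      (\<lambda>s. indicator {a..b} s * exponential_density l (s - u))"
    by (auto simp: exponential_density_def indicator_def algebra_simps)
  moreover have "- exp (- l * (b - u)) - (- exp (- l * (?c - u))) =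
      indicator {a<..b} u + (exponential_density l (a - u) - exponential_density l (b - u)) / l"
    using l True by (auto simp: exponential_density_def indicator_def max_def algebra_simps diff_divide_distrib)
  ultimately show ?thesis by simp
next
  case False
  then have "(\<lambda>s. indicator {a..b} s * exponential_density l (s - u)) = (\<lambda>s. 0)"
    by (auto simp: exponential_density_def indicator_def)
  then show ?thesis using False \<open>a \<le> b\<close> by (auto simp: exponential_density_def)
qed

text \<open>The integrated form of av' = l (n - av), valid for merely measurable \<open>n\<close>:
  integrating the reflected average over time and exchanging integrals leaves the kernel
  \<open>q\<close>.\<close>

lemma
  fixes n :: "real \<Rightarrow> real"
  assumes l: "l > 0" and n [measurable]: "n \<in> borel_measurable borel"
    and int: "\<And>t. integrable (expW l) (\<lambda>v. n (t - v))" and "a \<le> b"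
  defines "av \<equiv> \<lambda>t. \<integral>v. n (t - v) \<partial>expW l"
  shows set_integrable_minus_exp_average: "set_integrable lborel {a..b} (\<lambda>s. n s - av s)"
    and exp_average_increment: "av b - av a = l * (LBINT s:{a..b}. n s - av s)"
proof -
  let ?k = "\<lambda>t u. exponential_density l (t - u)"
  let ?F = "\<lambda>u s. indicator {a..b} s * ?k s u * n u"
  define q where "q u = indicator {a<..b} u + (?k a u - ?k b u) / l" for u
  note ker = has_bochner_integral_exponential_density[OF l \<open>a \<le> b\<close>, folded q_def]
  have kn: "integrable lborel (\<lambda>u. ?k t u * n u)" "(\<integral>u. ?k t u * n u \<partial>lborel) = av t" for t
    using int[of t] by (simp_all add: av_def integrable_expW_reflect[OF l n] integral_expW_reflect[OF l n])
  \<comment> \<open>On \<open>{a<..b}\<close> the density seen from \<open>b\<close> is at least l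
    exp (- l (b - a)), so weighted integrability implies local integrability.\<close>
  have n_int: "integrable lborel (\<lambda>u. indicator {a<..b} u * n u)"
  proof (rule Bochner_Integration.integrable_bound)
    show "integrable lborel (\<lambda>u. exp (l * (b - a)) / l * (?k b u * n u))"
      using kn(1)[of b] by (rule integrable_mult_right)
    show "AE u in lborel. norm (indicator {a<..b} u * n u) \<le> norm (exp (l * (b - a)) / l * (?k b u * n u))"
    proof (rule AE_I2)
      fix u
      have "indicator {a<..b} u \<le> exp (l * (b - a)) / l * ?k b u"
        using l by (auto simp: indicator_def exponential_density_def algebra_simps simp flip: exp_add)
      then have "indicator {a<..b} u * \<bar>n u\<bar> \<le> exp (l * (b - a)) / l * ?k b u * \<bar>n u\<bar>"
        by (rule mult_right_mono) simp
      then show "norm (indicator {a<..b} u * n u) \<le> norm (exp (l * (b - a)) / l * (?k b u * n u))"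
        using l by (simp add: abs_mult exponential_density_nonneg mult.assoc)
    qed
  qed measurable
  have qn: "integrable lborel (\<lambda>u. q u * n u)"
    "(\<integral>u. q u * n u \<partial>lborel) = (\<integral>u. indicator {a<..b} u * n u \<partial>lborel) + (av a - av b) / l"
  proof -
    have eq: "q u * n u = indicator {a<..b} u * n u + (?k a u * n u - ?k b u * n u) / l" for u
      using l by (simp add: q_def field_simps)
    show "integrable lborel (\<lambda>u. q u * n u)" unfolding eq using n_int kn by auto
    show "(\<integral>u. q u * n u \<partial>lborel) = (\<integral>u. indicator {a<..b} u * n u \<partial>lborel) + (av a - av b) / l"
      unfolding eq using n_int kn by simp
  qed
  \<comment> \<open>Not visible from the formula for \<open>q\<close>, but clear from the integral
    it represents; it lets the absolute value pass to \<open>n\<close> in the integrability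
    condition of Fubini's theorem.\<close>
  have q_nonneg: "q u \<ge> 0" for u
  proof -
    have "q u = (\<integral>s. indicator {a..b} s * ?k s u \<partial>lborel)"
      using ker[of u] by (simp add: has_bochner_integral_iff)
    also have "\<dots> \<ge> 0"
      using l by (intro Bochner_Integration.integral_nonneg) (simp add: exponential_density_nonneg)
    finally show ?thesis .
  qed
  have I: "integrable (lborel \<Otimes>\<^sub>M lborel) (\<lambda>(u, s). ?F u s)"
  proof (rule lborel_pair.Fubini_integrable)
    have "(\<integral>s. norm (case (u, s) of (u, s) \<Rightarrow> ?F u s) \<partial>lborel) = q u * \<bar>n u\<bar>" for u
    proof -
      have "(\<integral>s. norm (case (u, s) of (u, s) \<Rightarrow> ?F u s) \<partial>lborel) =
          (\<integral>s. indicator {a..b} s * ?k s u * \<bar>n u\<bar> \<partial>lborel)"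
        using l by (intro Bochner_Integration.integral_cong) (auto simp: abs_mult exponential_density_nonneg)
      also have "\<dots> = q u * \<bar>n u\<bar>"
        using ker[of u] by (simp add: has_bochner_integral_iff)
      finally show ?thesis .
    qed
    moreover have "integrable lborel (\<lambda>u. q u * \<bar>n u\<bar>)"
      using integrable_abs[OF qn(1)] q_nonneg by (simp add: abs_mult)
    ultimately show "integrable lborel (\<lambda>u. \<integral>s. norm (case (u, s) of (u, s) \<Rightarrow> ?F u s) \<partial>lborel)"
      by simp
    show "AE u in lborel. integrable lborel (\<lambda>s. case (u, s) of (u, s) \<Rightarrow> ?F u s)"
      using ker by (intro AE_I2) (simp add: has_bochner_integral_iff)
  qed measurable
  have inner: "(\<integral>u. ?F u s \<partial>lborel) = indicator {a..b} s * av s" for s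
    using kn(2)[of s] by (simp add: mult.assoc)
  have av_int: "integrable lborel (\<lambda>s. indicator {a..b} s * av s)"
    using lborel_pair.integrable_snd[OF I] by (simp add: inner)
  have "(\<integral>s. indicator {a..b} s * av s \<partial>lborel) = (\<integral>s. \<integral>u. ?F u s \<partial>lborel \<partial>lborel)"
    by (simp add: inner)
  also have "\<dots> = (\<integral>u. \<integral>s. ?F u s \<partial>lborel \<partial>lborel)"
    by (rule lborel_pair.Fubini_integral[OF I])
  also have "\<dots> = (\<integral>u. q u * n u \<partial>lborel)"
    using ker by (simp add: has_bochner_integral_iff)
  finally have eq: "(\<integral>s. indicator {a..b} s * av s \<partial>lborel) =
      (\<integral>u. indicator {a<..b} u * n u \<partial>lborel) + (av a - av b) / l"
    by (simp add: qn)
  have ae: "AE u in lborel. indicator {a<..b} u * n u = indicator {a..b} u * n u"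
    using AE_lborel_singleton[of a] by eventually_elim (auto simp: indicator_def)
  have n_int': "integrable lborel (\<lambda>u. indicator {a..b} u * n u)"
    using n_int by (subst integrable_cong_AE[OF _ _ ae, symmetric]) auto
  have n_eq: "(\<integral>u. indicator {a<..b} u * n u \<partial>lborel) = (\<integral>u. indicator {a..b} u * n u \<partial>lborel)"
    by (intro integral_cong_AE ae) auto
  have "integrable lborel (\<lambda>s. indicator {a..b} s * n s - indicator {a..b} s * av s)"
    using n_int' av_int by (rule Bochner_Integration.integrable_diff)
  then show "set_integrable lborel {a..b} (\<lambda>s. n s - av s)"
    by (simp add: set_integrable_def right_diff_distrib)
  have "(LBINT s:{a..b}. n s - av s) = (\<integral>s. indicator {a..b} s * n s \<partial>lborel) - (\<integral>s. indicator {a..b} s * av s \<partial>lborel)"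
    using n_int' av_int by (simp add: set_lebesgue_integral_def right_diff_distrib)
  then have "(LBINT s:{a..b}. n s - av s) = - ((av a - av b) / l)"
    using eq n_eq by linarith
  then show "av b - av a = l * (LBINT s:{a..b}. n s - av s)"
    using l by simp
qed

text \<open>The value \<open>n 0\<close> stays in the equation because \<open>N 0\<close> vanishes
  only almost surely.\<close>

lemma
  fixes n :: "real \<Rightarrow> real"
  assumes l: "l > 0" and n: "n \<in> borel_measurable borel"
    and int: "\<And>t. integrable (expW l) (\<lambda>v. n (t - v))"
  defines "y \<equiv> \<lambda>t. n t - (\<integral>v. n (t - v) \<partial>expW l)"
  shows interval_integrable_exp_solution: "interval_lebesgue_integrable lborel (ereal 0) (ereal t) y"
    and exp_solution: "y t = y 0 - l * (LBINT s=ereal 0..ereal t. y s) + (n t - n 0)"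
proof -
  note si = set_integrable_minus_exp_average[OF l n int, folded y_def]
    and inc = exp_average_increment[OF l n int, folded y_def]
  have av: "(\<integral>v. n (t - v) \<partial>expW l) = n t - y t" for t by (simp add: y_def)
  show "interval_lebesgue_integrable lborel (ereal 0) (ereal t) y"
    unfolding interval_lebesgue_integrable_def using si[of 0 t] si[of t 0]
    by (auto intro: set_integrable_subset)
  show "y t = y 0 - l * (LBINT s=ereal 0..ereal t. y s) + (n t - n 0)"
  proof (cases "0 \<le> t")
    case True
    then show ?thesis using inc[OF True] unfolding av by (simp add: interval_integral_Icc)
  next
    case False
    then show ?thesis using inc[of t 0] unfolding av
      by (simp add: interval_integral_endpoints_reverse[of "ereal 0"] interval_integral_Icc)
  qed
qed

text \<open>\<open>d\<close> is only known to be integrable. The equation first makes it continuous,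
  then differentiable with d' = -l d, and exp (l x) is the integrating factor.\<close>

lemma integral_equation_unique:
  fixes d :: "real \<Rightarrow> real"
  assumes int: "\<And>t. interval_lebesgue_integrable lborel (ereal 0) (ereal t) d"
    and eq: "\<And>t. d t = d 0 - l * (LBINT s=ereal 0..ereal t. d s)"
  shows "d t = d 0 * exp (- l * t)"
proof -
  \<comment> \<open>A compact window that contains \<open>t\<close> and has 0 in its interior.
    Starting the indefinite integral at \<open>- R\<close> treats positive and negative times
    alike.\<close>
  define R where "R = \<bar>t\<bar> + 1"
  have R: "R > 0" "t \<in> {-R..R}" by (auto simp: R_def)
  define J where "J x = integral {-R..x} d" for x
  have right: "set_integrable lborel {0<..<x} d" if "0 \<le> x" for x
    using int[of x] that by (simp add: interval_lebesgue_integrable_def)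
  have left: "set_integrable lborel {x<..<0} d" if "x \<le> 0" for x
    using int[of x] that by (cases "x = 0") (auto simp: interval_lebesgue_integrable_def)
  have HK_right: "d integrable_on {0..x}" "(LBINT s=ereal 0..ereal x. d s) = integral {0..x} d" if "0 \<le> x" for x
    using set_borel_integral_eq_integral[OF right[OF that]] that
    by (auto simp: interval_lebesgue_integral_def integrable_on_Icc_iff_Ioo integral_open_interval_real)
  have HK_left: "d integrable_on {x..0}" "(LBINT s=ereal 0..ereal x. d s) = - integral {x..0} d" if "x \<le> 0" for x
  proof -
    have "d integrable_on {x<..<0}" "(LBINT s:{x<..<0}. d s) = integral {x<..<0} d"
      by (rule set_borel_integral_eq_integral[OF left[OF that]])+
    moreover have "(LBINT s=ereal 0..ereal x. d s) = - (LBINT s:{x<..<0}. d s)"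
      using that by (cases "x = 0") (simp_all add: interval_lebesgue_integral_def set_lebesgue_integral_def)
    ultimately show "d integrable_on {x..0}" "(LBINT s=ereal 0..ereal x. d s) = - integral {x..0} d"
      by (simp_all only: integrable_on_Icc_iff_Ioo integral_open_interval_real)
  qed
  have d_int: "d integrable_on {-R..R}"
    using HK_left(1)[of "-R"] HK_right(1)[of R] R by (intro Henstock_Kurzweil_Integration.integrable_combine[of "-R" 0 R]) auto
  have I: "(LBINT s=ereal 0..ereal x. d s) = J x - J 0" if "x \<in> {-R..R}" for x
  proof (cases "0 \<le> x")
    case True
    have "J 0 + integral {0..x} d = J x"
      unfolding J_def using that True R
      by (intro Henstock_Kurzweil_Integration.integral_combine integrable_subinterval_real[OF d_int]) auto
    then show ?thesis using HK_right(2)[OF True] by simp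
  next
    case False
    have "J x + integral {x..0} d = J 0"
      unfolding J_def using that False R
      by (intro Henstock_Kurzweil_Integration.integral_combine integrable_subinterval_real[OF d_int]) auto
    then show ?thesis using HK_left(2)[of x] False by simp
  qed
  have d_eq: "d x = d 0 - l * (J x - J 0)" if "x \<in> {-R..R}" for x
    using eq[of x] I[OF that] by simp
  have "continuous_on {-R..R} (\<lambda>x. d 0 - l * (J x - J 0))"
    unfolding J_def using indefinite_integral_continuous_1[OF d_int] by (intro continuous_intros)
  then have d_cont: "continuous_on {-R..R} d"
    by (rule continuous_on_eq) (rule d_eq[symmetric])
  have "\<exists>c. \<forall>x\<in>{-R..R}. exp (l * x) * (d 0 - l * (J x - J 0)) = c"
  proof (rule has_field_derivative_zero_constant)
    fix x assume x: "x \<in> {-R..R}"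
    have J': "(J has_real_derivative d x) (at x within {-R..R})"
      using integral_has_vector_derivative[OF d_cont x]
      by (simp add: J_def[abs_def] has_real_derivative_iff_has_vector_derivative)
    have "((\<lambda>x. exp (l * x) * (d 0 - l * (J x - J 0))) has_real_derivative
        l * exp (l * x) * (d 0 - l * (J x - J 0)) - l * d x * exp (l * x)) (at x within {-R..R})"
      by (auto intro!: derivative_eq_intros J')
    then show "((\<lambda>x. exp (l * x) * (d 0 - l * (J x - J 0))) has_real_derivative 0) (at x within {-R..R})"
      unfolding d_eq[OF x, symmetric] by (simp add: mult_ac)
  qed auto
  then obtain c where "\<And>x. x \<in> {-R..R} \<Longrightarrow> exp (l * x) * (d 0 - l * (J x - J 0)) = c"
    by blast
  then have c: "exp (l * x) * d x = c" if "x \<in> {-R..R}" for x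
    using that d_eq[OF that] by simp
  have "exp (l * t) * d t = exp (l * 0) * d 0"
    using c[OF R(2)] c[of 0] R by simp
  then have "d t = d 0 / exp (l * t)" by (simp add: field_simps)
  then show ?thesis by (simp add: exp_minus field_simps)
qed

section \<open>Existence and uniqueness of the stationary solution\<close>

lemma (in prob_space) stationary_tail:
  assumes st: "stationary M X" and [measurable]: "\<And>t. X t \<in> borel_measurable M"
  shows "prob {\<omega> \<in> space M. \<bar>X h \<omega>\<bar> > c} = prob {\<omega> \<in> space M. \<bar>X 0 \<omega>\<bar> > c}"
proof -
  let ?B = "{f \<in> space (PiM {0::real} (\<lambda>_. borel)). \<bar>f 0\<bar> > (c::real)}"
  have B: "?B \<in> sets (PiM {0} (\<lambda>_. borel))" by measurable
  have *: "measure (fdd M U {0}) ?B = prob {\<omega> \<in> space M. \<bar>U 0 \<omega>\<bar> > c}"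
    if [measurable]: "\<And>t. U t \<in> borel_measurable M" for U
  proof -
    have "(\<lambda>\<omega>. \<lambda>t\<in>{0}. U t \<omega>) -` ?B \<inter> space M = {\<omega> \<in> space M. \<bar>U 0 \<omega>\<bar> > c}"
      by (auto simp: space_PiM)
    then show ?thesis
      unfolding fdd_def using B by (subst measure_distr) (auto intro!: measurable_restrict)
  qed
  have "fdd M (\<lambda>t. X (t + h)) {0} = fdd M X {0}"
    using st by (auto simp: stationary_def same_law_def)
  then show ?thesis using *[of "\<lambda>t. X (t + h)"] *[of X] by simp
qed

lemma (in prob_space) tendsto_tail:
  assumes [measurable]: "U \<in> borel_measurable M" and c: "filterlim c at_top sequentially"
  shows "(\<lambda>n. prob {\<omega> \<in> space M. \<bar>U \<omega>\<bar> > (c n :: real)}) \<longlonglongrightarrow> 0"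
proof -
  have "(\<lambda>n. expectation (indicator {\<omega> \<in> space M. \<bar>U \<omega>\<bar> > c n} :: _ \<Rightarrow> real)) \<longlonglongrightarrow> expectation (\<lambda>_. 0)"
  proof (rule integral_dominated_convergence[where w = "\<lambda>_. 1"])
    show "AE \<omega> in M. (\<lambda>n. indicator {\<omega> \<in> space M. \<bar>U \<omega>\<bar> > c n} \<omega> :: real) \<longlonglongrightarrow> 0"
    proof (rule AE_I2)
      fix \<omega>
      have "\<forall>\<^sub>F n in sequentially. \<bar>U \<omega>\<bar> \<le> c n"
        using c by (simp add: filterlim_at_top)
      then have "\<forall>\<^sub>F n in sequentially. indicator {\<omega> \<in> space M. \<bar>U \<omega>\<bar> > c n} \<omega> = (0::real)"
        by eventually_elim simp
      then show "(\<lambda>n. indicator {\<omega> \<in> space M. \<bar>U \<omega>\<bar> > c n} \<omega> :: real) \<longlonglongrightarrow> 0"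
        by (rule tendsto_eventually)
    qed
  qed (auto simp: indicator_def)
  then show ?thesis by simp
qed

section \<open>Solving the equation along paths and comparing solutions\<close>

context lfsm_noise
begin

lemma N_path_measurable: "\<omega> \<in> space M \<Longrightarrow> (\<lambda>t. N t \<omega>) \<in> borel_measurable borel"
  by measurable

text \<open>A single null set must serve uncountably many times. It is chosen for the natural
  numbers, and integrability passes from each of them to all earlier times.\<close>

lemma AE_integrable_N: "AE \<omega> in M. \<forall>t. integrable W (\<lambda>v. N (t - v) \<omega>)"
proof -
  have "AE \<omega> in M. \<forall>m::nat. integrable W (\<lambda>v. N (real m) \<omega> - N (real m - v) \<omega>)"
    using Y_eq_average by (auto simp: AE_all_countable)
  then show ?thesis using AE_space
  proof eventually_elim
    case (elim \<omega>)
    show ?case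
    proof
      fix t
      obtain m :: nat where m: "t \<le> real m" using real_arch_simple by blast
      have "integrable W (\<lambda>v. N (real m - v) \<omega>)"
        using Bochner_Integration.integrable_diff[OF W.integrable_const[of "N (real m) \<omega>"] elim(1)[rule_format, of m]]
        by simp
      then show "integrable W (\<lambda>v. N (t - v) \<omega>)"
        by (rule integrable_expW_earlier[OF l_pos N_path_measurable[OF elim(2)] _ m])
    qed
  qed
qed

lemma QOU_process_Y: "QOU_process M N l Y"
  unfolding QOU_process_def
proof (intro conjI allI Y_measurable stationary_Y)
  show "AE \<omega> in M. \<forall>t. interval_lebesgue_integrable lborel (ereal 0) (ereal t) (\<lambda>s. Y s \<omega>) \<and>
      Y t \<omega> = Y 0 \<omega> - l * (LBINT s=ereal 0..ereal t. Y s \<omega>) + N t \<omega>"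
    using AE_integrable_N N_0 AE_space
  proof eventually_elim
    case (elim \<omega>)
    have int: "integrable W (\<lambda>v. N (t - v) \<omega>)" for t using elim(1) by blast
    note sol = interval_integrable_exp_solution[OF l_pos N_path_measurable[OF elim(3)] int, folded Y_def]
      exp_solution[OF l_pos N_path_measurable[OF elim(3)] int, folded Y_def]
    show ?case
    proof (intro allI conjI)
      fix t
      show "interval_lebesgue_integrable lborel (ereal 0) (ereal t) (\<lambda>s. Y s \<omega>)"
        by (rule sol(1))
      show "Y t \<omega> = Y 0 \<omega> - l * (LBINT s=ereal 0..ereal t. Y s \<omega>) + N t \<omega>"
        using sol(2)[of t] elim(2) by linarith
    qed
  qed
qed

text \<open>Two solutions differ by a multiple of \<open>exp (- l t)\<close>; running back in time, stationarity
  forces the multiple to vanish.\<close>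
lemma QOU_process_unique:
  assumes X: "QOU_process M N l X" and Y': "QOU_process M N l Y'"
  shows "AE \<omega> in M. X t \<omega> = Y' t \<omega>"
proof -
  have [measurable]: "\<And>t. X t \<in> borel_measurable M" "\<And>t. Y' t \<in> borel_measurable M"
    and st: "stationary M X" "stationary M Y'"
    using X Y' by (auto simp: QOU_process_def)
  have "AE \<omega> in M. \<forall>t. interval_lebesgue_integrable lborel (ereal 0) (ereal t) (\<lambda>s. X s \<omega>) \<and>
      X t \<omega> = X 0 \<omega> - l * (LBINT s=ereal 0..ereal t. X s \<omega>) + N t \<omega>"
    "AE \<omega> in M. \<forall>t. interval_lebesgue_integrable lborel (ereal 0) (ereal t) (\<lambda>s. Y' s \<omega>) \<and>
      Y' t \<omega> = Y' 0 \<omega> - l * (LBINT s=ereal 0..ereal t. Y' s \<omega>) + N t \<omega>"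
    using X Y' by (auto simp: QOU_process_def)
  then have diff: "AE \<omega> in M. \<forall>t. X t \<omega> - Y' t \<omega> = (X 0 \<omega> - Y' 0 \<omega>) * exp (- l * t)"
  proof eventually_elim
    case (elim \<omega>)
    have int: "interval_lebesgue_integrable lborel (ereal 0) (ereal t) (\<lambda>s. X s \<omega>)"
      "interval_lebesgue_integrable lborel (ereal 0) (ereal t) (\<lambda>s. Y' s \<omega>)" for t
      using elim by blast+
    have eq: "X t \<omega> = X 0 \<omega> - l * (LBINT s=ereal 0..ereal t. X s \<omega>) + N t \<omega>"
      "Y' t \<omega> = Y' 0 \<omega> - l * (LBINT s=ereal 0..ereal t. Y' s \<omega>) + N t \<omega>" for t
      using elim by blast+
    show ?case
    proof
      fix t
      show "X t \<omega> - Y' t \<omega> = (X 0 \<omega> - Y' 0 \<omega>) * exp (- l * t)"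
      proof (rule integral_equation_unique[where d = "\<lambda>t. X t \<omega> - Y' t \<omega>"])
        fix t
        show "interval_lebesgue_integrable lborel (ereal 0) (ereal t) (\<lambda>t. X t \<omega> - Y' t \<omega>)"
          using int by (rule interval_lebesgue_integral_diff(1))
        have "(LBINT s=ereal 0..ereal t. X s \<omega> - Y' s \<omega>) =
            (LBINT s=ereal 0..ereal t. X s \<omega>) - (LBINT s=ereal 0..ereal t. Y' s \<omega>)"
          using int by (rule interval_lebesgue_integral_diff(2))
        then show "X t \<omega> - Y' t \<omega> = X 0 \<omega> - Y' 0 \<omega> - l * (LBINT s=ereal 0..ereal t. X s \<omega> - Y' s \<omega>)"
          using eq[of t] by (simp only: right_diff_distrib)
      qed
    qed
  qed
  have zero: "prob {\<omega> \<in> space M. \<bar>X 0 \<omega> - Y' 0 \<omega>\<bar> > \<delta>} = 0" if "\<delta> > 0" for \<delta>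
  proof -
    \<comment> \<open>If the difference at 0 exceeds \<delta>, at time -n it exceeds 2 c n, so one
      of the two processes exceeds c n there; by stationarity that has the same probability as at
      time 0.\<close>
    define c where "c n = \<delta> / 2 * exp (l * real n)" for n
    have c: "filterlim c at_top sequentially"
    proof -
      have "filterlim (\<lambda>n. l * real n) at_top sequentially"
        using l_pos by (intro filterlim_tendsto_pos_mult_at_top[OF tendsto_const] filterlim_real_sequentially)
      then have "filterlim (\<lambda>n. exp (l * real n)) at_top sequentially"
        by (rule filterlim_compose[OF exp_at_top])
      then show ?thesis
        unfolding c_def using that by (intro filterlim_tendsto_pos_mult_at_top[OF tendsto_const]) auto
    qed
    let ?P = "\<lambda>U n. prob {\<omega> \<in> space M. \<bar>U \<omega>\<bar> > c n}"
    have le: "prob {\<omega> \<in> space M. \<bar>X 0 \<omega> - Y' 0 \<omega>\<bar> > \<delta>} \<le> ?P (X 0) n + ?P (Y' 0) n" for n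
    proof -
      let ?A = "{\<omega> \<in> space M. \<bar>X (- real n) \<omega>\<bar> > c n}" and ?B = "{\<omega> \<in> space M. \<bar>Y' (- real n) \<omega>\<bar> > c n}"
      have "prob {\<omega> \<in> space M. \<bar>X 0 \<omega> - Y' 0 \<omega>\<bar> > \<delta>} \<le> prob (?A \<union> ?B)"
      proof (rule finite_measure_mono_AE)
        show "AE \<omega> in M. \<omega> \<in> {\<omega> \<in> space M. \<bar>X 0 \<omega> - Y' 0 \<omega>\<bar> > \<delta>} \<longrightarrow> \<omega> \<in> ?A \<union> ?B"
          using diff
        proof eventually_elim
          case (elim \<omega>)
          have "\<bar>X (- real n) \<omega> - Y' (- real n) \<omega>\<bar> = \<bar>X 0 \<omega> - Y' 0 \<omega>\<bar> * exp (l * real n)"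
            unfolding elim[rule_format, of "- real n"] by (simp add: abs_mult)
          moreover have "\<bar>X 0 \<omega> - Y' 0 \<omega>\<bar> * exp (l * real n) > 2 * c n" if "\<bar>X 0 \<omega> - Y' 0 \<omega>\<bar> > \<delta>"
            using that by (simp add: c_def)
          ultimately show ?case by auto
        qed
      qed measurable
      also have "\<dots> \<le> prob ?A + prob ?B" by (intro measure_Un_le) measurable
      also have "\<dots> = ?P (X 0) n + ?P (Y' 0) n"
        by (intro arg_cong2[where f = "(+)"] stationary_tail st) measurable
      finally show ?thesis .
    qed
    have "(\<lambda>n. ?P (X 0) n + ?P (Y' 0) n) \<longlonglongrightarrow> 0 + 0"
      by (intro tendsto_add tendsto_tail c) measurable
    then have "prob {\<omega> \<in> space M. \<bar>X 0 \<omega> - Y' 0 \<omega>\<bar> > \<delta>} \<le> 0 + 0"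
      by (rule LIMSEQ_le_const) (use le in blast)
    then show ?thesis using measure_nonneg[of M] by (metis add_0 order_antisym)
  qed
  have "AE \<omega> in M. \<forall>m::nat. \<not> \<bar>X 0 \<omega> - Y' 0 \<omega>\<bar> > 1 / real (Suc m)"
    unfolding AE_all_countable
  proof
    fix m
    show "AE \<omega> in M. \<not> \<bar>X 0 \<omega> - Y' 0 \<omega>\<bar> > 1 / real (Suc m)"
    proof (rule AE_I')
      have "{\<omega> \<in> space M. \<bar>X 0 \<omega> - Y' 0 \<omega>\<bar> > 1 / real (Suc m)} \<in> events" by measurable
      then show "{\<omega> \<in> space M. \<bar>X 0 \<omega> - Y' 0 \<omega>\<bar> > 1 / real (Suc m)} \<in> null_sets M"
        using zero[of "1 / real (Suc m)"] by (simp add: null_sets_def emeasure_eq_measure del: of_nat_Suc)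
    qed auto
  qed
  then have "AE \<omega> in M. X 0 \<omega> = Y' 0 \<omega>"
  proof eventually_elim
    case (elim \<omega>)
    show ?case
    proof (rule ccontr)
      assume "X 0 \<omega> \<noteq> Y' 0 \<omega>"
      then have "\<bar>X 0 \<omega> - Y' 0 \<omega>\<bar> > 0" by simp
      from nat_approx_posE[OF this] obtain m where "1 / real (Suc m) < \<bar>X 0 \<omega> - Y' 0 \<omega>\<bar>" by blast
      with elim show False by blast
    qed
  qed
  with diff show ?thesis
  proof eventually_elim
    case (elim \<omega>)
    have "X t \<omega> - Y' t \<omega> = (X 0 \<omega> - Y' 0 \<omega>) * exp (- l * t)" using elim(1) by blast
    then show ?case using elim(2) by simp
  qed
qed

text \<open>Both processes live on \<open>M\<close> and solve the equation with the same
  \<open>N\<close>, so they are modifications of each other.\<close>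

lemma QOU_process_same_law:
  assumes "QOU_process M N l X" "QOU_process M N l Y'"
  shows "same_law M X Y'"
  unfolding same_law_def fdd_def
proof (intro allI impI)
  fix J :: "real set" assume J: "finite J"
  have [measurable]: "\<And>t. X t \<in> borel_measurable M" "\<And>t. Y' t \<in> borel_measurable M"
    using assms by (auto simp: QOU_process_def)
  have "AE \<omega> in M. \<forall>t\<in>J. X t \<omega> = Y' t \<omega>"
    using J QOU_process_unique[OF assms] by (simp add: AE_finite_all)
  then show "distr M (PiM J (\<lambda>_. borel)) (\<lambda>\<omega>. \<lambda>t\<in>J. X t \<omega>) = distr M (PiM J (\<lambda>_. borel)) (\<lambda>\<omega>. \<lambda>t\<in>J. Y' t \<omega>)"
    by (intro distr_cong_AE) (auto intro!: measurable_restrict elim!: eventually_mono)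
qed

lemma QOU_process_has_stable_integral:
  assumes "QOU_process M N l X"
  shows "has_stable_integral M \<alpha> Z (\<lambda>s. indicator {..t} s * psi \<alpha> H l (t - s)) (X t)"
  using assms QOU_process_unique[OF QOU_process_Y assms]
  by (intro has_stable_integral_cong_AE[OF has_stable_integral_Y]) (auto simp: QOU_process_def)

end

section \<open>Asymptotics of the kernel\<close>

lemma c_H_pos:
  assumes "0 < H" "H < 1"
  shows "c_H H > 0"
proof -
  have "pi * H < pi * 1" using assms pi_gt_zero by (intro mult_strict_left_mono)
  then have "sin (pi * H) > 0" using assms by (intro sin_gt_zero) auto
  then have "2 * H * sin (pi * H) * Gamma (2 * H) > 0"
    using assms by (intro mult_pos_pos Gamma_real_pos) auto
  moreover have "Gamma (H + 1 / 2) > 0" using assms by (intro Gamma_real_pos) auto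
  ultimately show ?thesis by (simp add: c_H_def)
qed

text \<open>The integral in \<open>psi\<close> as a Henstock-Kurzweil integral, the form used for
  differentiating in the upper limit.\<close>

definition exp_powr_integral :: "real \<Rightarrow> real \<Rightarrow> real \<Rightarrow> real" where
  "exp_powr_integral l b t = integral {0..t} (\<lambda>u. exp (l * u) * u powr b)"

lemma
  fixes l b t :: real
  assumes b: "b > -1" and t: "t \<ge> 0"
  shows exp_powr_integrable_on: "(\<lambda>u. exp (l * u) * u powr b) integrable_on {0..t}"
    and exp_powr_LBINT: "(LBINT u=ereal 0..ereal t. exp (l * u) * u powr b) = exp_powr_integral l b t"
proof -
  have "set_integrable lborel {0<..<t} (\<lambda>u. exp (l * u) * u powr b)"
    unfolding set_integrable_def
  proof (rule Bochner_Integration.integrable_bound)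
    show "integrable lborel (\<lambda>u. exp (\<bar>l\<bar> * t) * (indicator {0<..t} u * u powr b))"
      using integrable_powr_indicator[OF b t] by (rule integrable_mult_right)
    show "AE u in lborel. norm (indicator {0<..<t} u *\<^sub>R (exp (l * u) * u powr b)) \<le>
        norm (exp (\<bar>l\<bar> * t) * (indicator {0<..t} u * u powr b))"
      by (intro AE_I2) (auto simp: indicator_def intro!: mult_right_mono mult_mono)
  qed measurable
  note set_borel_integral_eq_integral[OF this]
  then show "(\<lambda>u. exp (l * u) * u powr b) integrable_on {0..t}"
    and "(LBINT u=ereal 0..ereal t. exp (l * u) * u powr b) = exp_powr_integral l b t"
    using t by (simp_all add: interval_lebesgue_integral_def integrable_on_Icc_iff_Ioo
        integral_open_interval_real exp_powr_integral_def)
qed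

lemma psi_eq:
  assumes "H - 1 / \<alpha> > -1" "t \<ge> 0"
  shows "psi \<alpha> H l t = c_H H * (t powr (H - 1 / \<alpha>) - l * exp (- l * t) * exp_powr_integral l (H - 1 / \<alpha>) t)"
  using assms by (simp add: psi_def exp_powr_LBINT)

lemma exp_powr_integral_has_derivative:
  fixes l b t :: real
  assumes b: "b > -1" and t: "t > 0"
  shows "(exp_powr_integral l b has_real_derivative exp (l * t) * t powr b) (at t)"
proof -
  have "((\<lambda>x. integral {0..x} (\<lambda>u. exp (l * u) * u powr b)) has_vector_derivative exp (l * t) * t powr b)
      (at t within {0..t + 1} - {})"
    using t by (intro integral_has_vector_derivative_continuous_at exp_powr_integrable_on b continuous_intros) auto
  moreover have "at t within {0..t + 1} = at t"
    using t by (intro at_within_interior) auto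
  ultimately show ?thesis
    by (simp add: exp_powr_integral_def[abs_def] has_real_derivative_iff_has_vector_derivative)
qed

text \<open>The exponent l t + a ln t equals t times a factor that tends to l > 0.\<close>

lemma filterlim_exp_times_powr:
  fixes l a :: real
  assumes "l > 0"
  shows "filterlim (\<lambda>t. exp (l * t) * t powr a) at_top at_top"
proof -
  have "((\<lambda>t::real. l + a * (ln t / t)) \<longlongrightarrow> l + a * 0) at_top"
    by (intro tendsto_intros ln_x_over_x_tendsto_0)
  then have "filterlim (\<lambda>t. (l + a * (ln t / t)) * t) at_top at_top"
    using assms by (intro filterlim_tendsto_pos_mult_at_top[OF _ _ filterlim_ident]) auto
  then have "filterlim (\<lambda>t. exp ((l + a * (ln t / t)) * t)) at_top at_top"
    by (rule filterlim_compose[OF exp_at_top])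
  moreover have "\<forall>\<^sub>F t in at_top. exp ((l + a * (ln t / t)) * t) = exp (l * t) * t powr a"
    using eventually_gt_at_top[of "0::real"]
    by eventually_elim (simp add: powr_def distrib_right exp_add)
  ultimately show ?thesis by (simp cong: filterlim_cong)
qed

text \<open>Numerator and denominator are multiplied by exp (l t). In the derivative of
  \<open>?h\<close> the two terms l exp (l t) t^b cancel, which lowers the power by one and brings
  in the factor b. The form as a limit of quotients includes b = 0.\<close>

lemma tendsto_psi_at_top:
  assumes l: "l > 0" and b: "H - 1 / \<alpha> > -1"
  shows "((\<lambda>t. psi \<alpha> H l t / t powr (H - 1 / \<alpha> - 1)) \<longlongrightarrow> c_H H * (H - 1 / \<alpha>) / l) at_top"
proof -
  define b where "b = H - 1 / \<alpha>"
  let ?h = "\<lambda>t. exp (l * t) * t powr b - l * exp_powr_integral l b t"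
  let ?g = "\<lambda>t. exp (l * t) * t powr (b - 1)"
  let ?h' = "\<lambda>t. b * (exp (l * t) * t powr (b - 1))"
  let ?g' = "\<lambda>t. exp (l * t) * t powr (b - 1) * (l + (b - 1) / t)"
  have b': "b > -1" using b by (simp add: b_def)
  have pw: "t powr (b - 1 - 1) = t powr (b - 1) / t" if "t > 0" for t
    using that by (simp add: powr_diff power2_eq_square)
  have lim0: "((\<lambda>t::real. l + (b - 1) / t) \<longlongrightarrow> l + 0) at_top"
    by (intro tendsto_intros tendsto_divide_0[OF tendsto_const] filterlim_at_top_imp_at_infinity filterlim_ident)
  then have lim1: "((\<lambda>t::real. l + (b - 1) / t) \<longlongrightarrow> l) at_top" by simp
  have pos: "\<forall>\<^sub>F t::real in at_top. l + (b - 1) / t > 0"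
    using order_tendstoD(1)[OF lim1 l] .
  have "((\<lambda>t. ?h t / ?g t) \<longlongrightarrow> b / l) at_top"
  proof (rule lhospital_at_top_at_top)
    show "filterlim ?g at_top at_top" by (rule filterlim_exp_times_powr[OF l])
    show "\<forall>\<^sub>F t in at_top. ?g' t \<noteq> 0"
      using pos eventually_gt_at_top[of 0] by eventually_elim auto
    show "\<forall>\<^sub>F t in at_top. (?h has_real_derivative ?h' t) (at t)"
      using eventually_gt_at_top[of 0]
    proof eventually_elim
      case (elim t)
      show ?case
        using elim by (auto intro!: derivative_eq_intros exp_powr_integral_has_derivative b' simp: algebra_simps)
    qed
    show "\<forall>\<^sub>F t in at_top. (?g has_real_derivative ?g' t) (at t)"
      using eventually_gt_at_top[of 0]
    proof eventually_elim
      case (elim t)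
      have "(?g has_real_derivative l * exp (l * t) * t powr (b - 1) + (b - 1) * t powr (b - 1 - 1) * exp (l * t)) (at t)"
        using elim by (auto intro!: derivative_eq_intros)
      then show ?case unfolding pw[OF elim] by (simp add: distrib_left mult_ac)
    qed
    have "((\<lambda>t. b / (l + (b - 1) / t)) \<longlongrightarrow> b / l) at_top"
      using l by (intro tendsto_divide tendsto_const lim1) simp
    moreover have "\<forall>\<^sub>F t in at_top. b / (l + (b - 1) / t) = ?h' t / ?g' t"
      using eventually_gt_at_top[of 0] by eventually_elim simp
    ultimately show "((\<lambda>t. ?h' t / ?g' t) \<longlongrightarrow> b / l) at_top"
      by (rule Lim_transform_eventually)
  qed
  then have "((\<lambda>t. c_H H * (?h t / ?g t)) \<longlongrightarrow> c_H H * (b / l)) at_top"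
    by (intro tendsto_mult tendsto_const)
  moreover have "\<forall>\<^sub>F t in at_top. c_H H * (?h t / ?g t) = psi \<alpha> H l t / t powr (b - 1)"
    using eventually_gt_at_top[of 0]
  proof eventually_elim
    case (elim t)
    have "psi \<alpha> H l t = c_H H * (?h t / exp (l * t))"
      using elim by (simp add: psi_eq[OF b] b_def[symmetric] exp_minus field_simps)
    then show ?case by simp
  qed
  ultimately have "((\<lambda>t. psi \<alpha> H l t / t powr (b - 1)) \<longlongrightarrow> c_H H * (b / l)) at_top"
    by (rule Lim_transform_eventually)
  then show ?thesis by (simp add: b_def)
qed

text \<open>Bounding the exponential by its value at the upper limit shows that the integral term,
  relative to t^b, lies between 0 and l t / (b + 1).\<close>

lemma psi_asymp_equiv_at_0:
  assumes l: "l > 0" and b: "H - 1 / \<alpha> > -1" and c: "c_H H \<noteq> 0"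
  shows "psi \<alpha> H l \<sim>[at_right 0] (\<lambda>t. c_H H * t powr (H - 1 / \<alpha>))"
proof (rule asymp_equivI')
  define b where "b = H - 1 / \<alpha>"
  have b': "b > -1" using b by (simp add: b_def)
  let ?E = "exp_powr_integral l b"
  have E: "0 \<le> ?E t" "?E t \<le> exp (l * t) * (t powr (b + 1) / (b + 1))" if "t > 0" for t
  proof -
    show "0 \<le> ?E t" unfolding exp_powr_integral_def
      using that by (intro Henstock_Kurzweil_Integration.integral_nonneg exp_powr_integrable_on b') auto
    have hi: "((\<lambda>u. exp (l * t) * u powr b) has_integral exp (l * t) * (t powr (b + 1) / (b + 1))) {0..t}"
      using that by (intro has_integral_mult_right has_integral_powr_from_0 b') auto
    show "?E t \<le> exp (l * t) * (t powr (b + 1) / (b + 1))"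
      unfolding exp_powr_integral_def
    proof (rule has_integral_le[OF integrable_integral hi])
      show "(\<lambda>u. exp (l * u) * u powr b) integrable_on {0..t}"
        using that by (intro exp_powr_integrable_on b') auto
      show "exp (l * u) * u powr b \<le> exp (l * t) * u powr b" if "u \<in> {0..t}" for u
        using that l by (intro mult_right_mono) auto
    qed
  qed
  have "((\<lambda>t. 1 - l * exp (- l * t) * ?E t / t powr b) \<longlongrightarrow> 1 - 0) (at_right 0)"
  proof (intro tendsto_diff tendsto_const)
    have "((\<lambda>t::real. l * t / (b + 1)) \<longlongrightarrow> l * 0 / (b + 1)) (at_right 0)"
      using b' by (intro tendsto_intros) auto
    then have lim: "((\<lambda>t::real. l * t / (b + 1)) \<longlongrightarrow> 0) (at_right 0)" by simp
    show "((\<lambda>t. l * exp (- l * t) * ?E t / t powr b) \<longlongrightarrow> 0) (at_right 0)"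
    proof (rule tendsto_sandwich[OF _ _ tendsto_const lim])
      have ev: "\<forall>\<^sub>F t in at_right (0::real). t > 0" by (rule eventually_at_right_less)
      show "\<forall>\<^sub>F t in at_right 0. 0 \<le> l * exp (- l * t) * ?E t / t powr b"
        using ev by eventually_elim (use l E in auto)
      show "\<forall>\<^sub>F t in at_right 0. l * exp (- l * t) * ?E t / t powr b \<le> l * t / (b + 1)"
        using ev
      proof eventually_elim
        case (elim t)
        have "l * exp (- l * t) * ?E t / t powr b \<le>
            l * exp (- l * t) * (exp (l * t) * (t powr (b + 1) / (b + 1))) / t powr b"
          using l E[OF elim] by (intro divide_right_mono mult_left_mono) auto
        also have "\<dots> = l * (t powr (b + 1) / t powr b) / (b + 1)"
          by (simp add: exp_minus field_simps)
        also have "t powr (b + 1) / t powr b = t"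
          using elim by (simp add: powr_add)
        finally show ?case .
      qed
    qed
  qed
  moreover have "\<forall>\<^sub>F t in at_right 0. 1 - l * exp (- l * t) * ?E t / t powr b =
      psi \<alpha> H l t / (c_H H * t powr (H - 1 / \<alpha>))"
    using eventually_at_right_less[of 0]
    by eventually_elim (use c in \<open>simp add: psi_eq[OF b] b_def[symmetric] diff_divide_distrib\<close>)
  ultimately show "((\<lambda>t. psi \<alpha> H l t / (c_H H * t powr (H - 1 / \<alpha>))) \<longlongrightarrow> 1) (at_right 0)"
    using Lim_transform_eventually by fastforce
qed

text \<open>The behaviour at infinity is split because for H = 1/\<alpha> the constant is 0, and
  equivalence to the zero function would mean vanishing near infinity. There \<open>psi\<close>
  equals c_H exp (- l t) for t > 0, the classical Ornstein-Uhlenbeck kernel.\<close>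

theorem corollary4p3:
  fixes M :: "'w measure"
    and Z N :: "real \<Rightarrow> 'w \<Rightarrow> real"
    and \<alpha> H l :: real
  assumes "prob_space M"
    and "1 < \<alpha>" and "\<alpha> \<le> 2"
    and "0 < H" and "H < 1"
    and "0 < l"
    and "stable_levy_process M \<alpha> Z"
    and "centered M Z"
    and "linear_fractional_stable_motion M \<alpha> H Z N"
  shows "(\<exists>X. QOU_process M N l X) \<and>
    (\<forall>X Y. QOU_process M N l X \<longrightarrow> QOU_process M N l Y \<longrightarrow> same_law M X Y) \<and>
    (\<forall>X. QOU_process M N l X \<longrightarrow>
       (\<forall>t. has_stable_integral M \<alpha> Z (\<lambda>s. indicator {..t} s * psi \<alpha> H l (t - s)) (X t))) \<and>
    (H \<noteq> 1 / \<alpha> \<longrightarrow>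
       psi \<alpha> H l \<sim>[at_top] (\<lambda>t. c_H H * (H - 1 / \<alpha>) / l * t powr (H - 1 / \<alpha> - 1))) \<and>
    (H = 1 / \<alpha> \<longrightarrow> ((\<lambda>t. psi \<alpha> H l t / t powr (H - 1 / \<alpha> - 1)) \<longlongrightarrow> 0) at_top) \<and>
    psi \<alpha> H l \<sim>[at_right 0] (\<lambda>t. c_H H * t powr (H - 1 / \<alpha>))"
proof -
  interpret prob_space M by fact
  interpret lfsm_noise M \<alpha> Z H l N
    using assms by unfold_locales auto
  have c: "c_H H \<noteq> 0" using c_H_pos assms by force
  note lim = tendsto_psi_at_top[OF l_pos exponent_gt]
  have equiv: "psi \<alpha> H l \<sim>[at_top] (\<lambda>t. c_H H * (H - 1 / \<alpha>) / l * t powr (H - 1 / \<alpha> - 1))"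
    if "H \<noteq> 1 / \<alpha>"
  proof (rule asymp_equivI')
    let ?K = "c_H H * (H - 1 / \<alpha>) / l"
    have "?K \<noteq> 0" using that c l_pos by auto
    then have "((\<lambda>t. psi \<alpha> H l t / t powr (H - 1 / \<alpha> - 1) / ?K) \<longlongrightarrow> 1) at_top"
      using tendsto_divide[OF lim tendsto_const[of ?K]] by simp
    then show "((\<lambda>t. psi \<alpha> H l t / (?K * t powr (H - 1 / \<alpha> - 1))) \<longlongrightarrow> 1) at_top"
      by (simp only: divide_divide_eq_left mult.commute)
  qed
  show ?thesis
  proof (intro conjI allI impI)
    show "\<exists>X. QOU_process M N l X"
      using QOU_process_Y by blast
    show "((\<lambda>t. psi \<alpha> H l t / t powr (H - 1 / \<alpha> - 1)) \<longlongrightarrow> 0) at_top" if "H = 1 / \<alpha>"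
      using lim that by simp
    show "psi \<alpha> H l \<sim>[at_right 0] (\<lambda>t. c_H H * t powr (H - 1 / \<alpha>))"
      by (rule psi_asymp_equiv_at_0[OF l_pos exponent_gt c])
  qed (use equiv QOU_process_same_law QOU_process_has_stable_integral in blast)+
qed

end
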